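(* Let $n\ge 3$, let $(B_k)_{k\in\mathbb{N}}$ be a sequence of measurable subsets of $\mathbb{R}^n$, and let $f:\mathbb{N}\to(0,\infty)$ satisfy $\sum_{k\in\mathbb{N}}f(k)^{-2}<\infty$. Then for $\mu$-almost every $\Lambda\in X_n$ there is $k_0=k_0(\Lambda)$ such that for all $k\ge k_0$, $$\left|N(\Lambda,B_k)-|B_k|\right|<|B_k|^{1/2}f(k).$$
   Context: $X_n=SL(n,\mathbb{R})/SL(n,\mathbb{Z})$ is the space of unimodular lattices in $\mathbb{R}^n$, and $\mu$ is the $SL(n,\mathbb{R})$-invariant (Haar) probability measure on $X_n$. For $F\subset\mathbb{R}^n$ and $\Lambda\in X_n$, $N(\Lambda,F)=\#(\Lambda\cap F)$. $|B|$ denotes the Lebesgue measure of $B\subset\mathbb{R}^n$.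
   Formalization: Assumed for all large k: |B_k| is finite and positive, and if 0 lies in B_k then 1-|B_k| < |B_k|^{1/2} f(k). Without these the claim fails or is undefined, e.g. for empty B_k or for balls about 0 with |B_k| = f(k)^{-4}. *)

theory Defs
  imports "HOL-Probability.Probability"
begin

definition special_linear :: "(real ^ 'n ^ 'n) set" where
  "special_linear = {g. det g = 1}"

definition integer_vectors :: "(real ^ 'n) set" where
  "integer_vectors = {x. \<forall>i. x $ i \<in> \<int>}"

definition lattice_of :: "real ^ 'n ^ 'n \<Rightarrow> (real ^ 'n) set" where
  "lattice_of g = (\<lambda>v. g *v v) ` integer_vectors"

text \<open>The coset of \<open>g\<close> in \<open>SL(n,\<real>)/SL(n,\<int>)\<close> is identified with the lattice \<open>g \<int>\<^sup>n\<close>: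
  two matrices in \<open>SL(n,\<real>)\<close> generate the same lattice iff they lie in the same coset.\<close>

definition unimodular_lattices :: "(real ^ 'n) set set" where
  "unimodular_lattices = lattice_of ` special_linear"

text \<open>Borel sigma-algebra of the quotient topology that \<open>lattice_of\<close> induces from \<open>SL(n,\<real>)\<close>,
  which itself carries the subspace topology of the space of all matrices. Only the underlying
  sigma-algebra of this measure is meaningful.\<close>

definition lattice_borel :: "(real ^ 'n) set measure" where
  "lattice_borel = sigma unimodular_lattices
     {U. U \<subseteq> unimodular_lattices \<and>
         openin (top_of_set special_linear) {g \<in> special_linear. lattice_of g \<in> U}}"

text \<open>The left action of \<open>g\<close> sends a lattice \<open>\<Lambda>\<close> to \<open>g \<Lambda>\<close>, so it sends a set \<open>A\<close> of
  lattices to the set of all \<open>g \<Lambda>\<close> with \<open>\<Lambda> \<in> A\<close>. The \<open>SL(n,\<real>)\<close>-invariant Borel probability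
  measure on the space of lattices is unique, so the predicate below characterises it.\<close>

definition haar_probability :: "(real ^ 'n) set measure \<Rightarrow> bool" where
  "haar_probability \<mu> \<longleftrightarrow>
     prob_space \<mu> \<and> sets \<mu> = sets lattice_borel \<and>
     (\<forall>g \<in> special_linear. \<forall>A \<in> sets \<mu>.
        emeasure \<mu> ((\<lambda>\<Lambda>. (\<lambda>v. g *v v) ` \<Lambda>) ` A) = emeasure \<mu> A)"

text \<open>Extended-real valued, because \<open>card\<close> would count an infinite intersection as \<open>0\<close>.
  The origin is counted whenever it lies in \<open>F\<close>.\<close>

definition lattice_count :: "(real ^ 'n) set \<Rightarrow> (real ^ 'n) set \<Rightarrow> ereal" where
  "lattice_count \<Lambda> F = (if finite (\<Lambda> \<inter> F) then ereal (real (card (\<Lambda> \<inter> F))) else \<infinity>)"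

end

theory Submission
  imports Defs "HOL-Library.Nat_Bijection"
begin

text \<open>The number of nonzero lattice points in \<open>B\<close> has mean \<open>|B|\<close> and variance at most \<open>C |B|\<close>, so the
  theorem follows from Chebyshev's inequality and the Borel-Cantelli lemma. The moments come from
  Rogers' formula: summing \<open>F\<close> over the linearly independent \<open>m\<close>-tuples of lattice vectors has
  expectation \<open>\<integral> F\<close> for \<open>m < n\<close>; it is used for \<open>m = 1\<close> and \<open>m = 2\<close>, and dependent pairs are integer
  multiples of a common lattice vector.

  By invariance, the lattice \<open>\<Lambda>\<close> may be replaced by \<open>a\<^sub>T u\<^sub>y \<Lambda>\<close>, where \<open>u\<^sub>y\<close> adds the combination
  \<open>\<Sum> y\<^sub>a v\<^sub>J\<^sub>a\<close> of \<open>m\<close> coordinates to another coordinate \<open>i0\<close>, and \<open>a\<^sub>T\<close> expands the coordinate \<open>i0\<close> by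
  \<open>T\<^sup>n\<^sup>-\<^sup>1\<close> and contracts the others by \<open>T\<close>. If \<open>F\<close> is continuous with compact support in the set where
  the \<open>m \<times> m\<close> minor of the coordinates \<open>J\<close> does not vanish, then after averaging over \<open>y\<close> the sum over
  any fixed lattice becomes, up to scaling, a Riemann sum of an equicontinuous family. Hence it
  converges to \<open>\<integral> F\<close> for every single lattice as \<open>T \<rightarrow> \<infinity>\<close>, and no reduction theory is needed.\<close>

section \<open>Lebesgue measure on tuples of vectors\<close>

text \<open>The dimension enters twice. A coordinate outside an \<open>m\<close> by \<open>m\<close>
  minor exists only for \<open>m < n\<close>, so pairs need \<open>n \<ge> 3\<close>. Moreover, both
  \<open>p z\<close> and \<open>q z\<close> lying in \<open>B\<close> confines \<open>z\<close> to a
  set of volume at most \<open>|B|\<close> times the power \<open>- n\<close> of the larger of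
  \<open>|p|\<close> and \<open>|q|\<close>, and the sum of these powers over all non-zero
  \<open>p\<close> and \<open>q\<close> converges exactly for \<open>n \<ge> 3\<close>. The origin
  lies in every lattice, so it is kept out of the mean value formula and treated apart. It shifts
  the count by 1, which half of the tolerance \<open>s = |B|^(1/2) f\<close> absorbs if
  \<open>s \<ge> 2\<close>. If \<open>s < 2\<close>, then \<open>|B| < 4 / f^2\<close> is itself
  summable, and Markov's inequality shows that for almost every lattice \<open>B\<close> eventually
  contains no non-zero lattice point. The restriction to a non-zero minor is what lets the
  \<open>m\<close> shear parameters move the \<open>m\<close> entries with index \<open>i0\<close>
  freely; finitely many minors cover all tuples of rank \<open>m\<close>.\<close>

lemma nn_integral_lborel_translate:
  fixes h :: "'a::euclidean_space \<Rightarrow> ennreal"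
  assumes [measurable]: "h \<in> borel_measurable borel"
  shows "(\<integral>\<^sup>+x. h (x + a) \<partial>lborel) = (\<integral>\<^sup>+x. h x \<partial>lborel)"
proof -
  have "(\<integral>\<^sup>+x. h x \<partial>lborel) = (\<integral>\<^sup>+x. h x \<partial>distr lborel borel ((+) a))"
    by (simp add: lborel_distr_plus)
  also have "\<dots> = (\<integral>\<^sup>+x. h (a + x) \<partial>lborel)"
    by (subst nn_integral_distr) auto
  finally show ?thesis by (simp add: add.commute)
qed

text \<open>Inserting a probability density \<open>k\<close> on the space of shear parameters turns the shear into
  translations, of \<open>x\<close> for fixed \<open>t\<close> and of \<open>t\<close> for fixed \<open>x\<close>.\<close>

lemma nn_integral_lborel_shear:
  fixes h :: "'a::euclidean_space \<Rightarrow> ennreal" and \<iota> :: "'b::euclidean_space \<Rightarrow> 'a"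
  assumes [measurable]: "h \<in> borel_measurable borel" "\<phi> \<in> borel_measurable borel"
    and lin: "linear \<iota>" and inv: "\<And>x t. \<phi> (x + \<iota> t) = \<phi> x"
  shows "(\<integral>\<^sup>+x. h (x + \<iota> (\<phi> x)) \<partial>lborel) = (\<integral>\<^sup>+x. h x \<partial>lborel)"
proof -
  have [measurable]: "\<iota> \<in> borel_measurable borel"
    using lin by (intro borel_measurable_continuous_onI linear_continuous_on) (simp add: linear_linear)
  define k :: "'b \<Rightarrow> ennreal" where "k = indicator (cbox 0 One)"
  have [measurable]: "k \<in> borel_measurable borel" by (simp add: k_def)
  have k1: "(\<integral>\<^sup>+t. k (t + a) \<partial>lborel) = 1" for a
    by (subst nn_integral_lborel_translate) (simp_all add: k_def emeasure_lborel_cbox_eq)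
  have "(\<integral>\<^sup>+x. h (x + \<iota> (\<phi> x)) \<partial>lborel)
      = (\<integral>\<^sup>+x. (\<integral>\<^sup>+t. k t * h (x + \<iota> (\<phi> x)) \<partial>lborel) \<partial>lborel)"
    using k1[of 0] by (simp add: nn_integral_multc)
  also have "\<dots> = (\<integral>\<^sup>+t. (\<integral>\<^sup>+x. k t * h (x + \<iota> (\<phi> x)) \<partial>lborel) \<partial>lborel)"
    by (rule lborel_pair.Fubini') measurable
  also have "\<dots> = (\<integral>\<^sup>+t. (\<integral>\<^sup>+x. k t * h ((x + \<iota> t) + \<iota> (\<phi> (x + \<iota> t))) \<partial>lborel) \<partial>lborel)"
    by (intro nn_integral_cong nn_integral_lborel_translate[symmetric]) measurable
  also have "\<dots> = (\<integral>\<^sup>+t. (\<integral>\<^sup>+x. k t * h (x + \<iota> (t + \<phi> x)) \<partial>lborel) \<partial>lborel)"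
    by (simp add: inv linear_add[OF lin] add.assoc)
  also have "\<dots> = (\<integral>\<^sup>+x. (\<integral>\<^sup>+t. k t * h (x + \<iota> (t + \<phi> x)) \<partial>lborel) \<partial>lborel)"
    by (rule lborel_pair.Fubini') measurable
  also have "\<dots> = (\<integral>\<^sup>+x. (\<integral>\<^sup>+t. k (t + - \<phi> x) * h (x + \<iota> t) \<partial>lborel) \<partial>lborel)"
  proof (rule nn_integral_cong)
    fix x
    show "(\<integral>\<^sup>+t. k t * h (x + \<iota> (t + \<phi> x)) \<partial>lborel) = (\<integral>\<^sup>+t. k (t + - \<phi> x) * h (x + \<iota> t) \<partial>lborel)"
      by (subst nn_integral_lborel_translate[symmetric, where a = "\<phi> x"]) (simp_all add: add.assoc)
  qed
  also have "\<dots> = (\<integral>\<^sup>+t. (\<integral>\<^sup>+x. k (t + - \<phi> x) * h (x + \<iota> t) \<partial>lborel) \<partial>lborel)"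
    by (rule lborel_pair.Fubini') measurable
  also have "\<dots> = (\<integral>\<^sup>+t. (\<integral>\<^sup>+x. k (t + - \<phi> x) * h x \<partial>lborel) \<partial>lborel)"
  proof (rule nn_integral_cong)
    fix t
    show "(\<integral>\<^sup>+x. k (t + - \<phi> x) * h (x + \<iota> t) \<partial>lborel) = (\<integral>\<^sup>+x. k (t + - \<phi> x) * h x \<partial>lborel)"
      using nn_integral_lborel_translate[of "\<lambda>x. k (t + - \<phi> x) * h x" "\<iota> t"] by (simp add: inv)
  qed
  also have "\<dots> = (\<integral>\<^sup>+x. (\<integral>\<^sup>+t. k (t + - \<phi> x) * h x \<partial>lborel) \<partial>lborel)"
    by (rule lborel_pair.Fubini') measurable
  also have "\<dots> = (\<integral>\<^sup>+x. h x \<partial>lborel)"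
    by (simp add: nn_integral_multc k1 del: add_uminus_conv_diff)
  finally show ?thesis .
qed

text \<open>The preimage of a box is a box with the same side lengths in another order. Needed for
  coordinate swaps and for identifying \<open>real ^ 'n ^ 1\<close> with
  \<open>real ^ 'n\<close>.\<close>

lemma lborel_distr_basis_bij:
  fixes f :: "'a::euclidean_space \<Rightarrow> 'b::euclidean_space"
  assumes lin: "linear f" and bij: "bij_betw f Basis Basis"
  shows "distr lborel borel f = lborel"
proof (rule lborel_eqI[symmetric])
  have [measurable]: "f \<in> borel_measurable borel"
    using lin by (intro borel_measurable_continuous_onI linear_continuous_on) (simp add: linear_linear)
  show "sets (distr lborel borel f) = sets borel" by simp
  fix l u :: 'b assume le: "\<And>b. b \<in> Basis \<Longrightarrow> l \<bullet> b \<le> u \<bullet> b"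
  define g :: "'b \<Rightarrow> 'a" where "g l = (\<Sum>c\<in>Basis. (l \<bullet> f c) *\<^sub>R c)" for l
  have g: "g l \<bullet> c = l \<bullet> f c" if "c \<in> Basis" for c l
    using that by (simp add: g_def)
  have fB: "f c \<in> Basis" if "c \<in> Basis" for c
    using bij that by (auto simp: bij_betw_def)
  have f: "f x \<bullet> f c = x \<bullet> c" if c: "c \<in> Basis" for x c
  proof -
    have "f x = (\<Sum>b\<in>Basis. (x \<bullet> b) *\<^sub>R f b)"
      by (subst (1) euclidean_representation[of x, symmetric])
         (simp add: linear_sum[OF lin] linear_scale[OF lin])
    also have "\<dots> \<bullet> f c = (\<Sum>b\<in>Basis. (x \<bullet> b) * (f b \<bullet> f c))"
      by (simp add: inner_sum_left)
    also have "\<dots> = (\<Sum>b\<in>Basis. if b = c then x \<bullet> b else 0)"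
    proof (intro sum.cong refl)
      fix b :: 'a assume b: "b \<in> Basis"
      have "f b = f c \<longleftrightarrow> b = c"
        using bij b c by (auto simp: bij_betw_def inj_on_def)
      then show "(x \<bullet> b) * (f b \<bullet> f c) = (if b = c then x \<bullet> b else 0)"
        using fB[OF b] fB[OF c] by (simp add: inner_Basis)
    qed
    finally show ?thesis using c by simp
  qed
  have "f -` box l u = box (g l) (g u)"
  proof -
    have "(\<forall>b\<in>Basis. l \<bullet> b < f x \<bullet> b \<and> f x \<bullet> b < u \<bullet> b) \<longleftrightarrow>
        (\<forall>c\<in>Basis. l \<bullet> f c < f x \<bullet> f c \<and> f x \<bullet> f c < u \<bullet> f c)" for x
      unfolding bij_betw_imp_surj_on[OF bij, symmetric] by simp
    then show ?thesis by (auto simp: box_def g f)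
  qed
  then have "emeasure (distr lborel borel f) (box l u) = emeasure lborel (box (g l) (g u))"
    by (subst emeasure_distr) auto
  also have "\<dots> = (\<Prod>c\<in>Basis. (u - l) \<bullet> f c)"
    using le fB by (subst emeasure_lborel_box_eq) (auto simp: g inner_diff_left intro!: prod.cong)
  also have "\<dots> = (\<Prod>b\<in>Basis. (u - l) \<bullet> b)"
    by (simp only: prod.reindex_bij_betw[OF bij, of "\<lambda>b. (u - l) \<bullet> b"])
  finally show "emeasure (distr lborel borel f) (box l u) = (\<Prod>b\<in>Basis. (u - l) \<bullet> b)" .
qed

text \<open>An \<open>m\<close>-tuple of vectors is a matrix with the vectors as rows, so that it
  lives in a Euclidean space carrying \<open>lborel\<close>; in matrix terms \<open>A\<close> acts
  as right multiplication by its transpose.\<close>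

definition tuple_mult :: "real ^ 'n ^ 'n \<Rightarrow> real ^ 'n ^ 'm \<Rightarrow> real ^ 'n ^ 'm" where
  "tuple_mult A Z = (\<chi> k. A *v Z $ k)"

lemma tuple_mult_nth [simp]: "tuple_mult A Z $ k = A *v Z $ k"
  by (simp add: tuple_mult_def)

lemma tuple_mult_mult: "tuple_mult (A ** B) Z = tuple_mult A (tuple_mult B Z)"
  by (simp add: vec_eq_iff matrix_vector_mul_assoc)

lemma linear_tuple_mult: "linear (tuple_mult A)"
  by (rule linearI) (simp_all add: vec_eq_iff matrix_vector_right_distrib matrix_vector_mult_scaleR)

lemma continuous_on_tuple_mult [continuous_intros]:
  "continuous_on S f \<Longrightarrow> continuous_on S (\<lambda>x. tuple_mult A (f x))"
  by (rule continuous_on_compose2[of UNIV "tuple_mult A"])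
     (simp_all add: linear_continuous_on linear_linear linear_tuple_mult)

lemma borel_measurable_tuple_mult [measurable]: "tuple_mult A \<in> borel_measurable borel"
  by (intro borel_measurable_continuous_onI continuous_intros)

text \<open>The formula is stable under products of matrices, so elementary matrices suffice. Each
  of the \<open>m\<close> vectors contributes one factor \<open>\<bar>det A\<bar>\<close>; row
  operations are shears and come from \<open>nn_integral_lborel_shear\<close>.\<close>

lemma nn_integral_tuple_mult:
  fixes A :: "real ^ 'n ^ 'n" and h :: "real ^ 'n ^ 'm \<Rightarrow> ennreal"
  assumes "det A \<noteq> 0" "h \<in> borel_measurable borel"
  shows "ennreal (\<bar>det A\<bar> ^ CARD('m)) * (\<integral>\<^sup>+Z. h (tuple_mult A Z) \<partial>lborel) = (\<integral>\<^sup>+Z. h Z \<partial>lborel)"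
proof -
  \<comment> \<open>\<open>h\<close> is quantified inside \<open>P\<close> because a product
    \<open>A ** B\<close> needs the case \<open>B\<close> for \<open>h\<close> composed with
    \<open>tuple_mult A\<close>.\<close>
  define P where "P A \<longleftrightarrow> (det A \<noteq> 0 \<longrightarrow> (\<forall>h :: real ^ 'n ^ 'm \<Rightarrow> ennreal. h \<in> borel_measurable borel \<longrightarrow>
      ennreal (\<bar>det A\<bar> ^ CARD('m)) * (\<integral>\<^sup>+Z. h (tuple_mult A Z) \<partial>lborel) = (\<integral>\<^sup>+Z. h Z \<partial>lborel)))"
    for A :: "real ^ 'n ^ 'n"
  have "P A"
  proof (rule induct_matrix_elementary, goal_cases mult zero_row diagonal swap1 idplus)
    case (mult A B)
    show ?case unfolding P_def
    proof (intro impI allI)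
      fix h :: "real ^ 'n ^ 'm \<Rightarrow> ennreal"
      assume d: "det (A ** B) \<noteq> 0" and [measurable]: "h \<in> borel_measurable borel"
      have hA: "(\<lambda>Z. h (tuple_mult A Z)) \<in> borel_measurable borel" by measurable
      have "P B" "det B \<noteq> 0" "P A" "det A \<noteq> 0" using mult d by (auto simp: det_mul)
      have "ennreal (\<bar>det B\<bar> ^ CARD('m)) * (\<integral>\<^sup>+Z. h (tuple_mult A (tuple_mult B Z)) \<partial>lborel)
         = (\<integral>\<^sup>+Z. h (tuple_mult A Z) \<partial>lborel)"
        using \<open>P B\<close>[unfolded P_def, rule_format, OF \<open>det B \<noteq> 0\<close> hA] .
      moreover have "ennreal (\<bar>det A\<bar> ^ CARD('m)) * (\<integral>\<^sup>+Z. h (tuple_mult A Z) \<partial>lborel) = (\<integral>\<^sup>+Z. h Z \<partial>lborel)"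
        using \<open>P A\<close>[unfolded P_def, rule_format, OF \<open>det A \<noteq> 0\<close>] by simp
      ultimately show "ennreal (\<bar>det (A ** B)\<bar> ^ CARD('m)) * (\<integral>\<^sup>+Z. h (tuple_mult (A ** B) Z) \<partial>lborel) = (\<integral>\<^sup>+Z. h Z \<partial>lborel)"
        by (simp add: det_mul abs_mult power_mult_distrib ennreal_mult tuple_mult_mult mult.assoc)
    qed
  next
    case (zero_row A i)
    then show ?case by (simp add: P_def det_zero_row)
  next
    case (diagonal A)
    show ?case unfolding P_def
    proof (intro impI allI)
      fix h :: "real ^ 'n ^ 'm \<Rightarrow> ennreal"
      assume d: "det A \<noteq> 0" and [measurable]: "h \<in> borel_measurable borel"
      have dA: "det A = (\<Prod>i\<in>UNIV. A $ i $ i)" using det_diagonal diagonal by blast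
      then have nz: "A $ i $ i \<noteq> 0" for i using d by auto
      \<comment> \<open>\<open>lborel_affine_euclidean\<close> expects the scaling factors as a
        function on \<open>Basis\<close>, so \<open>c\<close> recovers the coordinate
        \<open>i\<close> from the basis vector.\<close>
      define c :: "real ^ 'n ^ 'm \<Rightarrow> real" where "c b = (THE a. \<exists>k i. b = axis k (axis i 1) \<and> a = A $ i $ i)" for b
      have c: "c (axis k (axis i 1)) = A $ i $ i" for k i
        unfolding c_def by (rule the_equality) (auto simp: axis_eq_axis)
      have B: "(Basis :: (real ^ 'n ^ 'm) set) = (\<lambda>(k, i). axis k (axis i 1)) ` UNIV"
        by (auto simp: Basis_vec_def)
      have inj: "inj (\<lambda>(k, i). axis k (axis i 1) :: real ^ 'n ^ 'm)"
        by (auto simp: inj_on_def axis_eq_axis)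
      have T: "0 + (\<Sum>j\<in>Basis. (c j * (Z \<bullet> j)) *\<^sub>R j) = tuple_mult A Z" for Z
      proof -
        have "A *v x = (\<chi> i. A $ i $ i * x $ i)" for x
        proof -
          have "(\<Sum>j\<in>UNIV. A $ i $ j * x $ j) = (\<Sum>j\<in>UNIV. if j = i then A $ i $ i * x $ i else 0)" for i
            using diagonal by (intro sum.cong) auto
          then show ?thesis by (simp add: vec_eq_iff matrix_vector_mult_def)
        qed
        then have "tuple_mult A Z \<bullet> axis k (axis i 1) = A $ i $ i * (Z \<bullet> axis k (axis i 1))" for k i
          by (simp add: inner_axis)
        then have "tuple_mult A Z \<bullet> b = c b * (Z \<bullet> b)" if "b \<in> Basis" for b
          using that c unfolding B by force
        then show ?thesis by (subst euclidean_eq_iff) simp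
      qed
      have "(\<Prod>j\<in>Basis. \<bar>c j\<bar>) = (\<Prod>(k::'m,i)\<in>UNIV. \<bar>A $ i $ i\<bar>)"
        unfolding B by (subst prod.reindex[OF inj]) (auto simp: c intro!: prod.cong)
      also have "\<dots> = (\<Prod>k::'m\<in>UNIV. \<Prod>i\<in>UNIV. \<bar>A $ i $ i\<bar>)"
        by (simp only: prod.cartesian_product UNIV_Times_UNIV)
      also have "\<dots> = \<bar>det A\<bar> ^ CARD('m)" by (simp add: dA abs_prod)
      finally have pr: "(\<Prod>j\<in>Basis. \<bar>c j\<bar>) = \<bar>det A\<bar> ^ CARD('m)" .
      have "lborel = density (distr lborel borel (tuple_mult A)) (\<lambda>_::real^'n^'m. \<bar>det A\<bar> ^ CARD('m))"
      proof -
        have "c j \<noteq> 0" if jB: "j \<in> Basis" for j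
        proof -
          obtain k i where "j = axis k (axis i 1)" using jB unfolding B by auto
          then show ?thesis using c nz by simp
        qed
        then show ?thesis using lborel_affine_euclidean[of c 0] unfolding T pr by simp
      qed
      then have "(\<integral>\<^sup>+Z. h Z \<partial>lborel) = (\<integral>\<^sup>+Z. h Z \<partial>density (distr lborel borel (tuple_mult A)) (\<lambda>_::real^'n^'m. \<bar>det A\<bar> ^ CARD('m)))"
        by (rule arg_cong)
      also have "\<dots> = ennreal (\<bar>det A\<bar> ^ CARD('m)) * (\<integral>\<^sup>+Z. h (tuple_mult A Z) \<partial>lborel)"
        by (simp add: nn_integral_density nn_integral_distr nn_integral_cmult)
      finally show "ennreal (\<bar>det A\<bar> ^ CARD('m)) * (\<integral>\<^sup>+Z. h (tuple_mult A Z) \<partial>lborel) = (\<integral>\<^sup>+Z. h Z \<partial>lborel)" ..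
    qed
  next
    case (swap1 m n)

    let ?A = "(\<chi> i j. mat 1 $ i $ Transposition.transpose m n j) :: real ^ 'n ^ 'n"
    have "det ?A = of_int (sign (Transposition.transpose m n))"
      using det_permute_columns[OF permutes_swap_id[of m UNIV n], of "mat 1"] by simp
    then have d: "\<bar>det ?A\<bar> = 1" by (simp add: sign_def)
    have mv: "?A *v x = (\<chi> i. x $ Transposition.transpose m n i)" for x
    proof -
      have "(\<Sum>j\<in>UNIV. mat 1 $ i $ Transposition.transpose m n j * x $ j)
         = (\<Sum>j\<in>UNIV. if j = Transposition.transpose m n i then x $ j else 0)" for i
        by (intro sum.cong) (auto simp: mat_def transpose_eq_iff)
      then show ?thesis by (simp add: vec_eq_iff matrix_vector_mult_def)
    qed
    have B: "(Basis :: (real ^ 'n ^ 'm) set) = (\<lambda>(k, i). axis k (axis i 1)) ` UNIV"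
      by (auto simp: Basis_vec_def)
    have ax: "tuple_mult ?A (axis k (axis i 1)) = (axis k (axis (Transposition.transpose m n i) 1) :: real^'n^'m)" for k i
      by (auto simp: vec_eq_iff mv axis_def transpose_eq_iff)
    have im: "tuple_mult ?A b \<in> Basis" if bB: "b \<in> Basis" for b :: "real^'n^'m"
    proof -
      obtain k i where "b = axis k (axis i 1)" using bB unfolding B by auto
      then show ?thesis using ax[of k i] unfolding B by auto
    qed
    have id: "tuple_mult ?A (tuple_mult ?A Z) = Z" for Z :: "real^'n^'m"
      by (simp add: vec_eq_iff mv)
    have "bij_betw (tuple_mult ?A) Basis (Basis :: (real^'n^'m) set)"
      by (rule bij_betw_byWitness[where f' = "tuple_mult ?A"]) (use id im in \<open>blast+\<close>)
    then have D: "distr lborel borel (tuple_mult ?A) = (lborel :: (real^'n^'m) measure)"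
      by (intro lborel_distr_basis_bij linear_tuple_mult)
    show ?case unfolding P_def d
    proof (intro impI allI)
      fix h :: "real ^ 'n ^ 'm \<Rightarrow> ennreal"
      assume [measurable]: "h \<in> borel_measurable borel"
      have "(\<integral>\<^sup>+Z. h Z \<partial>lborel) = (\<integral>\<^sup>+Z. h Z \<partial>distr lborel borel (tuple_mult ?A))"
        by (simp only: D)
      also have "\<dots> = (\<integral>\<^sup>+Z. h (tuple_mult ?A Z) \<partial>lborel)"
        by (subst nn_integral_distr) auto
      finally show "ennreal (1 ^ CARD('m)) * (\<integral>\<^sup>+Z. h (tuple_mult ?A Z) \<partial>lborel) = (\<integral>\<^sup>+Z. h Z \<partial>lborel)"
        by simp
    qed
  next
    case (idplus m n c)
    let ?A = "(\<chi> i j. if i = m \<and> j = n then c else of_bool (i = j)) :: real ^ 'n ^ 'n"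
    have "?A = (\<chi> k. if k = m then row m (mat 1) + c *s row n (mat 1) else row k (mat 1))"
      using idplus by (auto simp: vec_eq_iff row_def mat_def)
    then have d: "det ?A = 1"
      using det_row_operation[OF idplus, of "mat 1 :: real^'n^'n" c] by simp
    have mv: "?A *v x = x + c *\<^sub>R (x $ n) *\<^sub>R axis m 1" for x
    proof -
      have "(\<Sum>j\<in>UNIV. (if i = m \<and> j = n then c else of_bool (i = j)) * x $ j)
         = (\<Sum>j\<in>UNIV. (if j = i then x $ j else 0) + (if j = n then of_bool (i = m) * c * x $ j else 0))" for i
        using idplus by (intro sum.cong) auto
      then show ?thesis by (simp add: vec_eq_iff matrix_vector_mult_def sum.distrib axis_def)
    qed
    \<comment> \<open>One shear parameter for each vector of the tuple: \<open>\<phi>\<close> reads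
      coordinate \<open>n\<close>, \<open>\<iota>\<close> changes only coordinate \<open>m\<close>,
      and \<open>m \<noteq> n\<close> makes \<open>\<phi>\<close> invariant.\<close>
    define \<iota> :: "real ^ 'm \<Rightarrow> real ^ 'n ^ 'm" where "\<iota> t = (\<chi> k. t $ k *\<^sub>R axis m 1)" for t
    define \<phi> :: "real ^ 'n ^ 'm \<Rightarrow> real ^ 'm" where "\<phi> Z = (\<chi> k. c * Z $ k $ n)" for Z
    have tm: "tuple_mult ?A Z = Z + \<iota> (\<phi> Z)" for Z
      by (simp add: vec_eq_iff mv \<iota>_def \<phi>_def)
    have [measurable]: "\<phi> \<in> borel_measurable borel" unfolding \<phi>_def
      by (intro borel_measurable_continuous_onI continuous_intros)
    have lin: "linear \<iota>"
      by (rule linearI) (simp_all add: \<iota>_def vec_eq_iff algebra_simps)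
    have inv: "\<phi> (Z + \<iota> t) = \<phi> Z" for Z t
      using idplus by (simp add: \<phi>_def \<iota>_def vec_eq_iff axis_def)
    show ?case unfolding P_def d tm
    proof (intro impI allI)
      fix h :: "real ^ 'n ^ 'm \<Rightarrow> ennreal"
      assume [measurable]: "h \<in> borel_measurable borel"
      have "(\<integral>\<^sup>+Z. h (Z + \<iota> (\<phi> Z)) \<partial>lborel) = (\<integral>\<^sup>+Z. h Z \<partial>lborel)"
        by (rule nn_integral_lborel_shear[OF _ _ lin inv]) measurable
      then show "ennreal (\<bar>1\<bar> ^ CARD('m)) * (\<integral>\<^sup>+Z. h (Z + \<iota> (\<phi> Z)) \<partial>lborel) = (\<integral>\<^sup>+Z. h Z \<partial>lborel)"
        by (simp only: abs_one power_one ennreal_1 mult_1_left)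
    qed
  qed
  then show ?thesis using assms by (auto simp: P_def)
qed

text \<open>The case of 1-tuples, transported along \<open>Z $ 1\<close>. It serves the substitution
  in the shear parameter.\<close>

lemma nn_integral_matrix_vector_mult:
  fixes A :: "real ^ 'n ^ 'n" and h :: "real ^ 'n \<Rightarrow> ennreal"
  assumes d: "det A \<noteq> 0" and [measurable]: "h \<in> borel_measurable borel"
  shows "ennreal \<bar>det A\<bar> * (\<integral>\<^sup>+x. h (A *v x) \<partial>lborel) = (\<integral>\<^sup>+x. h x \<partial>lborel)"
proof -
  let ?f = "\<lambda>Z :: real ^ 'n ^ 1. Z $ 1"
  have lin: "linear ?f" by (rule linearI) auto
  have "bij_betw ?f Basis Basis"
    by (rule bij_betw_byWitness[where f' = "\<lambda>x. axis 1 x"]) (auto simp: Basis_vec_def axis_def vec_eq_iff)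
  then have D: "distr lborel borel ?f = lborel" by (rule lborel_distr_basis_bij[OF lin])
  have [measurable]: "?f \<in> borel_measurable borel"
    by (intro borel_measurable_continuous_onI continuous_intros)
  have [measurable]: "(*v) A \<in> borel_measurable borel"
    by (intro borel_measurable_continuous_onI linear_continuous_on) (simp add: matrix_vector_mul_linear linear_linear)
  have *: "(\<integral>\<^sup>+x. g x \<partial>lborel) = (\<integral>\<^sup>+Z. g (?f Z) \<partial>lborel)" if [measurable]: "g \<in> borel_measurable borel"
    for g :: "real ^ 'n \<Rightarrow> ennreal"
    by (subst D[symmetric], subst nn_integral_distr) auto
  show ?thesis
    using nn_integral_tuple_mult[of A "\<lambda>Z. h (?f Z)"] d by (simp add: *[of h] *[of "\<lambda>x. h (A *v x)"])
qed

section \<open>Tuples of lattice vectors\<close>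

lemma borel_measurable_vec_nth [measurable]:
  "(\<lambda>Z :: ('b :: topological_space) ^ 'm. Z $ k) \<in> borel_measurable borel"
  by (intro borel_measurable_continuous_onI continuous_intros)

text \<open>The product measure pushed forward to matrices agrees with \<open>lborel\<close> on
  boxes, hence everywhere. This turns the volume of the pairs with both entries in \<open>B\<close>
  into \<open>|B|^2\<close>.\<close>

lemma emeasure_lborel_tuples:
  fixes A :: "'m :: finite \<Rightarrow> (real ^ 'n) set"
  assumes A: "\<And>k. A k \<in> sets borel"
  shows "emeasure lborel {Z :: real ^ 'n ^ 'm. \<forall>k. Z $ k \<in> A k} = (\<Prod>k\<in>UNIV. emeasure lborel (A k))"
proof -
  interpret product_sigma_finite "\<lambda>_::'m. lborel :: (real ^ 'n) measure"
    by standard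
  let ?M = "Pi\<^sub>M (UNIV :: 'm set) (\<lambda>_. lborel :: (real ^ 'n) measure)"
  let ?f = "\<lambda>f :: 'm \<Rightarrow> real ^ 'n. \<chi> k. f k"
  have B: "(Basis :: (real ^ 'n ^ 'm) set) = (\<lambda>(k, b). axis k b) ` (UNIV \<times> Basis)"
    by (auto simp: Basis_vec_def)
  have inj: "inj_on (\<lambda>(k, b). axis k b :: real ^ 'n ^ 'm) (UNIV \<times> Basis)"
    by (auto simp: inj_on_def axis_eq_axis)
  have f[measurable]: "?f \<in> measurable ?M borel"
  proof (subst borel_measurable_euclidean_space, intro ballI)
    fix b :: "real ^ 'n ^ 'm" assume "b \<in> Basis"
    then obtain k i where b: "b = axis k i" unfolding B by auto
    show "(\<lambda>x. ?f x \<bullet> b) \<in> borel_measurable ?M"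
      by (simp add: b inner_axis)
  qed
  have pre: "emeasure (distr ?M borel ?f) {Z. \<forall>k. Z $ k \<in> A k} = (\<Prod>k\<in>UNIV. emeasure lborel (A k))"
    if A: "\<And>k. A k \<in> sets borel" for A
  proof -
    note A[measurable]
    have "{Z \<in> space borel. \<forall>k. (Z :: real ^ 'n ^ 'm) $ k \<in> A k} \<in> sets borel"
      by measurable
    then have "emeasure (distr ?M borel ?f) {Z. \<forall>k. Z $ k \<in> A k}
        = emeasure ?M (?f -` {Z. \<forall>k. Z $ k \<in> A k} \<inter> space ?M)"
      by (subst emeasure_distr) auto
    also have "?f -` {Z. \<forall>k. Z $ k \<in> A k} \<inter> space ?M = Pi\<^sub>E UNIV A"
      by (auto simp: space_PiM PiE_def)
    also have "emeasure ?M \<dots> = (\<Prod>k\<in>UNIV. emeasure lborel (A k))"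
      using A by (intro emeasure_PiM) auto
    finally show ?thesis .
  qed
  have "lborel = distr ?M borel ?f"
  proof (rule lborel_eqI)
    fix l u :: "real ^ 'n ^ 'm" assume le: "\<And>b. b \<in> Basis \<Longrightarrow> l \<bullet> b \<le> u \<bullet> b"
    have le': "l $ k \<bullet> b \<le> u $ k \<bullet> b" if "b \<in> Basis" for k b
      using le[of "axis k b"] that by (auto simp: inner_axis Basis_vec_def)
    have "box l u = {Z. \<forall>k. Z $ k \<in> box (l $ k) (u $ k)}"
      unfolding box_def B by (auto simp: inner_axis)
    then have "emeasure (distr ?M borel ?f) (box l u) = (\<Prod>k\<in>UNIV. emeasure lborel (box (l $ k) (u $ k)))"
      by (simp add: pre)
    also have "\<dots> = (\<Prod>k\<in>UNIV. ennreal (\<Prod>b\<in>Basis. (u $ k - l $ k) \<bullet> b))"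
      using le' by (intro prod.cong refl) (auto simp: emeasure_lborel_box_eq)
    also have "\<dots> = ennreal (\<Prod>k\<in>UNIV. \<Prod>b\<in>Basis. (u $ k - l $ k) \<bullet> b)"
      using le' by (intro prod_ennreal prod_nonneg) (auto simp: inner_diff_left)
    also have "(\<Prod>k\<in>UNIV. \<Prod>b\<in>Basis. (u $ k - l $ k) \<bullet> b) = (\<Prod>b\<in>Basis. (u - l) \<bullet> b)"
      unfolding B by (subst prod.reindex[OF inj]) (auto simp: prod.cartesian_product inner_axis intro!: prod.cong)
    finally show "emeasure (distr ?M borel ?f) (box l u) = (\<Prod>b\<in>Basis. (u - l) \<bullet> b)" .
  qed simp
  then show ?thesis using pre[OF A] by simp
qed

section \<open>Tuples of lattice vectors as corners of cells of volume 1\<close>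

definition tuples :: "(real ^ 'n) set \<Rightarrow> (real ^ 'n ^ 'm) set" where
  "tuples \<Lambda> = {W. \<forall>k. W $ k \<in> \<Lambda>}"

definition tuple_floor :: "real ^ 'n ^ 'm \<Rightarrow> real ^ 'n ^ 'm" where
  "tuple_floor Z = (\<chi> k i. of_int \<lfloor>Z $ k $ i\<rfloor>)"

lemma borel_measurable_vec2I:
  fixes f :: "'a \<Rightarrow> real ^ 'n ^ 'm"
  assumes "\<And>k i. (\<lambda>x. f x $ k $ i) \<in> borel_measurable M"
  shows "f \<in> borel_measurable M"
proof (subst borel_measurable_euclidean_space, intro ballI)
  fix b :: "real ^ 'n ^ 'm" assume "b \<in> Basis"
  then obtain k i where b: "b = axis k (axis i 1)" by (auto simp: Basis_vec_def)
  show "(\<lambda>x. f x \<bullet> b) \<in> borel_measurable M"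
    using assms by (simp add: b inner_axis)
qed

lemma borel_measurable_vec_nth2 [measurable]:
  "(\<lambda>Z :: real ^ 'n ^ 'm. Z $ k $ i) \<in> borel_measurable borel"
  by (intro borel_measurable_continuous_onI continuous_intros)

lemma borel_measurable_tuple_floor [measurable]: "tuple_floor \<in> borel_measurable borel"
  by (rule borel_measurable_vec2I) (simp add: tuple_floor_def)

lemma countable_integer_tuples: "countable (tuples integer_vectors :: (real ^ 'n ^ 'm) set)"
proof -
  have "W \<in> range (\<lambda>c :: 'm \<Rightarrow> 'n \<Rightarrow> int. \<chi> k i. of_int (c k i))"
    if W: "W \<in> tuples integer_vectors" for W :: "real ^ 'n ^ 'm"
  proof
    show "W = (\<chi> k i. of_int \<lfloor>W $ k $ i\<rfloor>)"
      using W by (simp add: tuples_def integer_vectors_def vec_eq_iff)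
  qed simp
  then have "tuples integer_vectors \<subseteq> range (\<lambda>c :: 'm \<Rightarrow> 'n \<Rightarrow> int. (\<chi> k i. of_int (c k i)) :: real ^ 'n ^ 'm)"
    by blast
  then show ?thesis by (rule countable_subset) simp
qed

text \<open>\<open>tuple_floor\<close> pushes \<open>lborel\<close> forward to counting measure: its
  fibre over an integer tuple is a half-open unit cube, squeezed between an open and a closed cube
  of volume 1.\<close>

lemma nn_integral_tuple_floor:
  fixes R :: "real ^ 'n ^ 'm \<Rightarrow> ennreal"
  shows "(\<integral>\<^sup>+Z. R (tuple_floor Z) \<partial>lborel) = (\<integral>\<^sup>+W. R W \<partial>count_space (tuples integer_vectors))"
proof -
  let ?I = "tuples integer_vectors :: (real ^ 'n ^ 'm) set"
  have mem: "tuple_floor Z \<in> ?I" for Z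
    by (simp add: tuples_def integer_vectors_def tuple_floor_def)
  have meas: "tuple_floor \<in> measurable lborel (count_space ?I)"
  proof (rule measurable_count_space_eq_countable[THEN iffD2])
    show "countable ?I" by (rule countable_integer_tuples)
    show "tuple_floor \<in> space lborel \<rightarrow> ?I \<and> (\<forall>a\<in>?I. tuple_floor -` {a} \<inter> space lborel \<in> sets lborel)"
      using mem measurable_sets[OF borel_measurable_tuple_floor, of "{a}" for a] by auto
  qed
  have one: "emeasure lborel (tuple_floor -` {c}) = 1" if c: "c \<in> ?I" for c
  proof -
    define u :: "real ^ 'n ^ 'm" where "u = (\<chi> k i. c $ k $ i + 1)"
    have S: "Z \<in> tuple_floor -` {c} \<longleftrightarrow> (\<forall>k i. c $ k $ i \<le> Z $ k $ i \<and> Z $ k $ i < u $ k $ i)" for Z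
    proof -
      have "of_int \<lfloor>Z $ k $ i\<rfloor> = c $ k $ i \<longleftrightarrow> c $ k $ i \<le> Z $ k $ i \<and> Z $ k $ i < c $ k $ i + 1" for k i
      proof -
        obtain m :: int where m: "c $ k $ i = of_int m"
          using c by (auto simp: tuples_def integer_vectors_def Ints_def)
        show ?thesis unfolding m by (simp add: floor_eq_iff)
      qed
      then show ?thesis by (auto simp: tuple_floor_def vec_eq_iff u_def)
    qed
    have B: "(Basis :: (real ^ 'n ^ 'm) set) = (\<lambda>(k, i). axis k (axis i 1)) ` UNIV"
      by (auto simp: Basis_vec_def)
    have le: "(u - c) \<bullet> b = 1" if "b \<in> Basis" for b
      using that unfolding B by (auto simp: inner_axis u_def)
    then have "c \<bullet> b \<le> u \<bullet> b" if "b \<in> Basis" for b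
      using that by (fastforce simp: inner_diff_left)
    then have e: "emeasure lborel (box c u) = 1" "emeasure lborel (cbox c u) = 1"
      using le by (simp_all add: emeasure_lborel_box_eq emeasure_lborel_cbox_eq)
    have "box c u \<subseteq> tuple_floor -` {c}" "tuple_floor -` {c} \<subseteq> cbox c u"
      unfolding subset_iff S box_def cbox_def B by (auto simp: inner_axis less_imp_le)
    moreover have "tuple_floor -` {c} \<in> sets lborel"
      using measurable_sets[OF borel_measurable_tuple_floor, of "{c}"] by simp
    ultimately show ?thesis
      by (intro antisym) (metis e emeasure_mono sets_lborel cbox_borel)+
  qed
  have "distr lborel (count_space ?I) tuple_floor = count_space ?I"
  proof (rule measure_eqI_countable[of _ ?I])
    show "countable ?I" by (rule countable_integer_tuples)
    fix c assume "c \<in> ?I"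
    then show "emeasure (distr lborel (count_space ?I) tuple_floor) {c} = emeasure (count_space ?I) {c}"
      using meas one by (simp add: emeasure_distr)
  qed auto
  then have "(\<integral>\<^sup>+W. R W \<partial>count_space ?I) = (\<integral>\<^sup>+W. R W \<partial>distr lborel (count_space ?I) tuple_floor)"
    by simp
  also have "\<dots> = (\<integral>\<^sup>+Z. R (tuple_floor Z) \<partial>lborel)"
    using meas by (subst nn_integral_distr) auto
  finally show ?thesis ..
qed

lemma tuples_lattice_of: "tuples (lattice_of A) = tuple_mult A ` tuples integer_vectors"
proof (intro equalityI subsetI)
  fix W assume "W \<in> tuples (lattice_of A)"
  then have "\<exists>v. v \<in> integer_vectors \<and> W $ k = A *v v" for k
    by (auto simp: tuples_def lattice_of_def)
  then obtain v where v: "\<And>k. v k \<in> integer_vectors" "\<And>k. W $ k = A *v v k"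
    by metis
  then have "W = tuple_mult A (\<chi> k. v k)" by (simp add: vec_eq_iff)
  then show "W \<in> tuple_mult A ` tuples integer_vectors"
    using v by (auto simp: tuples_def)
qed (auto simp: tuples_def lattice_of_def)

lemma norm_le_components:
  fixes Z :: "real ^ 'n ^ 'm" and B :: real
  assumes "\<And>k i. \<bar>Z $ k $ i\<bar> \<le> B"
  shows "norm Z \<le> CARD('m) * (CARD('n) * B)"
proof -
  have "norm Z \<le> (\<Sum>k\<in>UNIV. norm (Z $ k))"
    unfolding norm_vec_def by (rule L2_set_le_sum) simp
  also have "\<dots> \<le> (\<Sum>k\<in>(UNIV :: 'm set). real CARD('n) * B)"
  proof (intro sum_mono)
    fix k
    have "norm (Z $ k) \<le> (\<Sum>i\<in>UNIV. \<bar>Z $ k $ i\<bar>)" by (rule norm_le_l1_cart)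
    also have "\<dots> \<le> (\<Sum>i\<in>(UNIV :: 'n set). B)" by (intro sum_mono assms)
    finally show "norm (Z $ k) \<le> CARD('n) * B" by simp
  qed
  finally show ?thesis by simp
qed

text \<open>The map \<open>\<rho>\<close> sends every point to the corner of the lattice cell containing it.\<close>

lemma lattice_rounding:
  fixes \<Lambda> :: "(real ^ 'n) set"
  assumes "\<Lambda> \<in> unimodular_lattices"
  obtains \<rho> :: "real ^ 'n ^ 'm \<Rightarrow> real ^ 'n ^ 'm" and C where
    "\<rho> \<in> borel_measurable borel" "\<And>Z. norm (\<rho> Z - Z) \<le> C"
    "\<And>Q. Q \<in> borel_measurable borel \<Longrightarrow>
      (\<integral>\<^sup>+Z. Q (\<rho> Z) \<partial>lborel) = (\<integral>\<^sup>+W. Q W \<partial>count_space (tuples \<Lambda>))"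
proof -
  obtain A :: "real ^ 'n ^ 'n" where A: "det A = 1" "\<Lambda> = lattice_of A"
    using assms by (auto simp: unimodular_lattices_def special_linear_def)
  then have "invertible A" by (simp add: invertible_det_nz)
  then obtain B where B: "A ** B = mat 1" "B ** A = mat 1" by (auto simp: invertible_def)
  have BA: "tuple_mult B (tuple_mult A Z) = Z" "tuple_mult A (tuple_mult B Z) = Z" for Z :: "real ^ 'n ^ 'm"
    using B by (simp_all add: tuple_mult_mult[symmetric]) (simp_all add: vec_eq_iff)
  define \<rho> :: "real ^ 'n ^ 'm \<Rightarrow> real ^ 'n ^ 'm" where
    "\<rho> Z = tuple_mult A (tuple_floor (tuple_mult B Z))" for Z
  obtain K where K: "K > 0" "\<And>Z :: real ^ 'n ^ 'm. norm (tuple_mult A Z) \<le> K * norm Z"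
    using linear_bounded_pos[OF linear_tuple_mult, of A] by blast
  have fl: "norm (tuple_floor Z - Z) \<le> real CARD('m) * (real CARD('n) * 1)" for Z :: "real ^ 'n ^ 'm"
    by (rule norm_le_components) (simp add: tuple_floor_def, linarith)
  show thesis
  proof (rule that)
    show [measurable]: "\<rho> \<in> borel_measurable borel" unfolding \<rho>_def by measurable
    show "norm (\<rho> Z - Z) \<le> K * (real CARD('m) * (real CARD('n) * 1))" for Z
    proof -
      have "\<rho> Z - Z = tuple_mult A (tuple_floor (tuple_mult B Z) - tuple_mult B Z)"
        by (simp add: \<rho>_def linear_diff[OF linear_tuple_mult] BA)
      then show ?thesis using K fl[of "tuple_mult B Z"]
        by (simp add: order_trans[OF K(2) mult_left_mono])
    qed
    fix Q :: "real ^ 'n ^ 'm \<Rightarrow> ennreal" assume [measurable]: "Q \<in> borel_measurable borel"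
    have "(\<integral>\<^sup>+Z. Q (\<rho> Z) \<partial>lborel) = (\<integral>\<^sup>+Z. Q (\<rho> (tuple_mult A Z)) \<partial>lborel)"
      using nn_integral_tuple_mult[of A "\<lambda>Z. Q (\<rho> Z)"] A by simp
    also have "\<dots> = (\<integral>\<^sup>+W. Q (tuple_mult A W) \<partial>count_space (tuples integer_vectors))"
      using nn_integral_tuple_floor[of "\<lambda>Z. Q (tuple_mult A Z)"] by (simp add: \<rho>_def BA)
    also have "\<dots> = (\<integral>\<^sup>+W. Q W \<partial>count_space (tuples \<Lambda>))"
    proof (rule nn_integral_bij_count_space)
      show "bij_betw (tuple_mult A) (tuples integer_vectors) (tuples \<Lambda> :: (real ^ 'n ^ 'm) set)"
        unfolding A(2) tuples_lattice_of by (rule inj_on_imp_bij_betw, rule inj_on_inverseI, rule BA)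
    qed
    finally show "(\<integral>\<^sup>+Z. Q (\<rho> Z) \<partial>lborel) = (\<integral>\<^sup>+W. Q W \<partial>count_space (tuples \<Lambda>))" .
  qed
qed

text \<open>The cells whose corners lie in the ball are disjoint, have volume 1 and lie in the ball
  enlarged by the rounding error \<open>C\<close>, which has finite volume.\<close>

lemma finite_tuples_cball:
  fixes \<Lambda> :: "(real ^ 'n) set"
  assumes \<Lambda>: "\<Lambda> \<in> unimodular_lattices"
  shows "finite ((tuples \<Lambda> :: (real ^ 'n ^ 'm) set) \<inter> cball 0 r)"
proof -
  obtain \<rho> :: "real ^ 'n ^ 'm \<Rightarrow> real ^ 'n ^ 'm" and C where
    \<rho>: "\<rho> \<in> borel_measurable borel" "\<And>Z. norm (\<rho> Z - Z) \<le> C"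
    "\<And>Q. Q \<in> borel_measurable borel \<Longrightarrow>
      (\<integral>\<^sup>+Z. Q (\<rho> Z) \<partial>lborel) = (\<integral>\<^sup>+W. Q W \<partial>count_space (tuples \<Lambda>))"
    using lattice_rounding[OF \<Lambda>] by metis
  have "emeasure (count_space (tuples \<Lambda>)) (tuples \<Lambda> \<inter> cball 0 r :: (real ^ 'n ^ 'm) set)
      = (\<integral>\<^sup>+W. indicator (tuples \<Lambda> \<inter> cball 0 r) W \<partial>count_space (tuples \<Lambda> :: (real ^ 'n ^ 'm) set))"
    by (rule nn_integral_indicator[symmetric]) simp
  also have "\<dots> = (\<integral>\<^sup>+W. indicator (cball 0 r) W \<partial>count_space (tuples \<Lambda> :: (real ^ 'n ^ 'm) set))"
    by (intro nn_integral_cong) (auto split: split_indicator)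
  also have "\<dots> = (\<integral>\<^sup>+Z. indicator (cball 0 r) (\<rho> Z) \<partial>lborel)"
    by (rule \<rho>(3)[symmetric]) (intro borel_measurable_indicator borel_closed closed_cball)
  also have "\<dots> \<le> (\<integral>\<^sup>+Z. indicator (cball 0 (r + C)) (Z :: real ^ 'n ^ 'm) \<partial>lborel)"
  proof (intro nn_integral_mono)
    fix Z
    have "norm Z \<le> norm (\<rho> Z) + norm (\<rho> Z - Z)" by norm
    with \<rho>(2)[of Z] show "indicator (cball 0 r) (\<rho> Z) \<le> (indicator (cball 0 (r + C)) Z :: ennreal)"
      by (auto split: split_indicator)
  qed
  also have "\<dots> < \<infinity>"
    using emeasure_lborel_cball_finite by simp
  finally show ?thesis by (auto simp: emeasure_count_space split: if_splits)
qed

section \<open>Shears and their kernel\<close>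

text \<open>Closeness is asked for as two inequalities with an additive error, the shape in which
  the averages are later compared; finiteness of \<open>x\<close> allows passage to real
  limits.\<close>

lemma ennreal_tendstoI:
  fixes f :: "'a \<Rightarrow> ennreal"
  assumes x: "x < \<infinity>"
    and lim: "\<And>e :: real. e > 0 \<Longrightarrow> \<forall>\<^sub>F a in F. f a \<le> x + ennreal e \<and> x \<le> f a + ennreal e"
  shows "(f \<longlongrightarrow> x) F"
proof -
  obtain r where r: "r \<ge> 0" "x = ennreal r" using x by (cases x) auto
  have fin: "\<forall>\<^sub>F a in F. f a < \<infinity>"
    using lim[of 1, OF zero_less_one]
  proof eventually_elim
    case (elim a)
    then have "f a \<le> ennreal (r + 1)" using r by simp
    then show ?case using ennreal_less_top order_le_less_trans by (metis infinity_ennreal_def)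
  qed
  have "((\<lambda>a. enn2real (f a)) \<longlongrightarrow> r) F"
  proof (rule tendstoI)
    fix e :: real assume "e > 0"
    then have "\<forall>\<^sub>F a in F. f a \<le> x + ennreal (e/2) \<and> x \<le> f a + ennreal (e/2)" by (intro lim) simp
    with fin show "\<forall>\<^sub>F a in F. dist (enn2real (f a)) r < e"
    proof eventually_elim
      case (elim a)
      then obtain s where s: "s \<ge> 0" "f a = ennreal s" by (cases "f a") auto
      show ?case using elim \<open>e > 0\<close> r(1)
        by (simp add: s r(2) flip: ennreal_plus) (auto simp: dist_real_def abs_real_def s(1))
    qed
  qed
  then have "((\<lambda>a. ennreal (enn2real (f a))) \<longlongrightarrow> ennreal r) F"
    by (rule tendsto_ennrealI)
  moreover have "\<forall>\<^sub>F a in F. ennreal (enn2real (f a)) = f a"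
    using fin by eventually_elim (simp add: less_top)
  ultimately show ?thesis unfolding r(2) by (rule Lim_transform_eventually)
qed

section \<open>Cramer's rule and the averaging density\<close>

lemma continuous_on_det:
  fixes f :: "'a :: topological_space \<Rightarrow> real ^ 'n ^ 'n"
  assumes "\<And>i j. continuous_on S (\<lambda>x. f x $ i $ j)"
  shows "continuous_on S (\<lambda>x. det (f x))"
  unfolding det_def by (intro continuous_intros assms)

lemma det_scaleR:
  fixes A :: "real ^ 'n ^ 'n"
  shows "det (c *\<^sub>R A) = c ^ CARD('n) * det A"
  using det_rows_mul[of "\<lambda>_. c" "\<lambda>i. A $ i"] by (simp add: scalar_mult_eq_scaleR scaleR_vec_def)

text \<open>Explicit quotients of determinants, so continuity in the entries is visible wherever
  \<open>det A \<noteq> 0\<close>. For \<open>det A = 0\<close> division by zero yields the zero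
  vector.\<close>

definition cramer_solution :: "real ^ 'n ^ 'n \<Rightarrow> real ^ 'n \<Rightarrow> real ^ 'n" where
  "cramer_solution A b = (\<chi> k. det (\<chi> i j. if j = k then b $ i else A $ i $ j) / det A)"

lemma cramer_solution_iff: "det A \<noteq> 0 \<Longrightarrow> A *v x = b \<longleftrightarrow> x = cramer_solution A b"
  unfolding cramer_solution_def by (rule cramer)

text \<open>The weight for averaging over the shear parameter: continuous, so that the kernel is,
  and supported in the unit ball. It is not normalised; its integral is carried along and cancelled
  at the end.\<close>

definition bump :: "real ^ 'm \<Rightarrow> real" where
  "bump y = max 0 (1 - norm y)"

lemma bump_nonneg: "bump y \<ge> 0" by (simp add: bump_def)

lemma bump_nonzero: "bump y \<noteq> 0 \<Longrightarrow> norm y \<le> 1" by (auto simp: bump_def)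

lemma continuous_on_bump [continuous_intros]:
  "continuous_on S f \<Longrightarrow> continuous_on S (\<lambda>x. bump (f x))"
  unfolding bump_def by (intro continuous_intros)

lemma borel_measurable_bump [measurable]: "bump \<in> borel_measurable borel"
  by (intro borel_measurable_continuous_onI continuous_intros)

lemma bump_integral_finite: "(\<integral>\<^sup>+y. ennreal (bump (y :: real ^ 'm)) \<partial>lborel) < \<infinity>"
proof -
  have "(\<integral>\<^sup>+y. ennreal (bump (y :: real ^ 'm)) \<partial>lborel) \<le> (\<integral>\<^sup>+y. indicator (cball 0 1) (y :: real ^ 'm) \<partial>lborel)"
    by (intro nn_integral_mono) (auto split: split_indicator simp: bump_def ennreal_le_1 ennreal_neg)
  also have "\<dots> < \<infinity>" using emeasure_lborel_cball_finite by simp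
  finally show ?thesis .
qed

lemma bump_integral_pos: "(\<integral>\<^sup>+y. ennreal (bump (y :: real ^ 'm)) \<partial>lborel) > 0"
proof -
  define c :: real where "c = 1/2"
  have c: "c > 0" by (simp add: c_def)
  have "0 < ennreal c * emeasure lborel (cball 0 c :: (real ^ 'm) set)"
    using c by (simp add: ennreal_zero_less_mult_iff emeasure_cball)
  also have "\<dots> = (\<integral>\<^sup>+y. ennreal c * indicator (cball 0 c) (y :: real ^ 'm) \<partial>lborel)"
    by (subst nn_integral_cmult_indicator) auto
  also have "\<dots> \<le> (\<integral>\<^sup>+y. ennreal (bump (y :: real ^ 'm)) \<partial>lborel)"
  proof (intro nn_integral_mono)
    fix y :: "real ^ 'm"
    have "ennreal c \<le> ennreal (bump y)" if "norm y \<le> c"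
      using that by (intro ennreal_leI) (simp add: bump_def c_def)
    then show "ennreal c * indicator (cball 0 c) y \<le> ennreal (bump y)"
      by (simp split: split_indicator)
  qed
  finally show ?thesis .
qed

text \<open>\<open>J\<close> selects the coordinates that form an \<open>m\<close> by
  \<open>m\<close> minor and \<open>i0\<close> is a coordinate outside them; for injective
  \<open>J\<close> it exists only if \<open>m < n\<close>.\<close>

locale pivot =
  fixes i0 :: "'n :: finite" and J :: "'m :: finite \<Rightarrow> 'n"
  assumes i0: "i0 \<notin> range J"
begin

definition minor :: "real ^ 'n ^ 'm \<Rightarrow> real ^ 'm ^ 'm" where
  "minor Z = (\<chi> k a. Z $ k $ J a)"

definition column :: "real ^ 'n ^ 'm \<Rightarrow> real ^ 'm" where
  "column Z = (\<chi> k. Z $ k $ i0)"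

definition put :: "real ^ 'm \<Rightarrow> real ^ 'n ^ 'm \<Rightarrow> real ^ 'n ^ 'm" where
  "put s Z = (\<chi> k i. if i = i0 then s $ k else Z $ k $ i)"

text \<open>The matrix of \<open>a\<^sub>T u\<^sub>y\<close>. The exponent
  \<open>CARD('n) - 1\<close> balances the factors \<open>1 / T\<close> in the other rows, and
  summing over \<open>a\<close> covers repeated values of \<open>J\<close> as well.\<close>

definition shear :: "real \<Rightarrow> real ^ 'm \<Rightarrow> real ^ 'n ^ 'n" where
  "shear T y = (\<chi> i j. if i = i0 then T ^ (CARD('n) - 1) * (of_bool (j = i0) + (\<Sum>a\<in>UNIV. y $ a * of_bool (j = J a)))
     else of_bool (i = j) / T)"

lemma J_neq: "J a \<noteq> i0" "i0 \<noteq> J a" using i0 by auto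

lemma minor_put [simp]: "minor (put s Z) = minor Z"
  by (simp add: minor_def put_def J_neq)

lemma minor_scaleR: "minor (c *\<^sub>R Z) = c *\<^sub>R minor Z"
  by (simp add: minor_def vec_eq_iff)

lemma column_scaleR: "column (c *\<^sub>R Z) = c *\<^sub>R column Z"
  by (simp add: column_def vec_eq_iff)

text \<open>On the \<open>m\<close> entries with index \<open>i0\<close> the parameter
  \<open>y\<close> acts through the affine map \<open>column Z + minor Z *v y\<close>. Hence an
  average over \<open>y\<close> sweeps these entries out with density
  \<open>1 / \<bar>det (minor Z)\<bar>\<close> relative to that of \<open>y\<close>, up to a power
  of \<open>T\<close>.\<close>

lemma tuple_mult_shear:
  "tuple_mult (shear T y) Z = put (T ^ (CARD('n) - 1) *\<^sub>R (column Z + minor Z *v y)) (Z /\<^sub>R T)"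
proof -
  have 1: "(\<Sum>j\<in>UNIV. T ^ (CARD('n) - 1) * (of_bool (j = i0) + (\<Sum>a\<in>UNIV. y $ a * of_bool (j = J a))) * v $ j)
     = T ^ (CARD('n) - 1) * (v $ i0 + (\<Sum>a\<in>UNIV. v $ J a * y $ a))" for v :: "real ^ 'n"
  proof -
    have "(\<Sum>j\<in>UNIV. (\<Sum>a\<in>UNIV. y $ a * of_bool (j = J a)) * v $ j)
        = (\<Sum>a\<in>UNIV. \<Sum>j\<in>UNIV. y $ a * of_bool (j = J a) * v $ j)"
      unfolding sum_distrib_right by (rule sum.swap)
    also have "\<dots> = (\<Sum>a\<in>UNIV. v $ J a * y $ a)"
      by (intro sum.cong refl) (simp add: of_bool_def if_distrib if_distribR cong: if_cong)
    finally have *: "(\<Sum>j\<in>UNIV. (\<Sum>a\<in>UNIV. y $ a * of_bool (j = J a)) * v $ j) = (\<Sum>a\<in>UNIV. v $ J a * y $ a)" .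
    have "(\<Sum>j\<in>UNIV. of_bool (j = i0) * v $ j) = v $ i0"
      by (simp add: of_bool_def if_distrib if_distribR cong: if_cong)
    with * show ?thesis
      by (simp add: mult.assoc sum_distrib_left[symmetric] distrib_right sum.distrib)
  qed
  have 2: "(\<Sum>j\<in>UNIV. of_bool (i = j) / T * v $ j) = v $ i / T" for i and v :: "real ^ 'n"
    by (simp add: of_bool_def if_distrib if_distribR cong: if_cong)
  have "(shear T y *v v) $ i = (if i = i0 then T ^ (CARD('n) - 1) * (v $ i0 + (\<Sum>a\<in>UNIV. v $ J a * y $ a)) else v $ i / T)"
    for v i
    unfolding matrix_vector_mult_def shear_def using 1[of v] 2[of i v]
    by (cases "i = i0") (simp_all only: vec_lambda_beta if_True if_False simp_thms)
  then show ?thesis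
    by (simp add: vec_eq_iff put_def minor_def column_def matrix_vector_mult_def divide_inverse_commute)
qed

lemma det_shear:
  assumes "T > 0"
  shows "det (shear T y) = 1"
proof -
  let ?D = "shear T 0"
  \<comment> \<open>Row \<open>J a\<close> of the diagonal matrix carries \<open>1 / T\<close>, so
    the factor \<open>T ^ CARD('n)\<close> produces the required power
    \<open>CARD('n) - 1\<close>.\<close>
  define x where "x = (\<Sum>a\<in>UNIV. (T ^ CARD('n) * y $ a) *s row (J a) ?D)"
  have "x \<in> vec.span {row j ?D |j. j \<noteq> i0}"
    unfolding x_def by (intro vec.span_sum vec.span_scale vec.span_base) (auto simp: J_neq)
  then have "det (\<chi> k. if k = i0 then row i0 ?D + x else row k ?D) = det ?D"
    by (rule det_row_span)
  moreover have "(\<chi> k. if k = i0 then row i0 ?D + x else row k ?D) = shear T y"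
  proof -
    have "T ^ CARD('n) * c / T = T ^ (CARD('n) - 1) * c" for c
      using assms by (simp add: power_diff)
    then have "x $ j = T ^ (CARD('n) - 1) * (\<Sum>a\<in>UNIV. y $ a * of_bool (j = J a))" for j
      unfolding x_def sum_component sum_distrib_left
      by (intro sum.cong) (auto simp: row_def shear_def J_neq)
    then show ?thesis by (auto simp: vec_eq_iff row_def shear_def algebra_simps)
  qed
  moreover have "det ?D = (\<Prod>i\<in>UNIV. if i = i0 then T ^ (CARD('n) - 1) else 1 / T)"
    by (subst det_diagonal) (auto simp: shear_def intro!: prod.cong)
  moreover have "\<dots> = T ^ (CARD('n) - 1) * (1 / T) ^ (CARD('n) - 1)"
    by (subst prod.remove[of _ i0]) auto
  moreover have "\<dots> = 1" using assms by (simp add: power_divide)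
  ultimately show ?thesis by simp
qed

lemma continuous_on_put [continuous_intros]:
  assumes "continuous_on S f" "continuous_on S g"
  shows "continuous_on S (\<lambda>x. put (f x) (g x))"
  unfolding put_def
proof (intro continuous_on_vec_lambda)
  fix k i
  show "continuous_on S (\<lambda>x. if i = i0 then f x $ k else g x $ k $ i)"
    using assms by (cases "i = i0") (auto intro!: continuous_intros)
qed

lemma continuous_on_minor_det [continuous_intros]:
  "continuous_on S f \<Longrightarrow> continuous_on S (\<lambda>x. det (minor (f x)))"
  by (intro continuous_on_det) (auto simp: minor_def intro!: continuous_intros)

lemma continuous_on_column [continuous_intros]:
  "continuous_on S f \<Longrightarrow> continuous_on S (\<lambda>x. column (f x))"
  unfolding column_def by (intro continuous_intros)

lemma continuous_on_cramer_solution: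
  assumes "continuous_on S f" "continuous_on S g" "\<And>x. x \<in> S \<Longrightarrow> det (minor (f x)) \<noteq> 0"
  shows "continuous_on S (\<lambda>x. cramer_solution (minor (f x)) (g x))"
  unfolding cramer_solution_def
proof (intro continuous_on_vec_lambda continuous_on_divide continuous_on_det)
  fix k i j
  show "continuous_on S (\<lambda>x. (\<chi> i j. if j = k then g x $ i else minor (f x) $ i $ j) $ i $ j)"
    using assms by (cases "j = k") (auto simp: minor_def intro!: continuous_intros)
qed (use assms in \<open>auto simp: minor_def intro!: continuous_intros\<close>)

end

text \<open>The compact set \<open>S\<close> keeps the support of \<open>F\<close> away from the
  zeros of the minor; this makes the kernel below extend continuously by zero and have bounded
  support.\<close>

locale pivot_function = pivot i0 J for i0 :: "'n :: finite" and J :: "'m :: finite \<Rightarrow> 'n" +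
  fixes F :: "real ^ 'n ^ 'm \<Rightarrow> real" and S :: "(real ^ 'n ^ 'm) set"
  assumes F_cont: "continuous_on UNIV F" and F_nonneg: "\<And>Z. F Z \<ge> 0"
    and S_compact: "compact S" and S_minor: "\<And>Z. Z \<in> S \<Longrightarrow> det (minor Z) \<noteq> 0"
    and F_zero: "\<And>Z. Z \<notin> S \<Longrightarrow> F Z = 0"
begin

text \<open>After the substitution \<open>s = T\<^sup>n (column z + minor z y)\<close> the average of \<open>F\<close> over the sheared
  images of \<open>T z\<close> is an integral over \<open>s\<close> of this kernel at \<open>\<epsilon> = T\<^sup>-\<^sup>n\<close>. If \<open>det (minor Z) = 0\<close> the
  kernel vanishes, the numerator being zero as well.\<close>

definition kernel :: "real \<Rightarrow> real ^ 'm \<Rightarrow> real ^ 'n ^ 'm \<Rightarrow> real" where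
  "kernel \<epsilon> s Z = bump (cramer_solution (minor Z) (\<epsilon> *\<^sub>R s - column Z)) * F (put s Z) / \<bar>det (minor Z)\<bar>"

lemma kernel_nonneg: "kernel \<epsilon> s Z \<ge> 0"
  by (simp add: kernel_def bump_nonneg F_nonneg)

lemma F_borel [measurable]: "F \<in> borel_measurable borel"
  by (rule borel_measurable_continuous_onI[OF F_cont])

lemma continuous_on_F [continuous_intros]:
  "continuous_on A f \<Longrightarrow> continuous_on A (\<lambda>x. F (f x))"
  by (rule continuous_on_compose2[OF F_cont]) auto

text \<open>\<open>put\<close> leaves the minor unchanged, so wherever
  \<open>det (minor Z) = 0\<close> the point \<open>put s Z\<close> lies in the open complement of
  \<open>S\<close>, where the kernel is zero. This open condition and the non-vanishing of the minor
  cover all arguments.\<close>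

lemma continuous_kernel: "continuous_on UNIV (\<lambda>(\<epsilon>, s, Z). kernel \<epsilon> s Z)"
proof -
  let ?O1 = "{p :: real \<times> (real ^ 'm) \<times> (real ^ 'n ^ 'm). det (minor (snd (snd p))) \<noteq> 0}"
  let ?O2 = "(\<lambda>p :: real \<times> (real ^ 'm) \<times> (real ^ 'n ^ 'm). put (fst (snd p)) (snd (snd p))) -` (- S)"
  have "open ?O1" by (intro open_Collect_neq continuous_intros)
  moreover have "open ?O2"
    using S_compact by (intro open_vimage continuous_intros) (auto simp: compact_imp_closed open_Compl)
  moreover have "continuous_on ?O1 (\<lambda>(\<epsilon>, s, Z). kernel \<epsilon> s Z)"
    unfolding kernel_def split_beta
    by (intro continuous_intros continuous_on_cramer_solution) auto
  moreover have "continuous_on ?O2 (\<lambda>(\<epsilon>, s, Z). kernel \<epsilon> s Z)"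
    by (subst continuous_on_cong[OF refl, where g = "\<lambda>_. 0"]) (auto simp: kernel_def F_zero)
  ultimately have "continuous_on (?O1 \<union> ?O2) (\<lambda>(\<epsilon>, s, Z). kernel \<epsilon> s Z)"
    by (rule continuous_on_open_Un)
  moreover have "?O1 \<union> ?O2 = UNIV" using S_minor by fastforce
  ultimately show ?thesis by simp
qed

text \<open>\<open>F\<close> bounds \<open>s\<close> and every column of \<open>Z\<close> except
  number \<open>i0\<close>. The missing column equals
  \<open>\<epsilon> *\<^sub>R s - minor Z *v y\<close> with \<open>norm y \<le> 1\<close>, which is
  bounded for \<open>\<epsilon> \<le> 1\<close>.\<close>

lemma kernel_support:
  obtains R where "R > 0" "\<And>\<epsilon> s Z. kernel \<epsilon> s Z \<noteq> 0 \<Longrightarrow> \<epsilon> \<in> {0..1} \<Longrightarrow> norm s \<le> R \<and> norm Z \<le> R"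
proof -
  obtain R where R: "R > 0" "\<And>Z. Z \<in> S \<Longrightarrow> norm Z \<le> R"
    using compact_imp_bounded[OF S_compact] unfolding bounded_pos by blast
  define R' where "R' = CARD('m) * R + CARD('m) * (CARD('n) * (R + CARD('m) * R))"
  have s: "norm s \<le> R'" and Z: "norm Z \<le> R'" if k: "kernel \<epsilon> s Z \<noteq> 0" and \<epsilon>: "\<epsilon> \<in> {0..1}" for \<epsilon> s Z
  proof -
    have "F (put s Z) \<noteq> 0" using k by (auto simp: kernel_def)
    then have "put s Z \<in> S" using F_zero by blast
    then have n: "norm (put s Z) \<le> R" and d: "det (minor Z) \<noteq> 0"
      using R S_minor[of "put s Z"] by auto
    have c: "\<bar>put s Z $ k $ i\<bar> \<le> R" for k i
    proof -
      have "\<bar>put s Z $ k $ i\<bar> \<le> norm (put s Z $ k)" by (rule component_le_norm_cart)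
      also have "\<dots> \<le> norm (put s Z)" by (rule Finite_Cartesian_Product.norm_nth_le)
      finally show ?thesis using n by simp
    qed
    have c1: "\<bar>s $ k\<bar> \<le> R" for k using c[of k i0] by (simp add: put_def)
    have c2: "\<bar>Z $ k $ i\<bar> \<le> R" if "i \<noteq> i0" for k i using c[of k i] that by (simp add: put_def)
    have "norm s \<le> (\<Sum>k\<in>UNIV. \<bar>s $ k\<bar>)" by (rule norm_le_l1_cart)
    also have "\<dots> \<le> CARD('m) * R" using sum_mono[of UNIV "\<lambda>k. \<bar>s $ k\<bar>" "\<lambda>_. R"] c1 by simp
    also have "\<dots> \<le> R'" using R by (simp add: R'_def)
    finally show "norm s \<le> R'" .
    define y where "y = cramer_solution (minor Z) (\<epsilon> *\<^sub>R s - column Z)"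
    have y: "norm y \<le> 1"
      using k by (intro bump_nonzero) (auto simp: kernel_def y_def)
    have My: "minor Z *v y = \<epsilon> *\<^sub>R s - column Z"
      using d by (simp add: cramer_solution_iff y_def)
    have "\<bar>Z $ k $ i0\<bar> \<le> R + CARD('m) * R" for k
    proof -
      have "Z $ k $ i0 = \<epsilon> * s $ k - (\<Sum>a\<in>UNIV. Z $ k $ J a * y $ a)"
        using arg_cong[OF My, of "\<lambda>v. v $ k"] by (simp add: matrix_vector_mult_def minor_def column_def)
      moreover have "\<bar>\<epsilon> * s $ k\<bar> \<le> 1 * R"
        unfolding abs_mult using \<epsilon> c1[of k] by (intro mult_mono) auto
      moreover have "\<bar>\<Sum>a\<in>UNIV. Z $ k $ J a * y $ a\<bar> \<le> (\<Sum>a\<in>(UNIV :: 'm set). R * 1)"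
      proof (rule order_trans[OF sum_abs sum_mono])
        fix a
        have "\<bar>y $ a\<bar> \<le> 1" using component_le_norm_cart[of y a] y by simp
        then show "\<bar>Z $ k $ J a * y $ a\<bar> \<le> R * 1"
          unfolding abs_mult using c2[of "J a" k] R by (intro mult_mono) (auto simp: J_neq)
      qed
      ultimately show ?thesis by simp
    qed
    then have "\<bar>Z $ k $ i\<bar> \<le> R + CARD('m) * R" for k i
      using c2[of i k] R by (cases "i = i0") (auto intro: order_trans)
    then have "norm Z \<le> CARD('m) * (CARD('n) * (R + CARD('m) * R))" by (rule norm_le_components)
    also have "\<dots> \<le> R'" using R by (simp add: R'_def)
    finally show "norm Z \<le> R'" .
  qed
  have "R' > 0" using R by (auto simp: R'_def intro!: add_pos_pos mult_pos_pos)
  with s Z show thesis by (intro that) auto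
qed

text \<open>The interval \<open>{0..1}\<close> includes the limit value
  \<open>\<epsilon> = 0\<close>, so compactness gives one modulus of continuity for all
  \<open>\<epsilon> = 1 / T ^ n\<close> with \<open>T \<ge> 1\<close>.\<close>

lemma kernel_uniform:
  assumes "\<eta> > 0"
  obtains \<delta> where "\<delta> > 0"
    "\<And>\<epsilon> s Z Z'. \<epsilon> \<in> {0..1} \<Longrightarrow> dist Z Z' < \<delta> \<Longrightarrow> \<bar>kernel \<epsilon> s Z - kernel \<epsilon> s Z'\<bar> \<le> \<eta>"
proof -
  obtain R where R: "R > 0" "\<And>\<epsilon> s Z. kernel \<epsilon> s Z \<noteq> 0 \<Longrightarrow> \<epsilon> \<in> {0..1} \<Longrightarrow> norm s \<le> R \<and> norm Z \<le> R"
    using kernel_support by blast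
  \<comment> \<open>Radius \<open>R + 1\<close>: when the kernel is non-zero at one of the two
    points, that point has norm at most \<open>R\<close> and the other is less than 1 away.\<close>
  let ?C = "{0..1 :: real} \<times> cball (0 :: real ^ 'm) R \<times> cball (0 :: real ^ 'n ^ 'm) (R + 1)"
  have "uniformly_continuous_on ?C (\<lambda>(\<epsilon>, s, Z). kernel \<epsilon> s Z)"
    by (intro compact_uniformly_continuous continuous_on_subset[OF continuous_kernel] compact_Times) auto
  then obtain \<delta> where \<delta>: "\<delta> > 0"
    "\<And>p q. p \<in> ?C \<Longrightarrow> q \<in> ?C \<Longrightarrow> dist q p < \<delta> \<Longrightarrow> dist ((\<lambda>(\<epsilon>, s, Z). kernel \<epsilon> s Z) q) ((\<lambda>(\<epsilon>, s, Z). kernel \<epsilon> s Z) p) < \<eta>"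
    using assms unfolding uniformly_continuous_on_def by blast
  have "\<bar>kernel \<epsilon> s Z - kernel \<epsilon> s Z'\<bar> \<le> \<eta>" if \<epsilon>: "\<epsilon> \<in> {0..1}" and d: "dist Z Z' < min \<delta> 1" for \<epsilon> s Z Z'
  proof (cases "kernel \<epsilon> s Z = 0 \<and> kernel \<epsilon> s Z' = 0")
    case True
    then show ?thesis using assms by simp
  next
    case False
    then have "norm s \<le> R" "norm Z \<le> R \<or> norm Z' \<le> R" using R(2) \<epsilon> by blast+
    moreover have "norm Z \<le> norm Z' + dist Z Z'" "norm Z' \<le> norm Z + dist Z Z'"
      by norm+
    ultimately have "(\<epsilon>, s, Z) \<in> ?C" "(\<epsilon>, s, Z') \<in> ?C" using \<epsilon> d by auto
    moreover have "dist (\<epsilon>, s, Z) (\<epsilon>, s, Z') < \<delta>" using d by (simp add: dist_Pair_Pair)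
    ultimately show ?thesis using \<delta>(2) by (force simp: dist_real_def)
  qed
  with \<delta>(1) show thesis by (intro that[of "min \<delta> 1"]) auto
qed

end

section \<open>Averages over the shear parameter as Riemann sums\<close>

lemma borel_measurable_indicator_cball [measurable]:
  "(indicator (cball a r) :: _ \<Rightarrow> ennreal) \<in> borel_measurable borel"
  by (intro borel_measurable_indicator borel_closed closed_cball)

lemma countable_tuples:
  assumes "\<Lambda> \<in> unimodular_lattices"
  shows "countable (tuples \<Lambda> :: (real ^ 'n ^ 'm) set)"
  using assms countable_integer_tuples by (auto simp: unimodular_lattices_def tuples_lattice_of)

context pivot_function
begin

lemma continuous_on_sheared [continuous_intros]:
  fixes g :: "'a :: topological_space \<Rightarrow> real ^ 'n ^ 'm"
  assumes "continuous_on A f" "continuous_on A g"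
  shows "continuous_on A (\<lambda>x. tuple_mult (shear T (f x)) (g x))"
  unfolding tuple_mult_shear matrix_vector_mult_def
  by (intro continuous_intros assms) (auto simp: minor_def intro!: continuous_intros assms)

lemma borel_measurable_sheared [measurable]:
  "(\<lambda>(Z, y). F (tuple_mult (shear T y) Z)) \<in> borel_measurable (borel \<Otimes>\<^sub>M borel)"
  unfolding borel_prod split_beta
  by (intro borel_measurable_continuous_onI continuous_intros)

lemma borel_measurable_kernel [measurable]: "(\<lambda>s. kernel \<epsilon> s Z) \<in> borel_measurable borel"
proof (rule borel_measurable_continuous_onI)
  have "continuous_on UNIV (\<lambda>s. (\<lambda>(\<epsilon>, s, Z). kernel \<epsilon> s Z) (\<epsilon>, s, Z))"
    by (rule continuous_on_compose2[OF continuous_kernel]) (auto intro!: continuous_intros)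
  then show "continuous_on UNIV (\<lambda>s. kernel \<epsilon> s Z)" by simp
qed

definition average :: "real \<Rightarrow> real ^ 'n ^ 'm \<Rightarrow> ennreal" where
  "average T Z = (\<integral>\<^sup>+y. ennreal (bump y) * ennreal (F (tuple_mult (shear T y) Z)) \<partial>lborel)"

lemma borel_measurable_average [measurable]: "average T \<in> borel_measurable borel"
proof -
  have "(\<lambda>(Z, y). ennreal (bump y) * ennreal (F (tuple_mult (shear T y) Z))) \<in> borel_measurable (borel \<Otimes>\<^sub>M lborel)"
    by measurable
  then show ?thesis unfolding average_def by (rule lborel.borel_measurable_nn_integral)
qed

text \<open>The substitution has Jacobian \<open>\<bar>det (minor z)\<bar>\<close> times
  \<open>T\<close> to the power \<open>n m\<close>. The determinant is the denominator of the
  kernel, and the power of \<open>T\<close> becomes the weight of a Riemann sum with mesh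
  \<open>1 / T\<close> in dimension \<open>n m\<close>.\<close>

lemma average_scaleR:
  assumes T: "T > 0"
  shows "average T (T *\<^sub>R z) =
    ennreal (1 / T ^ (CARD('n) * CARD('m))) * (\<integral>\<^sup>+s. ennreal (kernel (1 / T ^ CARD('n)) s z) \<partial>lborel)"
proof -
  define \<tau> where "\<tau> = T ^ CARD('n)"
  have \<tau>: "\<tau> > 0" using T by (simp add: \<tau>_def)
  have "T ^ (CARD('n) - 1) * T = \<tau>"
    unfolding \<tau>_def using power_minus_mult[of "CARD('n)" T] by simp
  then have sh: "tuple_mult (shear T y) (T *\<^sub>R z) = put (\<tau> *\<^sub>R (column z + minor z *v y)) z" for y
    using T unfolding tuple_mult_shear
    by (simp add: minor_scaleR column_scaleR scaleR_matrix_vector_assoc[symmetric] flip: scaleR_add_right)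
  show ?thesis
  proof (cases "det (minor z) = 0")
    \<comment> \<open>\<open>put\<close> does not change the minor, so no \<open>put s z\<close>
      lies in \<open>S\<close> and both sides are 0.\<close>
    case True
    then have "F (put s z) = 0" for s
      using S_minor[of "put s z"] F_zero by auto
    then show ?thesis using True by (simp add: average_def sh kernel_def)
  next
    case d: False
    define h where "h s = ennreal (kernel (1 / \<tau>) s z)" for s
    have h: "h (\<tau> *\<^sub>R column z + (\<tau> *\<^sub>R minor z) *v y)
        = ennreal (1 / \<bar>det (minor z)\<bar>) * (ennreal (bump y) * ennreal (F (tuple_mult (shear T y) (T *\<^sub>R z))))" for y
    proof -
      have "cramer_solution (minor z) (minor z *v y) = y"
        using cramer_solution_iff[OF d, of y "minor z *v y"] by simp
      moreover have "\<tau> *\<^sub>R column z + (\<tau> *\<^sub>R minor z) *v y = \<tau> *\<^sub>R (column z + minor z *v y)"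
        by (simp add: scaleR_matrix_vector_assoc[symmetric] scaleR_add_right)
      ultimately show ?thesis using \<tau>
        by (simp add: h_def kernel_def sh bump_nonneg F_nonneg flip: ennreal_mult)
    qed
    have [measurable]: "h \<in> borel_measurable borel" unfolding h_def by measurable
    have "(\<integral>\<^sup>+s. h s \<partial>lborel) = (\<integral>\<^sup>+s. h (s + \<tau> *\<^sub>R column z) \<partial>lborel)"
      by (rule nn_integral_lborel_translate[symmetric]) measurable
    also have "\<dots> = ennreal \<bar>det (\<tau> *\<^sub>R minor z)\<bar> * (\<integral>\<^sup>+y. h ((\<tau> *\<^sub>R minor z) *v y + \<tau> *\<^sub>R column z) \<partial>lborel)"
      using d \<tau> by (intro nn_integral_matrix_vector_mult[symmetric]) (simp_all add: det_scaleR)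
    also have "(\<integral>\<^sup>+y. h ((\<tau> *\<^sub>R minor z) *v y + \<tau> *\<^sub>R column z) \<partial>lborel)
        = ennreal (1 / \<bar>det (minor z)\<bar>) * average T (T *\<^sub>R z)"
      unfolding add.commute[of "(\<tau> *\<^sub>R minor z) *v _"] h average_def
    proof (rule nn_integral_cmult)
      have "(\<lambda>y. (T *\<^sub>R z, y)) \<in> measurable borel (borel \<Otimes>\<^sub>M borel)" by measurable
      from measurable_compose[OF this borel_measurable_sheared]
      have [measurable]: "(\<lambda>y. F (tuple_mult (shear T y) (T *\<^sub>R z))) \<in> borel_measurable borel" by simp
      show "(\<lambda>y. ennreal (bump y) * ennreal (F (tuple_mult (shear T y) (T *\<^sub>R z)))) \<in> borel_measurable lborel"
        by measurable
    qed
    finally have "(\<integral>\<^sup>+s. h s \<partial>lborel)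
        = ennreal (\<bar>det (\<tau> *\<^sub>R minor z)\<bar> * (1 / \<bar>det (minor z)\<bar>)) * average T (T *\<^sub>R z)"
      by (subst ennreal_mult) (simp_all add: mult.assoc)
    also have "\<bar>det (\<tau> *\<^sub>R minor z)\<bar> * (1 / \<bar>det (minor z)\<bar>) = \<tau> ^ CARD('m)"
      using d \<tau> by (simp add: det_scaleR abs_mult)
    finally have I: "(\<integral>\<^sup>+s. h s \<partial>lborel) = ennreal (\<tau> ^ CARD('m)) * average T (T *\<^sub>R z)" .
    have "ennreal (1 / \<tau> ^ CARD('m)) * ennreal (\<tau> ^ CARD('m)) = 1"
      using \<tau> by (simp flip: ennreal_mult)
    then have "ennreal (1 / \<tau> ^ CARD('m)) * (\<integral>\<^sup>+s. h s \<partial>lborel) = average T (T *\<^sub>R z)"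
      unfolding I by (simp only: mult.assoc[symmetric] mult_1_left)
    then show ?thesis
      by (simp add: h_def \<tau>_def power_mult)
  qed
qed

lemma integral_average:
  assumes "T > 0"
  shows "(\<integral>\<^sup>+Z. average T Z \<partial>lborel) = (\<integral>\<^sup>+y. ennreal (bump (y :: real ^ 'm)) \<partial>lborel) * (\<integral>\<^sup>+Z. F Z \<partial>lborel)"
proof -
  have "(\<integral>\<^sup>+Z. average T Z \<partial>lborel)
      = (\<integral>\<^sup>+y. \<integral>\<^sup>+Z. ennreal (bump y) * ennreal (F (tuple_mult (shear T y) Z)) \<partial>lborel \<partial>lborel)"
    unfolding average_def by (rule lborel_pair.Fubini') measurable
  also have "\<dots> = (\<integral>\<^sup>+y. ennreal (bump (y :: real ^ 'm)) * (\<integral>\<^sup>+Z. F Z \<partial>lborel) \<partial>lborel)"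
  proof (rule nn_integral_cong)
    fix y
    have "(\<integral>\<^sup>+Z. ennreal (bump y) * ennreal (F (tuple_mult (shear T y) Z)) \<partial>lborel)
        = ennreal (bump y) * (\<integral>\<^sup>+Z. ennreal (F (tuple_mult (shear T y) Z)) \<partial>lborel)"
      by (rule nn_integral_cmult) measurable
    also have "(\<integral>\<^sup>+Z. ennreal (F (tuple_mult (shear T y) Z)) \<partial>lborel) = (\<integral>\<^sup>+Z. F Z \<partial>lborel)"
      using nn_integral_tuple_mult[of "shear T y" "\<lambda>Z. ennreal (F Z)"] det_shear[OF assms] by simp
    finally show "(\<integral>\<^sup>+Z. ennreal (bump y) * ennreal (F (tuple_mult (shear T y) Z)) \<partial>lborel)
        = ennreal (bump y) * (\<integral>\<^sup>+Z. F Z \<partial>lborel)" .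
  qed
  also have "\<dots> = (\<integral>\<^sup>+y. ennreal (bump (y :: real ^ 'm)) \<partial>lborel) * (\<integral>\<^sup>+Z. F Z \<partial>lborel)"
    by (rule nn_integral_multc) measurable
  finally show ?thesis .
qed

lemma integral_F_finite: "(\<integral>\<^sup>+Z. F Z \<partial>lborel) < \<infinity>"
proof -
  have "compact (F ` S)"
    using S_compact by (intro compact_continuous_image continuous_on_subset[OF F_cont]) auto
  then obtain B where B: "\<And>Z. Z \<in> S \<Longrightarrow> F Z \<le> B"
    using compact_imp_bounded bounded_iff by (metis abs_le_D1 imageI real_norm_def)
  have "(\<integral>\<^sup>+Z. F Z \<partial>lborel) \<le> (\<integral>\<^sup>+Z. ennreal B * indicator S Z \<partial>lborel)"
    using B F_zero by (intro nn_integral_mono) (auto split: split_indicator intro: ennreal_leI)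
  also have "\<dots> = ennreal B * emeasure lborel S"
    using S_compact by (intro nn_integral_cmult_indicator) (simp add: borel_compact)
  also have "\<dots> < \<infinity>"
    using emeasure_compact_finite[OF S_compact] by (simp add: ennreal_mult_less_top)
  finally show ?thesis .
qed

text \<open>Over distances \<open>\<delta> * T\<close> the average varies by at most
  \<open>\<eta>\<close> divided by \<open>T\<close> to the power \<open>n m\<close>, and only within
  radius \<open>R * T\<close>, a ball whose volume is of the order of that same power. A bounded
  displacement therefore changes the integral by at most a multiple of \<open>\<eta>\<close>. Both
  indicators are recorded because the estimate is integrated over either point.\<close>

lemma average_close:
  obtains R where "R > 0" "\<And>\<eta>. \<eta> > 0 \<Longrightarrow> \<exists>\<delta>>0. \<forall>T\<ge>1. \<forall>Z Z'. norm (Z - Z') < \<delta> * T \<longrightarrow>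
    average T Z \<le> average T Z' + ennreal (\<eta> / T ^ (CARD('n) * CARD('m)))
      * (indicator (cball 0 (R * T)) Z * indicator (cball 0 (R * T)) Z')"
proof -
  obtain R where R: "R > 0" "\<And>\<epsilon> s Z. kernel \<epsilon> s Z \<noteq> 0 \<Longrightarrow> \<epsilon> \<in> {0..1} \<Longrightarrow> norm s \<le> R \<and> norm Z \<le> R"
    using kernel_support by blast
  obtain v where v: "emeasure lborel (cball (0 :: real ^ 'm) R) = ennreal v" "v > 0"
    using emeasure_cball[of R "0 :: real ^ 'm"] R(1) by auto
  have "\<exists>\<delta>>0. \<forall>T\<ge>1. \<forall>Z Z'. norm (Z - Z') < \<delta> * T \<longrightarrow>
    average T Z \<le> average T Z' + ennreal (\<eta> / T ^ (CARD('n) * CARD('m)))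
      * (indicator (cball 0 ((R + 1) * T)) Z * indicator (cball 0 ((R + 1) * T)) Z')" if assms: "\<eta> > 0" for \<eta>
  proof -
    \<comment> \<open>Dividing by the volume \<open>v\<close> of the ball containing all relevant
      \<open>s\<close> turns the pointwise error into a total error \<open>\<eta>\<close>.\<close>
    obtain \<delta> where \<delta>: "\<delta> > 0"
      "\<And>\<epsilon> s Z Z'. \<epsilon> \<in> {0..1} \<Longrightarrow> dist Z Z' < \<delta> \<Longrightarrow> \<bar>kernel \<epsilon> s Z - kernel \<epsilon> s Z'\<bar> \<le> \<eta> / v"
      using kernel_uniform[of "\<eta> / v"] assms v by auto
    have "average T Z \<le> average T Z' + ennreal (\<eta> / T ^ (CARD('n) * CARD('m)))
        * (indicator (cball 0 ((R + 1) * T)) Z * indicator (cball 0 ((R + 1) * T)) Z')"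
      if T: "T \<ge> 1" and d: "norm (Z - Z') < min \<delta> 1 * T" for T Z Z'
    proof -
      define z z' where "z = Z /\<^sub>R T" and "z' = Z' /\<^sub>R T"
      define \<epsilon> where "\<epsilon> = 1 / T ^ CARD('n)"
      have \<epsilon>: "\<epsilon> \<in> {0..1}" using T by (simp add: \<epsilon>_def)
      have Z: "Z = T *\<^sub>R z" "Z' = T *\<^sub>R z'" using T by (simp_all add: z_def z'_def)
      have "norm (Z - Z') = T * norm (z - z')"
        using T unfolding Z by (simp flip: scaleR_diff_right)
      then have dz: "norm (z - z') < min \<delta> 1" using d T by (simp add: mult.commute)
      have tri: "norm z \<le> norm z' + norm (z - z')" "norm z' \<le> norm z + norm (z - z')" by norm+
      show ?thesis
      proof (cases "norm z \<le> R + 1 \<and> norm z' \<le> R + 1")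
        case False
        \<comment> \<open>The points are less than 1 apart, so if either leaves the ball of radius
          \<open>R + 1\<close>, then \<open>z\<close> leaves that of radius
          \<open>R\<close>.\<close>
        then have "norm z > R" using tri dz by auto
        then have "kernel \<epsilon> s z = 0" for s using R(2) \<epsilon> by fastforce
        then have "average T Z = 0"
          using T unfolding Z by (simp add: average_scaleR \<epsilon>_def)
        then show ?thesis by simp
      next
        case True
        then have ind: "indicator (cball 0 ((R + 1) * T)) Z * indicator (cball 0 ((R + 1) * T)) Z' = (1 :: ennreal)"
          using T unfolding Z by (simp add: mult.commute)
        have "(\<integral>\<^sup>+s. ennreal (kernel \<epsilon> s z) \<partial>lborel)
            \<le> (\<integral>\<^sup>+s. ennreal (kernel \<epsilon> s z') + ennreal (\<eta> / v) * indicator (cball 0 R) s \<partial>lborel)"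
        proof (intro nn_integral_mono)
          fix s
          have "kernel \<epsilon> s z \<le> kernel \<epsilon> s z' + \<eta> / v * indicator (cball 0 R) s"
          proof (cases "kernel \<epsilon> s z = 0")
            case True
            then show ?thesis using kernel_nonneg assms v by simp
          next
            case False
            then have "s \<in> cball 0 R" using R(2) \<epsilon> by auto
            moreover have "\<bar>kernel \<epsilon> s z - kernel \<epsilon> s z'\<bar> \<le> \<eta> / v"
              using dz \<epsilon> by (intro \<delta>(2)) (auto simp: dist_norm)
            ultimately show ?thesis by simp
          qed
          then have "ennreal (kernel \<epsilon> s z) \<le> ennreal (kernel \<epsilon> s z' + \<eta> / v * indicator (cball 0 R) s)"
            by (rule ennreal_leI)
          also have "\<dots> = ennreal (kernel \<epsilon> s z') + ennreal (\<eta> / v) * indicator (cball 0 R) s"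
            using assms v kernel_nonneg by (simp split: split_indicator)
          finally show "ennreal (kernel \<epsilon> s z) \<le> \<dots>" .
        qed
        also have "\<dots> = (\<integral>\<^sup>+s. ennreal (kernel \<epsilon> s z') \<partial>lborel) + ennreal (\<eta> / v) * emeasure lborel (cball (0 :: real ^ 'm) R)"
          by (subst nn_integral_add) (measurable, simp add: nn_integral_cmult_indicator)
        also have "ennreal (\<eta> / v) * emeasure lborel (cball (0 :: real ^ 'm) R) = ennreal \<eta>"
          using v assms by (simp flip: ennreal_mult)
        finally have "average T Z \<le> ennreal (1 / T ^ (CARD('n) * CARD('m))) *
            ((\<integral>\<^sup>+s. ennreal (kernel \<epsilon> s z') \<partial>lborel) + ennreal \<eta>)"
          using T unfolding Z by (subst average_scaleR) (auto simp: \<epsilon>_def intro: mult_left_mono)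
        also have "\<dots> = average T Z' + ennreal (1 / T ^ (CARD('n) * CARD('m))) * ennreal \<eta>"
          using T unfolding Z by (subst average_scaleR) (auto simp: \<epsilon>_def distrib_left)
        also have "ennreal (1 / T ^ (CARD('n) * CARD('m))) * ennreal \<eta> = ennreal (\<eta> / T ^ (CARD('n) * CARD('m)))"
          using T assms by (simp flip: ennreal_mult)
        finally show ?thesis by (simp add: ind)
      qed
    qed
    then show ?thesis using \<delta>(1) by (intro exI[of _ "min \<delta> 1"]) auto
  qed
  then show thesis using R(1) by (intro that[of "R + 1"]) auto
qed

text \<open>Rounding to cell corners moves a point by at most \<open>C\<close>, which is negligible
  against \<open>\<delta> * T\<close> once \<open>T\<close> is large. So the lattice sum, being the
  integral of \<open>average T\<close> after rounding, approaches the integral of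
  \<open>average T\<close>, whose value does not depend on \<open>T\<close>.\<close>

lemma lattice_sum_average_limit:
  assumes \<Lambda>: "\<Lambda> \<in> unimodular_lattices"
  shows "((\<lambda>T. \<integral>\<^sup>+W. average T W \<partial>count_space (tuples \<Lambda>)) \<longlongrightarrow>
    (\<integral>\<^sup>+y. ennreal (bump (y :: real ^ 'm)) \<partial>lborel) * (\<integral>\<^sup>+Z. F Z \<partial>lborel)) at_top"
proof (rule ennreal_tendstoI)
  show "(\<integral>\<^sup>+y. ennreal (bump (y :: real ^ 'm)) \<partial>lborel) * (\<integral>\<^sup>+Z. F Z \<partial>lborel) < \<infinity>"
    using bump_integral_finite[where 'm = 'm] integral_F_finite by (simp add: ennreal_mult_less_top)
  fix e :: real assume e: "e > 0"
  obtain \<rho> :: "real ^ 'n ^ 'm \<Rightarrow> real ^ 'n ^ 'm" and C where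
    \<rho>[measurable]: "\<rho> \<in> borel_measurable borel" and C: "\<And>Z. norm (\<rho> Z - Z) \<le> C" and
    sum: "\<And>Q. Q \<in> borel_measurable borel \<Longrightarrow>
      (\<integral>\<^sup>+Z. Q (\<rho> Z) \<partial>lborel) = (\<integral>\<^sup>+W. Q W \<partial>count_space (tuples \<Lambda>))"
    using lattice_rounding[OF \<Lambda>] by metis
  obtain R where R: "R > 0" "\<And>\<eta>. \<eta> > 0 \<Longrightarrow> \<exists>\<delta>>0. \<forall>T\<ge>1. \<forall>Z Z'. norm (Z - Z') < \<delta> * T \<longrightarrow>
    average T Z \<le> average T Z' + ennreal (\<eta> / T ^ (CARD('n) * CARD('m)))
      * (indicator (cball 0 (R * T)) Z * indicator (cball 0 (R * T)) Z')"
    using average_close by blast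
  \<comment> \<open>Used with \<open>p = \<rho>\<close> and \<open>q\<close> the identity, and
    conversely. The identity among the two yields the indicator of a ball of known volume.\<close>
  have bound: "\<forall>\<^sub>F T in at_top. (\<integral>\<^sup>+Z. average T (p Z) \<partial>lborel) \<le> (\<integral>\<^sup>+Z. average T (q Z) \<partial>lborel) + ennreal e"
    if [measurable]: "p \<in> borel_measurable borel" "q \<in> borel_measurable borel"
      and pq: "\<And>Z. norm (p Z - q Z) \<le> C" and id: "(\<forall>Z. p Z = Z) \<or> (\<forall>Z. q Z = Z)" for p q
  proof -
    \<comment> \<open>The ball of radius \<open>R * T\<close> has volume \<open>D\<close> times
      \<open>T\<close> to the power \<open>n m\<close>, so the choice \<open>\<eta> = e / D\<close>
      makes the total error \<open>e\<close>.\<close>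
    define D where "D = unit_ball_vol (DIM(real ^ 'n ^ 'm)) * R ^ (CARD('n) * CARD('m))"
    have D: "D > 0" using R(1) by (simp add: D_def)
    have vol: "emeasure lborel (cball (0 :: real ^ 'n ^ 'm) (R * T)) = ennreal (D * T ^ (CARD('n) * CARD('m)))"
      if "T \<ge> 1" for T
      using that R(1) by (subst emeasure_cball) (simp_all add: D_def power_mult_distrib mult.commute[of "CARD('m)"])
    obtain \<delta> where \<delta>: "\<delta> > 0" "\<And>T Z Z'. T \<ge> 1 \<Longrightarrow> norm (Z - Z') < \<delta> * T \<Longrightarrow>
        average T Z \<le> average T Z' + ennreal (e / D / T ^ (CARD('n) * CARD('m)))
          * (indicator (cball 0 (R * T)) Z * indicator (cball 0 (R * T)) Z')"
      using R(2)[of "e / D"] D e by auto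
    have "\<forall>\<^sub>F T in at_top. T \<ge> 1 \<and> T > C / \<delta>"
      by (intro eventually_conj eventually_ge_at_top eventually_gt_at_top)
    then show ?thesis
    proof eventually_elim
      case (elim T)
      then have "C < \<delta> * T" using \<delta>(1) by (simp add: pos_divide_less_eq mult.commute)
      have "(\<integral>\<^sup>+Z. average T (p Z) \<partial>lborel) \<le> (\<integral>\<^sup>+Z. average T (q Z)
          + ennreal (e / D / T ^ (CARD('n) * CARD('m))) * indicator (cball 0 (R * T)) Z \<partial>lborel)"
      proof (intro nn_integral_mono)
        fix Z
        have "average T (p Z) \<le> average T (q Z) + ennreal (e / D / T ^ (CARD('n) * CARD('m)))
            * (indicator (cball 0 (R * T)) (p Z) * indicator (cball 0 (R * T)) (q Z))"
          using elim pq[of Z] \<open>C < \<delta> * T\<close> by (intro \<delta>(2)) auto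
        also have "\<dots> \<le> average T (q Z) + ennreal (e / D / T ^ (CARD('n) * CARD('m))) * indicator (cball 0 (R * T)) Z"
          using id by (intro add_left_mono mult_left_mono) (auto split: split_indicator)
        finally show "average T (p Z) \<le> \<dots>" .
      qed
      also have "\<dots> = (\<integral>\<^sup>+Z. average T (q Z) \<partial>lborel)
          + ennreal (e / D / T ^ (CARD('n) * CARD('m))) * ennreal (D * T ^ (CARD('n) * CARD('m)))"
        using elim by (subst nn_integral_add) (measurable, simp add: nn_integral_cmult_indicator vol)
      also have "ennreal (e / D / T ^ (CARD('n) * CARD('m))) * ennreal (D * T ^ (CARD('n) * CARD('m))) = ennreal e"
        using D e elim by (simp flip: ennreal_mult)
      finally show ?case .
    qed
  qed
  have C': "norm (Z - \<rho> Z) \<le> C" for Z using C[of Z] by (simp add: norm_minus_commute)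
  have "\<forall>\<^sub>F T in at_top. (\<integral>\<^sup>+Z. average T (\<rho> Z) \<partial>lborel) \<le> (\<integral>\<^sup>+Z. average T Z \<partial>lborel) + ennreal e"
    by (rule bound) (auto simp: C)
  moreover have "\<forall>\<^sub>F T in at_top. (\<integral>\<^sup>+Z. average T Z \<partial>lborel) \<le> (\<integral>\<^sup>+Z. average T (\<rho> Z) \<partial>lborel) + ennreal e"
    by (rule bound) (auto simp: C')
  ultimately show "\<forall>\<^sub>F T in at_top. (\<integral>\<^sup>+W. average T W \<partial>count_space (tuples \<Lambda>))
      \<le> (\<integral>\<^sup>+y. ennreal (bump (y :: real ^ 'm)) \<partial>lborel) * (\<integral>\<^sup>+Z. F Z \<partial>lborel) + ennreal e \<and>
      (\<integral>\<^sup>+y. ennreal (bump (y :: real ^ 'm)) \<partial>lborel) * (\<integral>\<^sup>+Z. F Z \<partial>lborel)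
      \<le> (\<integral>\<^sup>+W. average T W \<partial>count_space (tuples \<Lambda>)) + ennreal e"
    using eventually_gt_at_top[of 0]
    by eventually_elim (simp add: integral_average sum)
qed

end

section \<open>Sums over lattices as random variables\<close>

text \<open>Multiply a cutoff in the distance to the complement by a cutoff at infinity. Since
  \<open>infdist\<close> to the empty set is 0, the set \<open>UNIV\<close> is excluded.\<close>

lemma open_compact_approximation:
  fixes U :: "'a :: euclidean_space set"
  assumes U: "open U" "U \<noteq> UNIV"
  obtains F :: "nat \<Rightarrow> 'a \<Rightarrow> real" and S where
    "\<And>n. continuous_on UNIV (F n)" "\<And>n x. F n x \<ge> 0" "\<And>x. incseq (\<lambda>n. F n x)"
    "\<And>x. (\<lambda>n. F n x) \<longlonglongrightarrow> indicator U x"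
    "\<And>n. compact (S n)" "\<And>n. S n \<subseteq> U" "\<And>n x. x \<notin> S n \<Longrightarrow> F n x = 0"
proof -
  define d where "d x = infdist x (- U)" for x
  \<comment> \<open>The shift by 1 keeps the support, for \<open>n > 0\<close>, at distance at least
    \<open>1 / n\<close> from the complement of \<open>U\<close>, hence compactly inside
    \<open>U\<close>.\<close>
  define F where "F n x = max 0 (min 1 (real n * d x - 1)) * max 0 (min 1 (real n - norm x))" for n x
  define S where "S n = {x. real n * d x \<ge> 1} \<inter> cball 0 (real n)" for n
  have d0: "d x \<ge> 0" for x by (simp add: d_def infdist_nonneg)
  have dU: "d x > 0 \<longleftrightarrow> x \<in> U" for x
    using in_closed_iff_infdist_zero[of "- U" x] U d0[of x] by (auto simp: d_def less_le)
  show thesis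
  proof (rule that)
    show "continuous_on UNIV (F n)" for n
      unfolding F_def d_def by (intro continuous_intros)
    show "F n x \<ge> 0" for n x by (simp add: F_def)
    show "incseq (\<lambda>n. F n x)" for x
    proof (rule incseq_SucI)
      fix n
      have "real n * d x \<le> real (Suc n) * d x" using d0[of x] by (intro mult_right_mono) auto
      then show "F n x \<le> F (Suc n) x"
        unfolding F_def by (intro mult_mono) auto
    qed
    show "(\<lambda>n. F n x) \<longlonglongrightarrow> indicator U x" for x
    proof (cases "x \<in> U")
      case True
      then have "d x > 0" by (simp add: dU)
      obtain N :: nat where N: "real N > 2 / d x" using reals_Archimedean2 by blast
      obtain N' :: nat where N': "real N' > norm x + 1" using reals_Archimedean2 by blast
      have "F n x = 1" if "n \<ge> max N N'" for n
      proof -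
        have "real n > 2 / d x" "real n > norm x + 1" using that N N' by linarith+
        then have "real n * d x > 2" using \<open>d x > 0\<close> by (simp add: pos_divide_less_eq)
        with \<open>real n > norm x + 1\<close> show ?thesis by (simp add: F_def)
      qed
      then have "\<forall>\<^sub>F n in sequentially. F n x = indicator U x"
        using True by (intro eventually_sequentiallyI[of "max N N'"]) simp
      then show ?thesis by (rule tendsto_eventually)
    next
      case False
      then have "d x = 0" using dU[of x] d0[of x] by simp
      then show ?thesis using False by (simp add: F_def)
    qed
    show "compact (S n)" for n
      unfolding S_def d_def by (intro closed_Int_compact closed_Collect_le continuous_intros) auto
    show "S n \<subseteq> U" for n
    proof
      fix x assume "x \<in> S n"
      then have "d x \<noteq> 0" by (auto simp: S_def)
      then show "x \<in> U" using dU[of x] d0[of x] by simp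
    qed
    show "F n x = 0" if "x \<notin> S n" for n x
      using that by (auto simp: F_def S_def)
  qed
qed

text \<open>Runs over all tuples, dependent ones included; restrictions on the rank are imposed
  through \<open>f\<close>.\<close>

definition lattice_sum :: "(real ^ 'n ^ 'm \<Rightarrow> ennreal) \<Rightarrow> (real ^ 'n) set \<Rightarrow> ennreal" where
  "lattice_sum f \<Lambda> = (\<integral>\<^sup>+W. f W \<partial>count_space (tuples \<Lambda>))"

section \<open>Measurability on the space of lattices\<close>

lemma space_lattice_borel: "space lattice_borel = unimodular_lattices"
  unfolding lattice_borel_def by (subst space_measure_of) auto

lemma lattice_borel_open:
  assumes "U \<subseteq> unimodular_lattices" "openin (top_of_set special_linear) {g \<in> special_linear. lattice_of g \<in> U}"
  shows "U \<in> sets lattice_borel"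
  unfolding lattice_borel_def by (subst sets_measure_of) (use assms in auto)

lemma bij_betw_tuples:
  fixes A :: "real ^ 'n ^ 'n" and X :: "(real ^ 'n ^ 'm) set"
  assumes "det A \<noteq> 0"
  shows "bij_betw (tuple_mult A) X (tuple_mult A ` X)"
proof -
  obtain B where B: "B ** A = mat 1"
    using assms by (auto simp: invertible_det_nz[symmetric] invertible_def)
  have "tuple_mult B (tuple_mult A Z) = Z" for Z :: "real ^ 'n ^ 'm"
    using B by (simp add: tuple_mult_mult[symmetric]) (simp add: vec_eq_iff)
  then show ?thesis by (intro inj_on_imp_bij_betw inj_on_inverseI)
qed

lemma lattice_sum_lattice_of:
  assumes "det g \<noteq> 0"
  shows "lattice_sum f (lattice_of g) = (\<integral>\<^sup>+W. f (tuple_mult g W) \<partial>count_space (tuples integer_vectors))"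
  unfolding lattice_sum_def tuples_lattice_of
  by (rule nn_integral_bij_count_space[symmetric]) (rule bij_betw_tuples[OF assms])

lemma lattice_of_mult: "(\<lambda>v. g *v v) ` lattice_of h = lattice_of (g ** h)"
  by (simp add: lattice_of_def image_image matrix_vector_mul_assoc)

lemma tuples_image: "tuples ((\<lambda>v. g *v v) ` \<Lambda>) = tuple_mult g ` tuples \<Lambda>"
proof (intro equalityI subsetI)
  fix W assume "W \<in> tuples ((\<lambda>v. g *v v) ` \<Lambda>)"
  then have "\<exists>v. v \<in> \<Lambda> \<and> W $ k = g *v v" for k
    by (auto simp: tuples_def)
  then obtain v where v: "\<And>k. v k \<in> \<Lambda>" "\<And>k. W $ k = g *v v k"
    by metis
  then have "W = tuple_mult g (\<chi> k. v k)" by (simp add: vec_eq_iff)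
  then show "W \<in> tuple_mult g ` tuples \<Lambda>"
    using v by (auto simp: tuples_def)
qed (auto simp: tuples_def)

lemma lattice_sum_image:
  assumes "det g \<noteq> 0"
  shows "lattice_sum f ((\<lambda>v. g *v v) ` \<Lambda>) = lattice_sum (\<lambda>W. f (tuple_mult g W)) \<Lambda>"
  unfolding lattice_sum_def tuples_image
  by (rule nn_integral_bij_count_space[symmetric]) (rule bij_betw_tuples[OF assms])

text \<open>The sum over a lattice is lower semicontinuous as a function of the basis, being a supremum of
  continuous partial sums.\<close>

lemma borel_measurable_lattice_sum_continuous:
  fixes F :: "real ^ 'n ^ 'm \<Rightarrow> real"
  assumes F: "continuous_on UNIV F" "\<And>Z. F Z \<ge> 0"
  shows "lattice_sum (\<lambda>W. ennreal (F W)) \<in> borel_measurable lattice_borel"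
proof (rule borel_measurableI_greater)
  fix c :: ennreal
  let ?I = "tuples integer_vectors :: (real ^ 'n ^ 'm) set"
  let ?U = "{\<Lambda> \<in> unimodular_lattices. c < lattice_sum (\<lambda>W. ennreal (F W)) \<Lambda>}"
  define b where "b = from_nat_into ?I"
  define D where "D = to_nat_on ?I ` ?I"
  have b: "bij_betw b D ?I"
    unfolding b_def D_def
    by (rule bij_betw_byWitness[where f' = "to_nat_on ?I"])
       (use countable_integer_tuples[where 'n = 'n and 'm = 'm] in \<open>auto simp: from_nat_into\<close>)
  define p where "p n g = (\<Sum>i<n. F (tuple_mult g (b i)) * indicator D i)" for n g
  have ls: "lattice_sum (\<lambda>W. ennreal (F W)) (lattice_of g) = (SUP n. ennreal (p n g))"
    if "g \<in> special_linear" for g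
  proof -
    have "lattice_sum (\<lambda>W. ennreal (F W)) (lattice_of g) = (\<integral>\<^sup>+W. ennreal (F (tuple_mult g W)) \<partial>count_space ?I)"
      using that by (intro lattice_sum_lattice_of) (simp add: special_linear_def)
    also have "\<dots> = (\<integral>\<^sup>+i. ennreal (F (tuple_mult g (b i))) \<partial>count_space D)"
      by (rule nn_integral_bij_count_space[symmetric, OF b])
    also have "\<dots> = (\<integral>\<^sup>+i. ennreal (F (tuple_mult g (b i))) * indicator D i \<partial>count_space UNIV)"
      by (rule nn_integral_count_space_indicator) simp
    also have "\<dots> = (\<Sum>i. ennreal (F (tuple_mult g (b i))) * indicator D i)"
      by (rule nn_integral_count_space_nat)
    also have "\<dots> = (SUP n. \<Sum>i<n. ennreal (F (tuple_mult g (b i))) * indicator D i)"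
      by (rule suminf_eq_SUP)
    also have "(\<lambda>n. \<Sum>i<n. ennreal (F (tuple_mult g (b i))) * indicator D i) = (\<lambda>n. ennreal (p n g))"
    proof
      fix n
      have "(\<Sum>i<n. ennreal (F (tuple_mult g (b i))) * indicator D i)
          = (\<Sum>i<n. ennreal (F (tuple_mult g (b i)) * indicator D i))"
        by (intro sum.cong refl) (simp split: split_indicator)
      also have "\<dots> = ennreal (p n g)"
        unfolding p_def using F(2) by (intro sum_ennreal) auto
      finally show "(\<Sum>i<n. ennreal (F (tuple_mult g (b i))) * indicator D i) = ennreal (p n g)" .
    qed
    finally show ?thesis .
  qed
  have "continuous_on special_linear (\<lambda>g. ennreal (p n g))" for n
  proof -
    have "continuous_on special_linear (\<lambda>g. tuple_mult g (b i))" for i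
      unfolding tuple_mult_def matrix_vector_mult_def by (intro continuous_intros)
    then show ?thesis unfolding p_def
      by (intro continuous_intros continuous_on_ennreal continuous_on_compose2[OF F(1)]) auto
  qed
  then have "openin (top_of_set special_linear) {g \<in> special_linear. c < ennreal (p n g)}" for n
    using continuous_openin_preimage_gen[of special_linear "\<lambda>g. ennreal (p n g)" "{c<..}"]
    by (auto simp: vimage_def Int_def)
  then have "openin (top_of_set special_linear) (\<Union>n. {g \<in> special_linear. c < ennreal (p n g)})"
    by (intro openin_Union) auto
  also have "(\<Union>n. {g \<in> special_linear. c < ennreal (p n g)}) = {g \<in> special_linear. lattice_of g \<in> ?U}"
    by (auto simp: ls less_SUP_iff unimodular_lattices_def)
  finally have "?U \<in> sets lattice_borel" by (intro lattice_borel_open) auto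
  then show "{\<Lambda> \<in> space lattice_borel. c < lattice_sum (\<lambda>W. ennreal (F W)) \<Lambda>} \<in> sets lattice_borel"
    by (simp add: space_lattice_borel)
qed

lemma lattice_sum_LIMSEQ:
  assumes "\<And>x. incseq (\<lambda>n. f n x)" "\<And>x. (\<lambda>n. f n x) \<longlonglongrightarrow> g x"
  shows "(\<lambda>n. lattice_sum (f n) \<Lambda>) \<longlonglongrightarrow> lattice_sum g \<Lambda>"
  unfolding lattice_sum_def using assms
  by (intro nn_integral_LIMSEQ) (auto simp: incseq_def le_fun_def)

lemma incseq_lattice_sum:
  assumes "\<And>x. incseq (\<lambda>n. f n x)"
  shows "incseq (\<lambda>n. lattice_sum (f n) \<Lambda>)"
  unfolding lattice_sum_def incseq_def using assms
  by (auto intro!: nn_integral_mono simp: incseq_def)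

lemma lattice_sum_bounded_finite:
  fixes A :: "(real ^ 'n ^ 'm) set"
  assumes \<Lambda>: "\<Lambda> \<in> unimodular_lattices" and A: "bounded A"
  shows "lattice_sum (indicator A) \<Lambda> < \<infinity>"
proof -
  obtain r where r: "A \<subseteq> cball 0 r" using A by (auto simp: bounded_iff subset_iff)
  have "lattice_sum (indicator A) \<Lambda> = (\<integral>\<^sup>+W. indicator (tuples \<Lambda> \<inter> A) W \<partial>count_space (tuples \<Lambda>))"
    unfolding lattice_sum_def by (intro nn_integral_cong) (auto split: split_indicator)
  also have "\<dots> = emeasure (count_space (tuples \<Lambda>)) (tuples \<Lambda> \<inter> A)"
    by (rule nn_integral_indicator) simp
  also have "\<dots> < \<infinity>"
  proof -
    have "finite (tuples \<Lambda> \<inter> A)"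
      by (rule finite_subset[OF _ finite_tuples_cball[OF \<Lambda>, of r]]) (use r in auto)
    then show ?thesis by (subst emeasure_count_space_finite) (auto simp: of_nat_less_top)
  qed
  finally show ?thesis .
qed

text \<open>Induction from the open sets, whose indicators are limits of continuous functions.
  Complements are handled by subtraction, which needs finite sums; therefore everything is first cut
  down to balls.\<close>

lemma borel_measurable_lattice_sum_indicator:
  fixes A :: "(real ^ 'n ^ 'm) set"
  assumes A: "A \<in> sets borel"
  shows "lattice_sum (indicator A) \<in> borel_measurable lattice_borel"
proof -
  have op: "lattice_sum (indicator U) \<in> borel_measurable lattice_borel"
    if U: "open U" "U \<noteq> UNIV" for U :: "(real ^ 'n ^ 'm) set"
  proof -
    obtain F :: "nat \<Rightarrow> real ^ 'n ^ 'm \<Rightarrow> real" where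
      F: "\<And>n. continuous_on UNIV (F n)" "\<And>n x. F n x \<ge> 0" "\<And>x. incseq (\<lambda>n. F n x)"
        "\<And>x. (\<lambda>n. F n x) \<longlonglongrightarrow> indicator U x"
      using open_compact_approximation[OF U] by metis
    have "(\<lambda>n. lattice_sum (\<lambda>W. ennreal (F n W)) \<Lambda>) \<longlonglongrightarrow> lattice_sum (indicator U) \<Lambda>" for \<Lambda>
    proof (rule lattice_sum_LIMSEQ)
      show "incseq (\<lambda>n. ennreal (F n x))" for x
        using F(3)[of x] by (auto simp: incseq_def intro: ennreal_leI)
      show "(\<lambda>n. ennreal (F n x)) \<longlonglongrightarrow> indicator U x" for x
        using tendsto_ennrealI[OF F(4)[of x]] by (simp add: ennreal_indicator)
    qed
    then show ?thesis
      by (rule borel_measurable_LIMSEQ_order) (intro borel_measurable_lattice_sum_continuous F)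
  qed
  have ball: "ball 0 r \<noteq> (UNIV :: (real ^ 'n ^ 'm) set)" for r
    using bounded_ball not_bounded_UNIV by metis
  have "\<forall>r. lattice_sum (indicator (A \<inter> ball 0 r)) \<in> borel_measurable lattice_borel"
  proof -
    have "Int_stable {S :: (real ^ 'n ^ 'm) set. open S}" "{S. open S} \<subseteq> Pow (UNIV :: (real ^ 'n ^ 'm) set)"
      "A \<in> sigma_sets UNIV {S. open S}"
      using A by (auto simp: borel_def Int_stable_def)
    then show "\<forall>r. lattice_sum (indicator (A \<inter> ball 0 r)) \<in> borel_measurable lattice_borel"
    proof (induction rule: sigma_sets_induct_disjoint)
      case (basic A)
      then show ?case using ball by (auto intro!: op)
    next
      case empty
      have "lattice_sum (indicator {} :: real ^ 'n ^ 'm \<Rightarrow> ennreal) \<in> borel_measurable lattice_borel"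
        by (rule op) auto
      then show ?case by (simp only: Int_empty_left simp_thms)
    next
      case (compl A)
      show ?case
      proof
        fix r
        have eq: "lattice_sum (indicator ((UNIV - A) \<inter> ball 0 r)) \<Lambda>
           = lattice_sum (indicator (ball 0 r :: (real ^ 'n ^ 'm) set)) \<Lambda> - lattice_sum (indicator (A \<inter> ball 0 r)) \<Lambda>"
          if "\<Lambda> \<in> space lattice_borel" for \<Lambda>
        proof -
          have "lattice_sum (indicator (A \<inter> ball 0 r)) \<Lambda> < \<infinity>"
            using that by (intro lattice_sum_bounded_finite) (auto simp: space_lattice_borel)
          moreover have "lattice_sum (indicator (ball 0 r :: (real ^ 'n ^ 'm) set)) \<Lambda>
            = lattice_sum (indicator ((UNIV - A) \<inter> ball 0 r)) \<Lambda> + lattice_sum (indicator (A \<inter> ball 0 r)) \<Lambda>"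
            unfolding lattice_sum_def
            by (subst nn_integral_add[symmetric]) (auto intro!: nn_integral_cong split: split_indicator)
          ultimately show ?thesis by (simp add: less_top)
        qed
        have "(\<lambda>\<Lambda>. lattice_sum (indicator (ball 0 r :: (real ^ 'n ^ 'm) set)) \<Lambda> - lattice_sum (indicator (A \<inter> ball 0 r)) \<Lambda>)
            \<in> borel_measurable lattice_borel"
          using compl op[of "ball 0 r"] ball by (intro borel_measurable_minus_ennreal) auto
        then show "lattice_sum (indicator ((UNIV - A) \<inter> ball 0 r)) \<in> borel_measurable lattice_borel"
          by (subst measurable_cong[OF eq])
      qed
    next
      case (union A)
      show ?case
      proof
        fix r
        have "lattice_sum (indicator ((\<Union>i. A i) \<inter> ball 0 r)) \<Lambda> = (\<Sum>i. lattice_sum (indicator (A i \<inter> ball 0 r)) \<Lambda>)" for \<Lambda>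
        proof -
          have "disjoint_family (\<lambda>i. A i \<inter> ball 0 r)"
            using union(1) by (auto simp: disjoint_family_on_def)
          then have "indicator ((\<Union>i. A i) \<inter> ball 0 r) W = (\<Sum>i. indicator (A i \<inter> ball 0 r) W :: ennreal)" for W
            by (subst suminf_indicator) (auto simp: Int_UN_distrib2)
          then have eq: "indicator ((\<Union>i. A i) \<inter> ball 0 r) = (\<lambda>W. \<Sum>i. indicator (A i \<inter> ball 0 r) W :: ennreal)"
            by (rule ext)
          show ?thesis unfolding lattice_sum_def eq
            by (rule nn_integral_suminf) simp
        qed
        moreover have "(\<lambda>\<Lambda>. \<Sum>i. lattice_sum (indicator (A i \<inter> ball 0 r)) \<Lambda>) \<in> borel_measurable lattice_borel"
          using union(3) by (intro borel_measurable_suminf_order) auto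
        ultimately show "lattice_sum (indicator ((\<Union>i. A i) \<inter> ball 0 r)) \<in> borel_measurable lattice_borel"
          by presburger
      qed
    qed
  qed
  then have m: "lattice_sum (indicator (A \<inter> ball 0 (real n))) \<in> borel_measurable lattice_borel" for n
    by blast
  have "(\<lambda>n. lattice_sum (indicator (A \<inter> ball 0 (real n))) \<Lambda>) \<longlonglongrightarrow> lattice_sum (indicator A) \<Lambda>" for \<Lambda>
  proof (rule lattice_sum_LIMSEQ)
    show "incseq (\<lambda>n. indicator (A \<inter> ball 0 (real n)) x :: ennreal)" for x
      by (auto simp: incseq_def split: split_indicator)
    show "(\<lambda>n. indicator (A \<inter> ball 0 (real n)) x :: ennreal) \<longlonglongrightarrow> indicator A x" for x
    proof -
      obtain N :: nat where "norm x < real N" using reals_Archimedean2 by blast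
      then have "\<forall>n\<ge>N. indicator (A \<inter> ball 0 (real n)) x = (indicator A x :: ennreal)"
        by (auto split: split_indicator)
      then show ?thesis by (intro tendsto_eventually) (auto simp: eventually_sequentially)
    qed
  qed
  then show ?thesis by (rule borel_measurable_LIMSEQ_order) (rule m)
qed

section \<open>Invariance of the Haar measure as a change of variables\<close>

lemma borel_measurable_act:
  fixes \<mu> :: "(real ^ 'n) set measure"
  assumes \<mu>: "sets \<mu> = sets lattice_borel" and g: "g \<in> special_linear"
  shows "(\<lambda>\<Lambda>. (\<lambda>v. g *v v) ` \<Lambda>) \<in> measurable \<mu> \<mu>"
proof -
  let ?act = "\<lambda>\<Lambda>. (\<lambda>v. g *v v) ` \<Lambda>"
  let ?G = "{U. U \<subseteq> unimodular_lattices \<and>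
         openin (top_of_set special_linear) {g \<in> special_linear. lattice_of g \<in> U}} :: (real ^ 'n) set set set"
  have gh: "g ** h \<in> special_linear" if "h \<in> special_linear" for h
    using g that by (simp add: special_linear_def det_mul)
  have sp: "?act \<Lambda> \<in> unimodular_lattices" if "\<Lambda> \<in> unimodular_lattices" for \<Lambda>
    using that gh by (auto simp: unimodular_lattices_def lattice_of_mult)
  have "?act \<in> measurable lattice_borel lattice_borel"
  proof (rule measurable_sigma_sets[where \<Omega> = unimodular_lattices and A = ?G])
    show "sets lattice_borel = sigma_sets unimodular_lattices ?G"
      unfolding lattice_borel_def by (rule sets_measure_of) auto
    show "?G \<subseteq> Pow unimodular_lattices" by auto
    show "?act \<in> space lattice_borel \<rightarrow> unimodular_lattices"
      using sp by (auto simp: space_lattice_borel)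
    fix U assume U: "U \<in> ?G"
    have "openin (top_of_set special_linear)
        (special_linear \<inter> (\<lambda>h. g ** h) -` {h \<in> special_linear. lattice_of h \<in> U})"
    proof (rule continuous_openin_preimage[where T = special_linear])
      show "continuous_on special_linear ((**) g)"
        unfolding matrix_matrix_mult_def by (intro continuous_intros)
    qed (use U gh in auto)
    also have "special_linear \<inter> (\<lambda>h. g ** h) -` {h \<in> special_linear. lattice_of h \<in> U}
      = {h \<in> special_linear. lattice_of h \<in> ?act -` U \<inter> unimodular_lattices}"
      using gh by (auto simp: lattice_of_mult unimodular_lattices_def)
    finally show "?act -` U \<inter> space lattice_borel \<in> sets lattice_borel"
      unfolding space_lattice_borel by (intro lattice_borel_open) auto
  qed
  then show ?thesis using measurable_cong_sets[OF \<mu> \<mu>] by auto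
qed

text \<open>\<open>haar_probability\<close> speaks of images of sets of lattices,
  \<open>distr\<close> of preimages; the preimage under \<open>g\<close> is the image under the
  inverse \<open>h\<close>.\<close>

lemma haar_distr_act:
  assumes haar: "haar_probability \<mu>" and g: "g \<in> special_linear"
  shows "distr \<mu> \<mu> (\<lambda>\<Lambda>. (\<lambda>v. g *v v) ` \<Lambda>) = \<mu>"
proof (rule measure_eqI)
  have \<mu>: "sets \<mu> = sets lattice_borel" using haar by (simp add: haar_probability_def)
  have sp: "space \<mu> = unimodular_lattices" using sets_eq_imp_space_eq[OF \<mu>] space_lattice_borel by simp
  note m = borel_measurable_act[OF \<mu> g]
  obtain h where h: "g ** h = mat 1" "h ** g = mat 1"
    using g by (auto simp: special_linear_def invertible_det_nz[symmetric] invertible_def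
        simp del: invertible_def) (metis invertible_def invertible_det_nz zero_neq_one)
  have "det g * det h = 1" using h by (metis det_I det_mul)
  then have hS: "h \<in> special_linear" using g by (simp add: special_linear_def)
  have gh: "(\<lambda>v. g *v v) ` (\<lambda>v. h *v v) ` \<Lambda> = \<Lambda>" "(\<lambda>v. h *v v) ` (\<lambda>v. g *v v) ` \<Lambda> = \<Lambda>" for \<Lambda>
    by (simp_all add: image_image matrix_vector_mul_assoc h)
  fix A assume "A \<in> sets (distr \<mu> \<mu> (\<lambda>\<Lambda>. (\<lambda>v. g *v v) ` \<Lambda>))"
  then have A: "A \<in> sets \<mu>" by simp
  have "(\<lambda>\<Lambda>. (\<lambda>v. g *v v) ` \<Lambda>) -` A \<inter> space \<mu> = (\<lambda>\<Lambda>. (\<lambda>v. h *v v) ` \<Lambda>) ` A"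
  proof (intro equalityI subsetI)
    fix \<Lambda> assume "\<Lambda> \<in> (\<lambda>\<Lambda>. (\<lambda>v. g *v v) ` \<Lambda>) -` A \<inter> space \<mu>"
    then have "(\<lambda>v. g *v v) ` \<Lambda> \<in> A" by simp
    then show "\<Lambda> \<in> (\<lambda>\<Lambda>. (\<lambda>v. h *v v) ` \<Lambda>) ` A" by (rule rev_image_eqI) (simp add: gh)
  next
    fix \<Lambda> assume "\<Lambda> \<in> (\<lambda>\<Lambda>. (\<lambda>v. h *v v) ` \<Lambda>) ` A"
    then obtain \<Lambda>' where "\<Lambda>' \<in> A" "\<Lambda> = (\<lambda>v. h *v v) ` \<Lambda>'" by auto
    moreover have "(\<lambda>v. h *v v) ` \<Lambda>' \<in> space \<mu>"
      using measurable_space[OF borel_measurable_act[OF \<mu> hS]] \<open>\<Lambda>' \<in> A\<close> sets.sets_into_space[OF A] by auto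
    ultimately show "\<Lambda> \<in> (\<lambda>\<Lambda>. (\<lambda>v. g *v v) ` \<Lambda>) -` A \<inter> space \<mu>" by (simp add: gh)
  qed
  then show "emeasure (distr \<mu> \<mu> (\<lambda>\<Lambda>. (\<lambda>v. g *v v) ` \<Lambda>)) A = emeasure \<mu> A"
    using haar hS A by (simp add: emeasure_distr[OF m A] haar_probability_def)
qed simp

text \<open>The outer function \<open>h\<close> is there for truncations of the sum, which are
  needed besides the sum itself.\<close>

lemma haar_lattice_sum_invariant:
  assumes haar: "haar_probability \<mu>" and g: "g \<in> special_linear"
    and h: "h \<in> borel_measurable borel" and f: "(\<lambda>\<Lambda>. h (lattice_sum f \<Lambda>)) \<in> borel_measurable \<mu>"
  shows "(\<integral>\<^sup>+\<Lambda>. h (lattice_sum (\<lambda>W. f (tuple_mult g W)) \<Lambda>) \<partial>\<mu>) = (\<integral>\<^sup>+\<Lambda>. h (lattice_sum f \<Lambda>) \<partial>\<mu>)"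
proof -
  have \<mu>: "sets \<mu> = sets lattice_borel" using haar by (simp add: haar_probability_def)
  have "(\<integral>\<^sup>+\<Lambda>. h (lattice_sum f \<Lambda>) \<partial>\<mu>) = (\<integral>\<^sup>+\<Lambda>. h (lattice_sum f \<Lambda>) \<partial>distr \<mu> \<mu> (\<lambda>\<Lambda>. (\<lambda>v. g *v v) ` \<Lambda>))"
    by (simp only: haar_distr_act[OF haar g])
  also have "\<dots> = (\<integral>\<^sup>+\<Lambda>. h (lattice_sum f ((\<lambda>v. g *v v) ` \<Lambda>)) \<partial>\<mu>)"
    by (rule nn_integral_distr[OF borel_measurable_act[OF \<mu> g]]) (use f in simp)
  also have "\<dots> = (\<integral>\<^sup>+\<Lambda>. h (lattice_sum (\<lambda>W. f (tuple_mult g W)) \<Lambda>) \<partial>\<mu>)"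
    using g by (subst lattice_sum_image) (auto simp: special_linear_def)
  finally show ?thesis ..
qed

section \<open>Joint measurability of the sheared sums\<close>

context pivot_function
begin

definition sheared_sum :: "real \<Rightarrow> real ^ 'm \<Rightarrow> (real ^ 'n) set \<Rightarrow> ennreal" where
  "sheared_sum T y \<Lambda> = lattice_sum (\<lambda>W. ennreal (F (tuple_mult (shear T y) W))) \<Lambda>"

lemma put_put: "put s (put t Z) = put s Z"
  by (simp add: put_def vec_eq_iff)

text \<open>The map \<open>u\<close> inverts the shear by an explicit formula that is continuous in
  \<open>y\<close> and the tuple together, so the image of a ball times \<open>S\<close> is
  compact.\<close>

lemma bounded_sheared_support:
  assumes T: "T > 0"
  obtains R where "\<And>y W. norm y \<le> r \<Longrightarrow> F (tuple_mult (shear T y) W) \<noteq> 0 \<Longrightarrow> norm W \<le> R"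
proof -
  define u :: "(real ^ 'm) \<times> (real ^ 'n ^ 'm) \<Rightarrow> real ^ 'n ^ 'm" where
    "u p = put (column (snd p) /\<^sub>R T ^ (CARD('n) - 1) - T *\<^sub>R (minor (snd p) *v fst p)) (T *\<^sub>R snd p)" for p
  have u: "u (y, tuple_mult (shear T y) W) = W" for y W
  proof -
    have "put (column W) W = W" by (simp add: put_def column_def vec_eq_iff)
    moreover have "column (put s Z) = s" for s Z by (simp add: put_def column_def vec_eq_iff)
    moreover have "T *\<^sub>R put s Z = put (T *\<^sub>R s) (T *\<^sub>R Z)" for s Z by (simp add: put_def vec_eq_iff)
    ultimately show ?thesis
      using T by (simp add: u_def tuple_mult_shear minor_scaleR put_put scaleR_matrix_vector_assoc[symmetric])
  qed
  have "continuous_on (cball 0 r \<times> S) u"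
    unfolding u_def matrix_vector_mult_def
    by (intro continuous_intros) (auto simp: minor_def intro!: continuous_intros)
  then have "compact (u ` (cball 0 r \<times> S))"
    using S_compact by (intro compact_continuous_image compact_Times) auto
  then obtain R where R: "\<And>X. X \<in> u ` (cball 0 r \<times> S) \<Longrightarrow> norm X \<le> R"
    using compact_imp_bounded bounded_iff by metis
  show thesis
  proof (rule that)
    fix y W assume "norm y \<le> r" "F (tuple_mult (shear T y) W) \<noteq> 0"
    then have "(y, tuple_mult (shear T y) W) \<in> cball 0 r \<times> S" using F_zero by auto
    then show "norm W \<le> R" using R u by (metis imageI)
  qed
qed

text \<open>For \<open>y\<close> in a ball only a fixed finite set of tuples contributes, which
  leaves a finite sum of continuous functions.\<close>

lemma continuous_on_sheared_sum:
  assumes T: "T > 0" and \<Lambda>: "\<Lambda> \<in> unimodular_lattices"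
  shows "continuous_on UNIV (\<lambda>y. sheared_sum T y \<Lambda>)"
proof -
  have "continuous_on (ball 0 r) (\<lambda>y. sheared_sum T y \<Lambda>)" for r
  proof -
    obtain R where R: "\<And>y W. norm y \<le> r \<Longrightarrow> F (tuple_mult (shear T y) W) \<noteq> 0 \<Longrightarrow> norm W \<le> R"
      using bounded_sheared_support[OF T] by metis
    let ?X = "tuples \<Lambda> \<inter> cball 0 R :: (real ^ 'n ^ 'm) set"
    have "sheared_sum T y \<Lambda> = ennreal (\<Sum>W\<in>?X. F (tuple_mult (shear T y) W))" if "y \<in> ball 0 r" for y
    proof -
      have "F (tuple_mult (shear T y) W) = 0" if "W \<notin> cball 0 R" for W
        using R[of y W] \<open>y \<in> ball 0 r\<close> that by auto
      then have "sheared_sum T y \<Lambda> = (\<Sum>W\<in>?X. ennreal (F (tuple_mult (shear T y) W)))"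
        unfolding sheared_sum_def lattice_sum_def
        by (intro nn_integral_count_space' finite_tuples_cball[OF \<Lambda>]) auto
      then show ?thesis by (simp add: F_nonneg)
    qed
    moreover have "continuous_on (ball 0 r) (\<lambda>y. ennreal (\<Sum>W\<in>?X. F (tuple_mult (shear T y) W)))"
      by (intro continuous_on_ennreal continuous_intros)
    ultimately show ?thesis by (subst continuous_on_cong[OF refl]) auto
  qed
  then have "continuous_on (\<Union>n::nat. ball 0 (real n)) (\<lambda>y. sheared_sum T y \<Lambda>)"
    by (intro continuous_on_open_UN) auto
  also have "(\<Union>n::nat. ball 0 (real n)) = (UNIV :: (real ^ 'm) set)"
    using reals_Archimedean2 by auto
  finally show ?thesis .
qed

text \<open>Continuity in \<open>y\<close> and measurability in \<open>\<Lambda>\<close> give joint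
  measurability: round \<open>y\<close> down to the grid of mesh \<open>1 / Suc N\<close>, where
  only countably many values occur, and let \<open>N\<close> grow.\<close>

lemma borel_measurable_sheared_sum:
  assumes T: "T > 0"
  shows "(\<lambda>(y, \<Lambda>). sheared_sum T y \<Lambda>) \<in> borel_measurable (borel \<Otimes>\<^sub>M lattice_borel)"
proof -
  define q :: "nat \<Rightarrow> ('m \<Rightarrow> int) \<Rightarrow> real ^ 'm" where "q N c = (\<chi> a. of_int (c a) / real (Suc N))" for N c
  define p :: "nat \<Rightarrow> real ^ 'm \<Rightarrow> 'm \<Rightarrow> int" where "p N y = (\<lambda>a. \<lfloor>real (Suc N) * y $ a\<rfloor>)" for N y
  have lim: "(\<lambda>N. q N (p N y)) \<longlonglongrightarrow> y" for y
  proof (rule vec_tendstoI)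
    fix a
    show "(\<lambda>N. q N (p N y) $ a) \<longlonglongrightarrow> y $ a"
    proof (rule LIMSEQ_I)
      fix e :: real assume "e > 0"
      then obtain M :: nat where M: "1 / e < real M" using reals_Archimedean2 by blast
      show "\<exists>no. \<forall>N\<ge>no. norm (q N (p N y) $ a - y $ a) < e"
      proof (intro exI allI impI)
        fix N assume "M \<le> N"
        then have "1 / e < real (Suc N)" using M by linarith
        then have e: "1 < e * real (Suc N)" using \<open>e > 0\<close> by (simp add: pos_divide_less_eq mult.commute)
        have "q N (p N y) $ a - y $ a = (of_int \<lfloor>real (Suc N) * y $ a\<rfloor> - real (Suc N) * y $ a) / real (Suc N)"
          by (simp add: q_def p_def field_simps)
        also have "\<bar>\<dots>\<bar> \<le> 1 / real (Suc N)"
          unfolding abs_divide by (intro divide_mono) (auto, linarith)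
        also have "\<dots> < e" using e by (simp add: pos_divide_less_eq)
        finally show "norm (q N (p N y) $ a - y $ a) < e" by simp
      qed
    qed
  qed
  have m: "(\<lambda>z. sheared_sum T (q N (p N (fst z))) (snd z)) \<in> borel_measurable (borel \<Otimes>\<^sub>M lattice_borel)" for N
  proof (rule measurable_compose_countable[where f = "\<lambda>c z. sheared_sum T (q N c) (snd z)"])
    show "(\<lambda>z. sheared_sum T (q N c) (snd z)) \<in> borel_measurable (borel \<Otimes>\<^sub>M lattice_borel)" for c
    proof (rule measurable_compose[OF measurable_snd])
      show "sheared_sum T (q N c) \<in> borel_measurable lattice_borel"
        unfolding sheared_sum_def[abs_def]
        by (intro borel_measurable_lattice_sum_continuous F_nonneg continuous_intros)
    qed
    show "(\<lambda>z. p N (fst z)) \<in> measurable (borel \<Otimes>\<^sub>M lattice_borel) (count_space UNIV)"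
    proof (rule measurable_compose[OF measurable_fst], subst measurable_count_space_eq2_countable, intro conjI ballI)
      fix c :: "'m \<Rightarrow> int"
      have "{y \<in> space borel. \<forall>a. \<lfloor>real (Suc N) * y $ a\<rfloor> = c a} \<in> sets (borel :: (real ^ 'm) measure)"
        by measurable
      then show "p N -` {c} \<inter> space borel \<in> sets borel"
        by (simp add: p_def vimage_def fun_eq_iff)
    qed auto
  qed
  show ?thesis
  proof (rule borel_measurable_LIMSEQ_order[OF _ m])
    fix z :: "(real ^ 'm) \<times> (real ^ 'n) set" assume "z \<in> space (borel \<Otimes>\<^sub>M lattice_borel)"
    then have "snd z \<in> unimodular_lattices" by (auto simp: space_pair_measure space_lattice_borel)
    then have "continuous_on UNIV (\<lambda>y. sheared_sum T y (snd z))"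
      by (rule continuous_on_sheared_sum[OF T])
    then have "(\<lambda>N. sheared_sum T (q N (p N (fst z))) (snd z)) \<longlonglongrightarrow> sheared_sum T (fst z) (snd z)"
      by (rule continuous_on_tendsto_compose[OF _ lim]) auto
    then show "(\<lambda>N. sheared_sum T (q N (p N (fst z))) (snd z)) \<longlonglongrightarrow> (case z of (y, \<Lambda>) \<Rightarrow> sheared_sum T y \<Lambda>)"
      by (simp add: split_beta)
  qed
qed

end

section \<open>The mean value formula of Siegel and Rogers\<close>

lemma haar_sets: "haar_probability \<mu> \<Longrightarrow> sets \<mu> = sets lattice_borel"
  by (simp add: haar_probability_def)

lemma haar_space: "haar_probability \<mu> \<Longrightarrow> space \<mu> = unimodular_lattices"
  by (metis haar_sets sets_eq_imp_space_eq space_lattice_borel)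

lemma haar_prob: "haar_probability \<mu> \<Longrightarrow> prob_space \<mu>"
  by (simp add: haar_probability_def)

lemma borel_measurable_haar:
  "haar_probability \<mu> \<Longrightarrow> f \<in> borel_measurable lattice_borel \<Longrightarrow> f \<in> borel_measurable \<mu>"
  using measurable_cong_sets[OF haar_sets refl] by blast

context pivot_function
begin

text \<open>Invariance makes the expectation for fixed \<open>y\<close> independent of
  \<open>y\<close>, so exchanging the integrals leaves the total mass of \<open>bump\<close> as a
  factor. It is applied with \<open>h\<close> the identity and with \<open>h\<close> a
  truncation.\<close>

lemma expectation_sheared:
  assumes haar: "haar_probability \<mu>" and T: "T > 0" and h: "h \<in> borel_measurable borel"
  shows "(\<integral>\<^sup>+\<Lambda>. \<integral>\<^sup>+y. ennreal (bump y) * h (sheared_sum T y \<Lambda>) \<partial>lborel \<partial>\<mu>) =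
    (\<integral>\<^sup>+y. ennreal (bump (y :: real ^ 'm)) \<partial>lborel) * (\<integral>\<^sup>+\<Lambda>. h (lattice_sum (\<lambda>W. ennreal (F W)) \<Lambda>) \<partial>\<mu>)"
proof -
  interpret prob_space \<mu> by (rule haar_prob[OF haar])
  interpret pair_sigma_finite lborel \<mu> ..
  have "sets (lborel \<Otimes>\<^sub>M \<mu>) = sets (borel \<Otimes>\<^sub>M lattice_borel)"
    by (intro sets_pair_measure_cong haar_sets[OF haar]) simp
  then have "(\<lambda>(y, \<Lambda>). sheared_sum T y \<Lambda>) \<in> borel_measurable (lborel \<Otimes>\<^sub>M \<mu>)"
    using borel_measurable_sheared_sum[OF T] measurable_cong_sets by blast
  from measurable_compose[OF this h]
  have "(\<lambda>z. ennreal (bump (fst z)) * h (case z of (y, \<Lambda>) \<Rightarrow> sheared_sum T y \<Lambda>)) \<in> borel_measurable (lborel \<Otimes>\<^sub>M \<mu>)"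
    by measurable
  then have m: "(\<lambda>(y, \<Lambda>). ennreal (bump y) * h (sheared_sum T y \<Lambda>)) \<in> borel_measurable (lborel \<Otimes>\<^sub>M \<mu>)"
    by (simp add: split_beta)
  have m': "(\<lambda>\<Lambda>. h (lattice_sum (\<lambda>W. ennreal (G W)) \<Lambda>)) \<in> borel_measurable \<mu>"
    if "continuous_on UNIV G" "\<And>Z. G Z \<ge> 0" for G :: "real ^ 'n ^ 'm \<Rightarrow> real"
    using measurable_compose[OF borel_measurable_haar[OF haar borel_measurable_lattice_sum_continuous[OF that]] h] .
  have "(\<integral>\<^sup>+\<Lambda>. \<integral>\<^sup>+y. ennreal (bump y) * h (sheared_sum T y \<Lambda>) \<partial>lborel \<partial>\<mu>)
      = (\<integral>\<^sup>+y. \<integral>\<^sup>+\<Lambda>. ennreal (bump y) * h (sheared_sum T y \<Lambda>) \<partial>\<mu> \<partial>lborel)"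
    by (rule Fubini'[OF m])
  also have "\<dots> = (\<integral>\<^sup>+y. ennreal (bump (y :: real ^ 'm)) * (\<integral>\<^sup>+\<Lambda>. h (lattice_sum (\<lambda>W. ennreal (F W)) \<Lambda>) \<partial>\<mu>) \<partial>lborel)"
  proof (rule nn_integral_cong)
    fix y
    have "(\<integral>\<^sup>+\<Lambda>. ennreal (bump y) * h (sheared_sum T y \<Lambda>) \<partial>\<mu>)
        = ennreal (bump y) * (\<integral>\<^sup>+\<Lambda>. h (sheared_sum T y \<Lambda>) \<partial>\<mu>)"
      unfolding sheared_sum_def
      by (intro nn_integral_cmult m' F_nonneg continuous_intros)
    also have "(\<integral>\<^sup>+\<Lambda>. h (sheared_sum T y \<Lambda>) \<partial>\<mu>) = (\<integral>\<^sup>+\<Lambda>. h (lattice_sum (\<lambda>W. ennreal (F W)) \<Lambda>) \<partial>\<mu>)"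
      unfolding sheared_sum_def
      by (rule haar_lattice_sum_invariant[OF haar _ h])
         (auto simp: special_linear_def det_shear[OF T] intro!: m' F_nonneg F_cont)
    finally show "(\<integral>\<^sup>+\<Lambda>. ennreal (bump y) * h (sheared_sum T y \<Lambda>) \<partial>\<mu>)
        = ennreal (bump y) * (\<integral>\<^sup>+\<Lambda>. h (lattice_sum (\<lambda>W. ennreal (F W)) \<Lambda>) \<partial>\<mu>)" .
  qed
  also have "\<dots> = (\<integral>\<^sup>+y. ennreal (bump (y :: real ^ 'm)) \<partial>lborel) * (\<integral>\<^sup>+\<Lambda>. h (lattice_sum (\<lambda>W. ennreal (F W)) \<Lambda>) \<partial>\<mu>)"
    by (rule nn_integral_multc) measurable
  finally show ?thesis .
qed

lemma sheared_sum_limit: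
  assumes \<Lambda>: "\<Lambda> \<in> unimodular_lattices"
  shows "((\<lambda>T. \<integral>\<^sup>+y. ennreal (bump y) * sheared_sum T y \<Lambda> \<partial>lborel) \<longlongrightarrow>
    (\<integral>\<^sup>+y. ennreal (bump (y :: real ^ 'm)) \<partial>lborel) * (\<integral>\<^sup>+Z. F Z \<partial>lborel)) at_top"
proof -
  have "(\<integral>\<^sup>+y. ennreal (bump y) * sheared_sum T y \<Lambda> \<partial>lborel) = (\<integral>\<^sup>+W. average T W \<partial>count_space (tuples \<Lambda>))" for T
  proof -
    have m: "(\<lambda>y. ennreal (bump y) * ennreal (F (tuple_mult (shear T y) W))) \<in> borel_measurable lborel" for W
    proof -
      have "(\<lambda>y. F (tuple_mult (shear T y) W)) \<in> borel_measurable borel"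
        by (intro borel_measurable_continuous_onI continuous_intros)
      then show ?thesis by measurable
    qed
    have "(\<integral>\<^sup>+y. ennreal (bump y) * sheared_sum T y \<Lambda> \<partial>lborel)
        = (\<integral>\<^sup>+y. \<integral>\<^sup>+W. ennreal (bump y) * ennreal (F (tuple_mult (shear T y) W)) \<partial>count_space (tuples \<Lambda>) \<partial>lborel)"
      unfolding sheared_sum_def lattice_sum_def by (simp add: nn_integral_cmult)
    also have "\<dots> = (\<integral>\<^sup>+W. average T W \<partial>count_space (tuples \<Lambda>))"
      unfolding average_def by (rule nn_integral_count_space_nn_integral[OF countable_tuples[OF \<Lambda>] m])
    finally show ?thesis .
  qed
  then show ?thesis using lattice_sum_average_limit[OF \<Lambda>] by simp
qed

text \<open>By invariance the expectation may be averaged over the shears. The averages converge for every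
  single lattice, so Fatou's lemma gives one inequality; truncating the sum at height \<open>M\<close> makes
  dominated convergence available for the other one.\<close>

lemma lattice_sum_expectation:
  assumes haar: "haar_probability \<mu>"
  shows "(\<integral>\<^sup>+\<Lambda>. lattice_sum (\<lambda>W. ennreal (F W)) \<Lambda> \<partial>\<mu>) = (\<integral>\<^sup>+Z. F Z \<partial>lborel)"
proof -
  interpret prob_space \<mu> by (rule haar_prob[OF haar])
  define \<kappa> where "\<kappa> = (\<integral>\<^sup>+y. ennreal (bump (y :: real ^ 'm)) \<partial>lborel)"
  have \<kappa>: "\<kappa> \<noteq> 0" "\<kappa> \<noteq> \<infinity>"
    using bump_integral_pos[where 'm = 'm] bump_integral_finite[where 'm = 'm] by (auto simp: \<kappa>_def)
  let ?I = "\<integral>\<^sup>+Z. F Z \<partial>lborel"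
  let ?\<phi> = "lattice_sum (\<lambda>W. ennreal (F W))"
  \<comment> \<open>A sequence of parameters, as Fatou's lemma and dominated convergence require;
    \<open>Suc\<close> keeps them positive.\<close>
  define A where "A k \<Lambda> = (\<integral>\<^sup>+y. ennreal (bump y) * sheared_sum (real (Suc k)) y \<Lambda> \<partial>lborel)" for k \<Lambda>
  have lim: "(\<lambda>k. A k \<Lambda>) \<longlonglongrightarrow> \<kappa> * ?I" if "\<Lambda> \<in> space \<mu>" for \<Lambda>
    unfolding A_def \<kappa>_def
    by (rule filterlim_compose[OF sheared_sum_limit filterlim_compose[OF filterlim_real_sequentially filterlim_Suc]])
       (use that haar_space[OF haar] in simp)
  have EA: "(\<integral>\<^sup>+\<Lambda>. A k \<Lambda> \<partial>\<mu>) = \<kappa> * (\<integral>\<^sup>+\<Lambda>. ?\<phi> \<Lambda> \<partial>\<mu>)" for k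
    unfolding A_def \<kappa>_def using expectation_sheared[OF haar, of "real (Suc k)" "\<lambda>x. x"] by simp
  have mF: "?\<phi> \<in> borel_measurable \<mu>"
    by (intro borel_measurable_haar[OF haar] borel_measurable_lattice_sum_continuous F_cont F_nonneg)
  have mA[measurable]: "A k \<in> borel_measurable \<mu>" for k
  proof -
    have "sets (\<mu> \<Otimes>\<^sub>M lborel) = sets (lattice_borel \<Otimes>\<^sub>M borel)"
      by (intro sets_pair_measure_cong haar_sets[OF haar]) simp
    moreover have "(\<lambda>(\<Lambda>, y). sheared_sum (real (Suc k)) y \<Lambda>) \<in> borel_measurable (lattice_borel \<Otimes>\<^sub>M borel)"
      using measurable_pair_swap[OF borel_measurable_sheared_sum[of "real (Suc k)"]] by simp
    ultimately have "(\<lambda>(\<Lambda>, y). sheared_sum (real (Suc k)) y \<Lambda>) \<in> borel_measurable (\<mu> \<Otimes>\<^sub>M lborel)"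
      using measurable_cong_sets by blast
    then have "(\<lambda>(\<Lambda>, y). ennreal (bump y) * sheared_sum (real (Suc k)) y \<Lambda>) \<in> borel_measurable (\<mu> \<Otimes>\<^sub>M lborel)"
      unfolding split_beta by measurable
    then show ?thesis unfolding A_def by (rule lborel.borel_measurable_nn_integral)
  qed
  have "?I \<le> (\<integral>\<^sup>+\<Lambda>. ?\<phi> \<Lambda> \<partial>\<mu>)"
  proof -
    have "\<kappa> * ?I = (\<integral>\<^sup>+\<Lambda>. \<kappa> * ?I \<partial>\<mu>)" by (simp add: emeasure_space_1)
    also have "\<dots> = (\<integral>\<^sup>+\<Lambda>. liminf (\<lambda>k. A k \<Lambda>) \<partial>\<mu>)"
    proof (rule nn_integral_cong)
      fix \<Lambda> assume "\<Lambda> \<in> space \<mu>"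
      from lim_imp_Liminf[OF _ lim[OF this]] show "\<kappa> * ?I = liminf (\<lambda>k. A k \<Lambda>)" by simp
    qed
    also have "\<dots> \<le> liminf (\<lambda>k. \<integral>\<^sup>+\<Lambda>. A k \<Lambda> \<partial>\<mu>)" by (rule nn_integral_liminf) measurable
    also have "\<dots> = \<kappa> * (\<integral>\<^sup>+\<Lambda>. ?\<phi> \<Lambda> \<partial>\<mu>)" by (simp add: EA Liminf_const)
    finally show ?thesis using \<kappa> by (simp add: ennreal_mult_le_mult_iff)
  qed
  moreover have "(\<integral>\<^sup>+\<Lambda>. ?\<phi> \<Lambda> \<partial>\<mu>) \<le> ?I"
  proof (rule LIMSEQ_le_const2)
    show "(\<lambda>M. \<integral>\<^sup>+\<Lambda>. min (?\<phi> \<Lambda>) (of_nat M) \<partial>\<mu>) \<longlonglongrightarrow> (\<integral>\<^sup>+\<Lambda>. ?\<phi> \<Lambda> \<partial>\<mu>)"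
    proof (rule nn_integral_LIMSEQ)
      show "incseq (\<lambda>M \<Lambda>. min (?\<phi> \<Lambda>) (of_nat M))"
        by (auto simp: incseq_def le_fun_def min_le_iff_disj)
      show "(\<lambda>\<Lambda>. min (?\<phi> \<Lambda>) (of_nat M)) \<in> borel_measurable \<mu>" for M using mF by measurable
      show "(\<lambda>M. min (?\<phi> \<Lambda>) (of_nat M)) \<longlonglongrightarrow> ?\<phi> \<Lambda>" for \<Lambda>
        using tendsto_min[OF tendsto_const of_nat_tendsto_top_ennreal, of "?\<phi> \<Lambda>"] by simp
    qed
    have "\<kappa> * (\<integral>\<^sup>+\<Lambda>. min (?\<phi> \<Lambda>) (of_nat M) \<partial>\<mu>) \<le> \<kappa> * ?I" for M
    proof -
      \<comment> \<open>The average of the truncated sums lies below the truncated average, and the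
        latter converges pointwise and boundedly.\<close>
      have "\<kappa> * (\<integral>\<^sup>+\<Lambda>. min (?\<phi> \<Lambda>) (of_nat M) \<partial>\<mu>) \<le> (\<integral>\<^sup>+\<Lambda>. min (A k \<Lambda>) (\<kappa> * of_nat M) \<partial>\<mu>)" for k
      proof -
        have "\<kappa> * (\<integral>\<^sup>+\<Lambda>. min (?\<phi> \<Lambda>) (of_nat M) \<partial>\<mu>)
            = (\<integral>\<^sup>+\<Lambda>. \<integral>\<^sup>+y. ennreal (bump y) * min (sheared_sum (real (Suc k)) y \<Lambda>) (of_nat M) \<partial>lborel \<partial>\<mu>)"
          unfolding \<kappa>_def by (rule expectation_sheared[OF haar, symmetric]) auto
        also have "\<dots> \<le> (\<integral>\<^sup>+\<Lambda>. min (A k \<Lambda>) (\<kappa> * of_nat M) \<partial>\<mu>)"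
        proof (intro nn_integral_mono min.boundedI)
          fix \<Lambda>
          show "(\<integral>\<^sup>+y. ennreal (bump y) * min (sheared_sum (real (Suc k)) y \<Lambda>) (of_nat M) \<partial>lborel) \<le> A k \<Lambda>"
            unfolding A_def by (intro nn_integral_mono mult_left_mono) auto
          have "(\<integral>\<^sup>+y. ennreal (bump y) * min (sheared_sum (real (Suc k)) y \<Lambda>) (of_nat M) \<partial>lborel)
              \<le> (\<integral>\<^sup>+y. ennreal (bump (y :: real ^ 'm)) * of_nat M \<partial>lborel)"
            by (intro nn_integral_mono mult_left_mono) auto
          also have "\<dots> = \<kappa> * of_nat M" unfolding \<kappa>_def by (rule nn_integral_multc) measurable
          finally show "(\<integral>\<^sup>+y. ennreal (bump y) * min (sheared_sum (real (Suc k)) y \<Lambda>) (of_nat M) \<partial>lborel) \<le> \<kappa> * of_nat M" .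
        qed
        finally show ?thesis .
      qed
      moreover have "(\<lambda>k. \<integral>\<^sup>+\<Lambda>. min (A k \<Lambda>) (\<kappa> * of_nat M) \<partial>\<mu>) \<longlonglongrightarrow> (\<integral>\<^sup>+\<Lambda>. min (\<kappa> * ?I) (\<kappa> * of_nat M) \<partial>\<mu>)"
      proof (rule nn_integral_dominated_convergence[where w = "\<lambda>_. \<kappa> * of_nat M"])
        show "(\<integral>\<^sup>+\<Lambda>. \<kappa> * of_nat M \<partial>\<mu>) < \<infinity>"
          using \<kappa> by (simp add: emeasure_space_1 ennreal_mult_less_top less_top of_nat_less_top)
        show "AE \<Lambda> in \<mu>. (\<lambda>k. min (A k \<Lambda>) (\<kappa> * of_nat M)) \<longlonglongrightarrow> min (\<kappa> * ?I) (\<kappa> * of_nat M)"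
          by (intro AE_I2 tendsto_min lim tendsto_const)
      qed auto
      ultimately have "\<kappa> * (\<integral>\<^sup>+\<Lambda>. min (?\<phi> \<Lambda>) (of_nat M) \<partial>\<mu>) \<le> (\<integral>\<^sup>+\<Lambda>. min (\<kappa> * ?I) (\<kappa> * of_nat M) \<partial>\<mu>)"
        by (intro LIMSEQ_le_const) auto
      also have "\<dots> \<le> \<kappa> * ?I" by (simp add: emeasure_space_1)
      finally show ?thesis .
    qed
    then show "\<exists>N. \<forall>M\<ge>N. (\<integral>\<^sup>+\<Lambda>. min (?\<phi> \<Lambda>) (of_nat M) \<partial>\<mu>) \<le> ?I"
      using \<kappa> by (simp add: ennreal_mult_le_mult_iff)
  qed
  ultimately show ?thesis by (rule antisym[rotated])
qed

end

text \<open>The expected number of lattice tuples in \<open>A\<close>, as a function of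
  \<open>A\<close>. Once this is a measure, uniqueness theorems and disjoint decompositions become
  available.\<close>

definition intensity :: "(real ^ 'n) set measure \<Rightarrow> (real ^ 'n ^ 'm) measure" where
  "intensity \<mu> = measure_of UNIV (sets borel) (\<lambda>A. \<integral>\<^sup>+\<Lambda>. lattice_sum (indicator A) \<Lambda> \<partial>\<mu>)"

lemma sets_intensity [simp, measurable_cong]: "sets (intensity \<mu>) = sets borel"
  unfolding intensity_def by (metis sets.sets_measure_of_eq space_borel)

lemma emeasure_intensity:
  fixes A :: "(real ^ 'n ^ 'm) set"
  assumes haar: "haar_probability \<mu>" and A: "A \<in> sets borel"
  shows "emeasure (intensity \<mu>) A = (\<integral>\<^sup>+\<Lambda>. lattice_sum (indicator A) \<Lambda> \<partial>\<mu>)"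
proof (rule emeasure_measure_of[OF intensity_def])
  show "sets borel \<subseteq> Pow UNIV" "A \<in> sets (intensity \<mu>)" using A by auto
  have "sets (borel :: (real ^ 'n ^ 'm) measure) = sets (intensity \<mu>)" by simp
  show "positive (sets (intensity \<mu>)) (\<lambda>A. \<integral>\<^sup>+\<Lambda>. lattice_sum (indicator A :: real ^ 'n ^ 'm \<Rightarrow> ennreal) \<Lambda> \<partial>\<mu>)"
    by (simp add: positive_def lattice_sum_def)
  show "countably_additive (sets (intensity \<mu>)) (\<lambda>A. \<integral>\<^sup>+\<Lambda>. lattice_sum (indicator A :: real ^ 'n ^ 'm \<Rightarrow> ennreal) \<Lambda> \<partial>\<mu>)"
  proof (rule countably_additiveI)
    fix B :: "nat \<Rightarrow> (real ^ 'n ^ 'm) set"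
    assume B: "range B \<subseteq> sets (intensity \<mu>)" "disjoint_family B"
    have m: "lattice_sum (indicator (B i)) \<in> borel_measurable \<mu>" for i
      using B by (intro borel_measurable_haar[OF haar] borel_measurable_lattice_sum_indicator) auto
    have eq: "(indicator (\<Union>i. B i) :: real ^ 'n ^ 'm \<Rightarrow> ennreal) = (\<lambda>W. \<Sum>i. indicator (B i) W)"
      by (rule ext, rule suminf_indicator[OF B(2), symmetric])
    have "lattice_sum (indicator (\<Union>i. B i)) \<Lambda> = (\<Sum>i. lattice_sum (indicator (B i)) \<Lambda>)" for \<Lambda>
      unfolding eq lattice_sum_def by (rule nn_integral_suminf) simp
    then show "(\<Sum>i. \<integral>\<^sup>+\<Lambda>. lattice_sum (indicator (B i)) \<Lambda> \<partial>\<mu>) = (\<integral>\<^sup>+\<Lambda>. lattice_sum (indicator (\<Union>i. B i)) \<Lambda> \<partial>\<mu>)"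
      using m by (simp add: nn_integral_suminf)
  qed
qed

context pivot
begin

text \<open>Approximates the indicator of \<open>U\<close> from below by functions of the kind
  treated in \<open>pivot_function\<close>; monotone convergence applies on both sides.\<close>

lemma intensity_open:
  assumes haar: "haar_probability \<mu>" and U: "open U" "\<And>Z. Z \<in> U \<Longrightarrow> det (minor Z) \<noteq> 0"
  shows "emeasure (intensity \<mu>) U = emeasure lborel U"
proof -
  \<comment> \<open>The zero tuple has zero minor, so \<open>U\<close> omits it; the approximation
    requires \<open>U \<noteq> UNIV\<close>.\<close>
  have "det (0 :: real ^ 'm ^ 'm) = 0" using det_scaleR[of 0 "0 :: real ^ 'm ^ 'm"] by (simp add: zero_power)
  moreover have "minor 0 = 0" by (simp add: minor_def vec_eq_iff)
  ultimately have "0 \<notin> U" using U(2)[of 0] by auto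
  then have "U \<noteq> UNIV" by auto
  then obtain F :: "nat \<Rightarrow> real ^ 'n ^ 'm \<Rightarrow> real" and S where
    F: "\<And>n. continuous_on UNIV (F n)" "\<And>n x. F n x \<ge> 0" "\<And>x. incseq (\<lambda>n. F n x)"
      "\<And>x. (\<lambda>n. F n x) \<longlonglongrightarrow> indicator U x"
    and S: "\<And>n. compact (S n)" "\<And>n. S n \<subseteq> U" "\<And>n x. x \<notin> S n \<Longrightarrow> F n x = 0"
    using open_compact_approximation[OF U(1)] by metis
  have inc: "incseq (\<lambda>n. ennreal (F n x))" for x
    using F(3)[of x] by (auto simp: incseq_def intro: ennreal_leI)
  have lim: "(\<lambda>n. ennreal (F n x)) \<longlonglongrightarrow> indicator U x" for x
    using tendsto_ennrealI[OF F(4)[of x]] by (simp add: ennreal_indicator)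
  have "(\<lambda>n. \<integral>\<^sup>+\<Lambda>. lattice_sum (\<lambda>W. ennreal (F n W)) \<Lambda> \<partial>\<mu>) \<longlonglongrightarrow> (\<integral>\<^sup>+\<Lambda>. lattice_sum (indicator U) \<Lambda> \<partial>\<mu>)"
  proof (rule nn_integral_LIMSEQ)
    show "incseq (\<lambda>n. lattice_sum (\<lambda>W. ennreal (F n W)))"
      using incseq_lattice_sum[of "\<lambda>n W. ennreal (F n W)", OF inc] by (auto simp: incseq_def le_fun_def)
    show "lattice_sum (\<lambda>W. ennreal (F n W)) \<in> borel_measurable \<mu>" for n
      by (intro borel_measurable_haar[OF haar] borel_measurable_lattice_sum_continuous F)
    show "(\<lambda>n. lattice_sum (\<lambda>W. ennreal (F n W)) \<Lambda>) \<longlonglongrightarrow> lattice_sum (indicator U) \<Lambda>" for \<Lambda>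
      by (rule lattice_sum_LIMSEQ[of "\<lambda>n W. ennreal (F n W)", OF inc lim])
  qed
  moreover have "(\<integral>\<^sup>+\<Lambda>. lattice_sum (\<lambda>W. ennreal (F n W)) \<Lambda> \<partial>\<mu>) = (\<integral>\<^sup>+Z. ennreal (F n Z) \<partial>lborel)" for n
  proof -
    interpret pivot_function i0 J "F n" "S n"
      by unfold_locales (use F(1,2) S(1,3) subsetD[OF S(2)] U(2) in auto)
    show ?thesis by (rule lattice_sum_expectation[OF haar])
  qed
  moreover have "(\<lambda>n. \<integral>\<^sup>+Z. ennreal (F n Z) \<partial>lborel) \<longlonglongrightarrow> (\<integral>\<^sup>+Z. indicator U Z \<partial>lborel)"
  proof (rule nn_integral_LIMSEQ)
    show "incseq (\<lambda>n Z. ennreal (F n Z))" using inc by (auto simp: incseq_def le_fun_def)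
    show "(\<lambda>Z. ennreal (F n Z)) \<in> borel_measurable lborel" for n
      using borel_measurable_continuous_onI[OF F(1)] by measurable
  qed (rule lim)
  ultimately have "(\<integral>\<^sup>+\<Lambda>. lattice_sum (indicator U) \<Lambda> \<partial>\<mu>) = (\<integral>\<^sup>+Z. indicator U Z \<partial>lborel)"
    using LIMSEQ_unique by auto
  then show ?thesis using U(1) by (simp add: emeasure_intensity[OF haar])
qed

text \<open>Restricted to the open set \<open>\<Omega>\<close> of non-zero minors, the two measures
  agree on open sets, which are stable under intersection; balls provide the finite
  exhaustion.\<close>

lemma intensity_minor:
  assumes haar: "haar_probability \<mu>" and A: "A \<in> sets borel" "\<And>Z. Z \<in> A \<Longrightarrow> det (minor Z) \<noteq> 0"
  shows "emeasure (intensity \<mu>) A = emeasure lborel A"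
proof -
  define \<Omega> where "\<Omega> = {Z. det (minor Z) \<noteq> 0}"
  have \<Omega>: "open \<Omega>" unfolding \<Omega>_def by (intro open_Collect_neq continuous_intros)
  have eq: "emeasure (density (intensity \<mu>) (indicator \<Omega>)) X = emeasure (density lborel (indicator \<Omega>)) X"
    if X: "open X" for X
  proof -
    have "emeasure (intensity \<mu>) (\<Omega> \<inter> X) = emeasure lborel (\<Omega> \<inter> X)"
      using \<Omega> X by (intro intensity_open[OF haar]) (auto simp: \<Omega>_def)
    then show ?thesis using \<Omega> X by (simp add: emeasure_restricted)
  qed
  have "density (intensity \<mu>) (indicator \<Omega>) = density lborel (indicator \<Omega>)"
  proof (rule measure_eqI_generator_eq[where E = "{S. open S}" and A = "\<lambda>n. ball 0 (real n)" and \<Omega> = UNIV])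
    show "Int_stable {S :: (real ^ 'n ^ 'm) set. open S}" by (auto simp: Int_stable_def)
    show "emeasure (density (intensity \<mu>) (indicator \<Omega>)) X = emeasure (density lborel (indicator \<Omega>)) X"
      if "X \<in> {S. open S}" for X using eq that by simp
    show "(\<Union>n. ball 0 (real n)) = (UNIV :: (real ^ 'n ^ 'm) set)" using reals_Archimedean2 by auto
    show "emeasure (density (intensity \<mu>) (indicator \<Omega>)) (ball 0 (real n)) \<noteq> \<infinity>" for n
    proof -
      have "emeasure (density lborel (indicator \<Omega>)) (ball 0 (real n)) \<le> emeasure lborel (ball (0 :: real ^ 'n ^ 'm) (real n))"
        using \<Omega> by (simp add: emeasure_restricted emeasure_mono)
      also have "\<dots> < \<infinity>" using emeasure_lborel_ball_finite by simp
      finally show ?thesis by (simp add: eq)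
    qed
  qed (auto simp: borel_def)
  then have "emeasure (density (intensity \<mu>) (indicator \<Omega>)) A = emeasure (density lborel (indicator \<Omega>)) A"
    by simp
  moreover have "\<Omega> \<inter> A = A" using A(2) by (auto simp: \<Omega>_def)
  ultimately show ?thesis using \<Omega> A(1) by (simp add: emeasure_restricted)
qed

end

text \<open>Rogers' formula for independent tuples: rank \<open>m\<close> means that some minor is
  non-zero, and \<open>range J \<noteq> UNIV\<close> supplies \<open>i0\<close>. Splitting off one
  \<open>J\<close> at a time decomposes \<open>A\<close> into disjoint pieces, each handled by a
  single minor.\<close>

lemma intensity_full_rank:
  fixes A :: "(real ^ 'n ^ 'm) set"
  assumes haar: "haar_probability \<mu>" and A: "A \<in> sets borel"
    and rank: "\<And>Z. Z \<in> A \<Longrightarrow> \<exists>J :: 'm \<Rightarrow> 'n. range J \<noteq> UNIV \<and> det (\<chi> k a. Z $ k $ J a) \<noteq> 0"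
  shows "emeasure (intensity \<mu>) A = emeasure lborel A"
proof -
  have main: "\<forall>A :: (real ^ 'n ^ 'm) set \<in> sets borel. (\<forall>Z\<in>A. \<exists>J\<in>X. det (\<chi> k a. Z $ k $ J a) \<noteq> 0) \<longrightarrow>
      emeasure (intensity \<mu>) A = emeasure lborel A"
    if "finite X" "\<forall>J\<in>X. range J \<noteq> UNIV" for X :: "('m \<Rightarrow> 'n) set"
    using that
  proof (induction X)
    case empty
    then show ?case by auto
  next
    case (insert J X)
    then obtain i0 where "i0 \<notin> range J" by auto
    then interpret pivot i0 J by unfold_locales
    show ?case
    proof (intro ballI impI)
      fix A :: "(real ^ 'n ^ 'm) set"
      assume A: "A \<in> sets borel" and *: "\<forall>Z\<in>A. \<exists>J\<in>insert J X. det (\<chi> k a. Z $ k $ J a) \<noteq> 0"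
      define \<Omega> where "\<Omega> = {Z. det (minor Z) \<noteq> 0}"
      have "open \<Omega>" unfolding \<Omega>_def by (intro open_Collect_neq continuous_intros)
      then have \<Omega>: "\<Omega> \<in> sets borel" by simp
      have "emeasure (intensity \<mu>) (A \<inter> \<Omega>) = emeasure lborel (A \<inter> \<Omega>)"
        using A \<Omega> by (intro intensity_minor[OF haar]) (auto simp: \<Omega>_def)
      moreover have "emeasure (intensity \<mu>) (A - \<Omega>) = emeasure lborel (A - \<Omega>)"
        using insert.IH insert.prems A \<Omega> * by (auto simp: \<Omega>_def minor_def)
      moreover have "emeasure M A = emeasure M (A \<inter> \<Omega>) + emeasure M (A - \<Omega>)" if "sets M = sets borel" for M
      proof -
        have "A = (A \<inter> \<Omega>) \<union> (A - \<Omega>)" by auto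
        then show ?thesis using A \<Omega> that by (subst plus_emeasure) (auto simp: Int_Diff_Un)
      qed
      ultimately show "emeasure (intensity \<mu>) A = emeasure lborel A" by simp
    qed
  qed
  have "\<forall>Z\<in>A. \<exists>J\<in>{J. range J \<noteq> UNIV}. det (\<chi> k a. Z $ k $ J a) \<noteq> 0"
    using rank by blast
  moreover have "finite {J :: 'm \<Rightarrow> 'n. range J \<noteq> UNIV}" by (rule finite_subset[OF subset_UNIV]) simp
  ultimately show ?thesis using main[of "{J. range J \<noteq> UNIV}"] A by blast
qed

section \<open>Moments of the number of lattice points\<close>

lemma emeasure_count_space_bij:
  assumes "bij_betw f A B"
  shows "emeasure (count_space UNIV) A = emeasure (count_space UNIV) B"
  using bij_betw_finite[OF assms] bij_betw_same_card[OF assms] by (simp add: emeasure_count_space)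

lemma emeasure_count_space_image_le:
  "emeasure (count_space UNIV) (f ` A) \<le> emeasure (count_space UNIV) A"
  using card_image_le[of A f] by (auto simp: emeasure_count_space)

lemma emeasure_count_space_Times:
  "emeasure (count_space UNIV) (A \<times> A) = (emeasure (count_space UNIV) A)\<^sup>2"
proof (cases "finite A")
  case True
  then show ?thesis by (simp add: emeasure_count_space card_cartesian_product power2_eq_square)
next
  case False
  then have "infinite (A \<times> A)" using finite_cartesian_productD1[of A A] by auto
  then show ?thesis using False by (simp add: emeasure_count_space power2_eq_square)
qed

lemma lattice_sum_indicator:
  "lattice_sum (indicator A) \<Lambda> = emeasure (count_space UNIV) (tuples \<Lambda> \<inter> A)"
proof -
  have "lattice_sum (indicator A) \<Lambda> = (\<integral>\<^sup>+W. indicator A W * indicator (tuples \<Lambda>) W \<partial>count_space UNIV)"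
    unfolding lattice_sum_def by (rule nn_integral_count_space_indicator) simp
  also have "\<dots> = (\<integral>\<^sup>+W. indicator (tuples \<Lambda> \<inter> A) W \<partial>count_space UNIV)"
    by (intro nn_integral_cong) (auto split: split_indicator)
  also have "\<dots> = emeasure (count_space UNIV) (tuples \<Lambda> \<inter> A)" by (rule nn_integral_indicator) simp
  finally show ?thesis .
qed

section \<open>Counts of points and of pairs as lattice sums\<close>

definition point_count :: "(real ^ 'n) set \<Rightarrow> (real ^ 'n) set \<Rightarrow> ennreal" where
  "point_count B \<Lambda> = emeasure (count_space UNIV) (\<Lambda> \<inter> B)"

lemma point_count_lattice_sum:
  "point_count B = lattice_sum (indicator {Z :: real ^ 'n ^ 1. \<forall>k. Z $ k \<in> B})"
proof
  fix \<Lambda>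
  show "point_count B \<Lambda> = lattice_sum (indicator {Z :: real ^ 'n ^ 1. \<forall>k. Z $ k \<in> B}) \<Lambda>"
    unfolding point_count_def lattice_sum_indicator
    by (rule emeasure_count_space_bij[where f = "\<lambda>v. \<chi> k. v"], rule bij_betw_byWitness[where f' = "\<lambda>Z. Z $ 1"])
       (auto simp: tuples_def vec_eq_iff)
qed

lemma point_count_squared:
  "(point_count B \<Lambda>)\<^sup>2 = lattice_sum (indicator {Z :: real ^ 'n ^ 2. \<forall>k. Z $ k \<in> B}) \<Lambda>"
proof -
  have "bij_betw (\<lambda>(v, w). (\<chi> k. if k = 1 then v else w) :: real ^ 'n ^ 2) ((\<Lambda> \<inter> B) \<times> (\<Lambda> \<inter> B))
      (tuples \<Lambda> \<inter> {Z. \<forall>k. Z $ k \<in> B})"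
    by (rule bij_betw_byWitness[where f' = "\<lambda>Z. (Z $ 1, Z $ 2)"])
       (auto simp: tuples_def vec_eq_iff forall_2)
  from emeasure_count_space_bij[OF this] show ?thesis
    unfolding point_count_def lattice_sum_indicator emeasure_count_space_Times[symmetric] .
qed

lemma sets_tuples_in:
  assumes [measurable]: "B \<in> sets borel"
  shows "{Z :: real ^ 'n ^ 'm. \<forall>k. Z $ k \<in> B} \<in> sets borel"
proof -
  have "{Z \<in> space borel. \<forall>k. (Z :: real ^ 'n ^ 'm) $ k \<in> B} \<in> sets borel"
    by measurable
  then show ?thesis by simp
qed

lemma borel_measurable_point_count:
  assumes haar: "haar_probability \<mu>" and B: "B \<in> sets borel"
  shows "point_count B \<in> borel_measurable \<mu>"
  unfolding point_count_lattice_sum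
  by (intro borel_measurable_haar[OF haar] borel_measurable_lattice_sum_indicator sets_tuples_in B)

text \<open>Siegel's formula: a non-zero vector has a non-zero coordinate, that is, a non-zero 1 by
  1 minor.\<close>

lemma point_count_expectation:
  fixes B :: "(real ^ 'n) set"
  assumes haar: "haar_probability \<mu>" and dim: "CARD('n) \<ge> 2" and B: "B \<in> sets borel" "0 \<notin> B"
  shows "(\<integral>\<^sup>+\<Lambda>. point_count B \<Lambda> \<partial>\<mu>) = emeasure lborel B"
proof -
  let ?A = "{Z :: real ^ 'n ^ 1. \<forall>k. Z $ k \<in> B}"
  have "emeasure (intensity \<mu>) ?A = emeasure lborel ?A"
  proof (rule intensity_full_rank[OF haar sets_tuples_in[OF B(1)]])
    fix Z assume "Z \<in> ?A"
    then have "Z $ 1 \<noteq> 0" using B(2) by auto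
    then obtain i where i: "Z $ 1 $ i \<noteq> 0" by (auto simp: vec_eq_iff)
    have "range (\<lambda>_ :: 1. i) \<noteq> UNIV"
    proof
      assume "range (\<lambda>_ :: 1. i) = UNIV"
      then have "UNIV = {i}" by auto
      then have "CARD('n) = card {i}" by (rule arg_cong)
      then show False using dim by simp
    qed
    moreover have "det (\<chi> k a. Z $ k $ (\<lambda>_ :: 1. i) a) \<noteq> 0" using i by (simp add: det_1)
    ultimately show "\<exists>J :: 1 \<Rightarrow> 'n. range J \<noteq> UNIV \<and> det (\<chi> k a. Z $ k $ J a) \<noteq> 0" by blast
  qed
  also have "\<dots> = emeasure lborel B"
    using emeasure_lborel_tuples[of "\<lambda>_ :: 1. B"] B by simp
  finally show ?thesis
    unfolding point_count_lattice_sum emeasure_intensity[OF haar sets_tuples_in[OF B(1)]] .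
qed

text \<open>Reduce the ratio of one pair of coordinates to lowest terms \<open>p\<close> and
  \<open>q\<close>. Then \<open>p * L i = q * K i\<close> for all \<open>i\<close>, so coprimality
  makes \<open>p\<close> divide every coordinate of \<open>k\<close>.\<close>

lemma dependent_integer_vectors:
  fixes k l :: "real ^ 'n"
  assumes k: "k \<in> integer_vectors" "k \<noteq> 0" and l: "l \<in> integer_vectors" "l \<noteq> 0"
    and dep: "\<And>i j. k $ i * l $ j = k $ j * l $ i"
  obtains p q :: int and z where "p \<noteq> 0" "q \<noteq> 0" "z \<in> integer_vectors"
    "k = of_int p *\<^sub>R z" "l = of_int q *\<^sub>R z"
proof -
  define K where "K i = \<lfloor>k $ i\<rfloor>" for i
  have K: "k $ i = of_int (K i)" for i
    using k(1) by (simp add: integer_vectors_def K_def)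
  define L where "L i = \<lfloor>l $ i\<rfloor>" for i
  have L: "l $ i = of_int (L i)" for i
    using l(1) by (simp add: integer_vectors_def L_def)
  have dep': "K i * L j = K j * L i" for i j
    using dep[of i j] unfolding K L by (metis of_int_eq_iff of_int_mult)
  obtain j where j: "K j \<noteq> 0" using k(2) K by (auto simp: vec_eq_iff)
  then obtain d p q where pq: "K j = p * d" "L j = q * d" "coprime p q" and d: "d \<noteq> 0"
    using gcd_coprime_exists[of "K j" "L j"] by auto
  have p: "p \<noteq> 0" using pq(1) j by auto
  have pL: "p * L i = q * K i" for i
  proof -
    have "d * (p * L i) = K j * L i" by (simp add: pq(1) mult_ac)
    also have "\<dots> = L j * K i" using dep'[of i j] by (simp add: mult_ac)
    also have "\<dots> = d * (q * K i)" by (simp add: pq(2) mult_ac)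
    finally show ?thesis using d by simp
  qed
  have "p dvd K i" for i
    using pL[of i] pq(3) by (metis coprime_dvd_mult_right_iff dvd_triv_left)
  then obtain z where z: "\<And>i. K i = p * z i" unfolding dvd_def by metis
  have Lz: "L i = q * z i" for i
    using pL[of i] p unfolding z by simp
  show thesis
  proof (rule that)
    show "p \<noteq> 0" by (rule p)
    show "q \<noteq> 0" using l(2) L Lz by (auto simp: vec_eq_iff)
    show "(\<chi> i. of_int (z i)) \<in> integer_vectors" by (simp add: integer_vectors_def)
    show "k = of_int p *\<^sub>R (\<chi> i. of_int (z i))" by (simp add: vec_eq_iff K z)
    show "l = of_int q *\<^sub>R (\<chi> i. of_int (z i))" by (simp add: vec_eq_iff L Lz)
  qed
qed

text \<open>In integer coordinates with respect to a basis of the lattice the vanishing of all 2 by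
  2 minors persists, since it says that the vectors are proportional.\<close>

lemma dependent_lattice_vectors:
  fixes v w :: "real ^ 'n"
  assumes \<Lambda>: "\<Lambda> \<in> unimodular_lattices" and v: "v \<in> \<Lambda>" "v \<noteq> 0" and w: "w \<in> \<Lambda>" "w \<noteq> 0"
    and dep: "\<And>i j. v $ i * w $ j = v $ j * w $ i"
  obtains p q :: int and z where "p \<noteq> 0" "q \<noteq> 0" "z \<in> \<Lambda>" "v = of_int p *\<^sub>R z" "w = of_int q *\<^sub>R z"
proof -
  obtain A where A: "det A = 1" "\<Lambda> = lattice_of A"
    using \<Lambda> by (auto simp: unimodular_lattices_def special_linear_def)
  then obtain B where B: "B ** A = mat 1" by (metis invertible_def invertible_det_nz zero_neq_one)
  have BA: "B *v (A *v x) = x" for x using B by (simp add: matrix_vector_mul_assoc)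
  obtain k l where k: "k \<in> integer_vectors" "v = A *v k" and l: "l \<in> integer_vectors" "w = A *v l"
    using v(1) w(1) by (auto simp: A(2) lattice_of_def)
  obtain i where i: "v $ i \<noteq> 0" using v(2) by (auto simp: vec_eq_iff)
  have "w = (w $ i / v $ i) *\<^sub>R v"
    using i dep[of i] by (simp add: vec_eq_iff field_simps)
  then have "l = (w $ i / v $ i) *\<^sub>R k"
    using BA k(2) l(2) by (metis matrix_vector_mult_scaleR)
  then have "k $ a * l $ b = k $ b * l $ a" for a b by (simp add: mult_ac)
  moreover have "k \<noteq> 0" "l \<noteq> 0" using v w k l by auto
  ultimately obtain p q :: int and z where "p \<noteq> 0" "q \<noteq> 0" "z \<in> integer_vectors"
    "k = of_int p *\<^sub>R z" "l = of_int q *\<^sub>R z"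
    using dependent_integer_vectors[of k l] k l by metis
  then show thesis
    using k l by (intro that[of p q "A *v z"]) (auto simp: A(2) lattice_of_def matrix_vector_mult_scaleR)
qed

lemma emeasure_lborel_scaled_preimage:
  fixes B :: "(real ^ 'n) set"
  assumes c: "c \<noteq> 0" and B[measurable]: "B \<in> sets borel"
  shows "emeasure lborel {z. c *\<^sub>R z \<in> B} = ennreal (\<bar>c\<bar> powr (- real CARD('n))) * emeasure lborel B"
proof -
  have m: "{z. c *\<^sub>R z \<in> B} = (\<lambda>x. c *\<^sub>R x) -` B \<inter> space borel" by auto
  have "emeasure lborel B = emeasure (density (distr lborel borel (\<lambda>x. 0 + c *\<^sub>R x)) (\<lambda>_. ennreal (\<bar>c\<bar> ^ DIM(real ^ 'n)))) B"
    using lborel_affine[OF c, of 0] by metis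
  also have "\<dots> = ennreal (\<bar>c\<bar> ^ CARD('n)) * emeasure lborel {z. c *\<^sub>R z \<in> B}"
    by (subst emeasure_density_const) (simp_all add: emeasure_distr m)
  finally have "ennreal (\<bar>c\<bar> powr (- real CARD('n))) * emeasure lborel B
      = (ennreal (\<bar>c\<bar> powr (- real CARD('n))) * ennreal (\<bar>c\<bar> ^ CARD('n))) * emeasure lborel {z. c *\<^sub>R z \<in> B}"
    by (simp add: mult.assoc)
  also have "ennreal (\<bar>c\<bar> powr (- real CARD('n))) * ennreal (\<bar>c\<bar> ^ CARD('n)) = 1"
    using c by (simp add: powr_realpow[symmetric] powr_minus field_simps flip: ennreal_mult)
  finally show ?thesis by simp
qed

text \<open>An upper bound for the power \<open>- 3 / 2\<close> of
  \<open>\<bar>int_decode i\<bar>\<close>, which is at least \<open>i / 2\<close>. Two such powers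
  together bound the power \<open>- 3\<close> of the larger factor, 3 being the least dimension
  allowed, and \<open>- 3 / 2 < - 1\<close> makes the series converge. At \<open>i = 0\<close> the
  value is 0, because \<open>0 powr x = 0\<close>.\<close>

definition dependent_weight :: "nat \<Rightarrow> real" where
  "dependent_weight i = (real i / 2) powr (- 3 / 2)"

definition dependent_constant :: real where
  "dependent_constant = (\<Sum>i. dependent_weight i)\<^sup>2"

lemma summable_dependent_weight: "summable dependent_weight"
proof -
  have "summable (\<lambda>i. real i powr (- 3 / 2) * (1 / 2) powr (- 3 / 2))"
    by (intro summable_mult2) (simp add: summable_real_powr_iff)
  then show ?thesis
    by (simp add: dependent_weight_def[abs_def] powr_mult[symmetric])
qed

lemma suminf_dependent_weights:
  "(\<Sum>n. ennreal (case prod_decode n of (i, j) \<Rightarrow> dependent_weight i * dependent_weight j))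
    = ennreal dependent_constant"
proof -
  let ?w = dependent_weight
  have nn: "?w i \<ge> 0" for i by (simp add: dependent_weight_def)
  have s: "(\<Sum>i. ennreal (?w i)) = ennreal (\<Sum>i. ?w i)"
    by (rule suminf_ennreal2[OF nn summable_dependent_weight])
  have "(\<Sum>n. ennreal (case prod_decode n of (i, j) \<Rightarrow> ?w i * ?w j))
      = (\<integral>\<^sup>+n. ennreal (case prod_decode n of (i, j) \<Rightarrow> ?w i * ?w j) \<partial>count_space UNIV)"
    by (rule nn_integral_count_space_nat[symmetric])
  also have "\<dots> = (\<integral>\<^sup>+p. ennreal (case p of (i, j) \<Rightarrow> ?w i * ?w j) \<partial>count_space UNIV)"
    by (rule nn_integral_bij_count_space[OF bij_prod_decode])
  also have "\<dots> = (\<integral>\<^sup>+i. \<integral>\<^sup>+j. ennreal (?w i * ?w j) \<partial>count_space UNIV \<partial>count_space UNIV)"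
    using nn_integral_fst_count_space[of "\<lambda>p. ennreal (case p of (i, j) \<Rightarrow> ?w i * ?w j)"] by simp
  also have "\<dots> = (\<integral>\<^sup>+i. ennreal (?w i) * (\<Sum>j. ennreal (?w j)) \<partial>count_space UNIV)"
  proof (rule nn_integral_cong)
    fix i
    have "(\<integral>\<^sup>+j. ennreal (?w i * ?w j) \<partial>count_space UNIV) = (\<integral>\<^sup>+j. ennreal (?w i) * ennreal (?w j) \<partial>count_space UNIV)"
      by (simp add: ennreal_mult nn)
    also have "\<dots> = ennreal (?w i) * (\<integral>\<^sup>+j. ennreal (?w j) \<partial>count_space UNIV)"
      by (rule nn_integral_cmult) simp
    finally show "(\<integral>\<^sup>+j. ennreal (?w i * ?w j) \<partial>count_space UNIV) = ennreal (?w i) * (\<Sum>j. ennreal (?w j))"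
      by (simp only: nn_integral_count_space_nat)
  qed
  also have "\<dots> = (\<Sum>i. ennreal (?w i)) * (\<Sum>j. ennreal (?w j))"
    by (subst nn_integral_multc) (simp_all add: nn_integral_count_space_nat)
  also have "\<dots> = ennreal dependent_constant"
    unfolding s dependent_constant_def power2_eq_square
    by (rule ennreal_mult[symmetric]; intro suminf_nonneg summable_dependent_weight nn)
  finally show ?thesis .
qed

text \<open>Even codes \<open>2 * m\<close> stand for \<open>m\<close>, odd codes
  \<open>2 * m + 1\<close> for \<open>- m - 1\<close>.\<close>

lemma int_decode_ge: "real n / 2 \<le> \<bar>of_int (int_decode n)\<bar>"
proof (cases "even n")
  case True
  then show ?thesis by (auto simp: int_decode_def sum_decode_def)
next
  case False
  then obtain m where "n = 2 * m + 1" by (rule oddE)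
  then show ?thesis by (simp add: int_decode_def sum_decode_def)
qed

text \<open>The set lies in a scaled preimage of \<open>B\<close> with scaling factor of modulus
  \<open>max a b\<close>, and \<open>max a b powr (- 3)\<close> is at most the product of the powers
  \<open>- 3 / 2\<close> of \<open>a\<close> and \<open>b\<close>. The product form is what lets the
  double sum factor.\<close>

lemma dependent_measure_bound:
  fixes B :: "(real ^ 'n) set"
  assumes dim: "CARD('n) \<ge> 3" and B: "B \<in> sets borel"
    and p: "int_decode i \<noteq> 0" and q: "int_decode j \<noteq> 0"
  shows "emeasure lborel {z. of_int (int_decode i) *\<^sub>R z \<in> B \<and> of_int (int_decode j) *\<^sub>R z \<in> B}
    \<le> ennreal (dependent_weight i * dependent_weight j) * emeasure lborel B"
proof -
  define a b where "a = \<bar>of_int (int_decode i) :: real\<bar>" and "b = \<bar>of_int (int_decode j) :: real\<bar>"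
  have a: "a \<ge> 1" and b: "b \<ge> 1" using p q by (simp_all add: a_def b_def flip: of_int_abs)
  have i: "i \<noteq> 0" and j: "j \<noteq> 0"
  proof -
    have "int_decode 0 = 0" by (simp add: int_decode_def sum_decode_def)
    then show "i \<noteq> 0" "j \<noteq> 0" using p q by metis+
  qed
  let ?D = "{z. of_int (int_decode i) *\<^sub>R z \<in> B \<and> of_int (int_decode j) *\<^sub>R z \<in> B}"
  have bound: "emeasure lborel ?D \<le> ennreal (c powr (- 3)) * emeasure lborel B"
    if c: "c = a \<or> c = b" for c
  proof -
    obtain t :: int where t: "t \<noteq> 0" "c = \<bar>of_int t\<bar>" "?D \<subseteq> {z. of_int t *\<^sub>R z \<in> B}"
      using c p q unfolding a_def b_def by auto
    have "(\<lambda>z. of_int t *\<^sub>R z) -` B \<inter> space borel \<in> sets borel"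
      using B by (intro measurable_sets[of _ borel borel] borel_measurable_continuous_onI continuous_intros)
    then have m: "{z. of_int t *\<^sub>R z \<in> B} \<in> sets lborel" by (simp add: vimage_def)
    have "emeasure lborel ?D \<le> emeasure lborel {z. of_int t *\<^sub>R z \<in> B}"
      by (rule emeasure_mono[OF t(3) m])
    also have "\<dots> = ennreal (c powr (- real CARD('n))) * emeasure lborel B"
      using t B by (subst emeasure_lborel_scaled_preimage) auto
    also have "\<dots> \<le> ennreal (c powr (- 3)) * emeasure lborel B"
      using dim a b c by (intro mult_right_mono ennreal_leI powr_mono) auto
    finally show ?thesis .
  qed
  have w: "x powr (- 3 / 2) \<le> dependent_weight k" if "x = \<bar>of_int (int_decode k) :: real\<bar>" "k \<noteq> 0" for x k
    unfolding dependent_weight_def that(1) using that(2) int_decode_ge[of k] by (intro powr_mono2') auto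
  have "max a b powr (- 3) = max a b powr (- 3 / 2) * max a b powr (- 3 / 2)"
    by (simp flip: powr_add)
  also have "\<dots> \<le> a powr (- 3 / 2) * b powr (- 3 / 2)"
    using a b by (intro mult_mono powr_mono2') auto
  also have "\<dots> \<le> dependent_weight i * dependent_weight j"
    using i j by (intro mult_mono w) (auto simp: a_def b_def dependent_weight_def)
  finally have "ennreal (max a b powr (- 3)) * emeasure lborel B
      \<le> ennreal (dependent_weight i * dependent_weight j) * emeasure lborel B"
    by (intro mult_right_mono ennreal_leI) auto
  then show ?thesis
    using bound[of "max a b"] by (auto simp: max_def split: if_splits intro: order_trans)
qed

text \<open>Independent pairs contribute at most the volume of all pairs, by the formula for rank 2.
  Dependent pairs are \<open>(p z, q z)\<close>, and for fixed \<open>p\<close> and \<open>q\<close>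
  the mean number of such \<open>z\<close> is a volume. A pair may arise from several
  \<open>(p, q, z)\<close>, which is harmless for an upper bound.\<close>

lemma point_count_second_moment:
  fixes B :: "(real ^ 'n) set"
  assumes haar: "haar_probability \<mu>" and dim: "CARD('n) \<ge> 3" and B: "B \<in> sets borel" "0 \<notin> B"
  shows "(\<integral>\<^sup>+\<Lambda>. (point_count B \<Lambda>)\<^sup>2 \<partial>\<mu>) \<le> (emeasure lborel B)\<^sup>2 + ennreal dependent_constant * emeasure lborel B"
proof -
  note B(1)[measurable]
  let ?A = "{Z :: real ^ 'n ^ 2. \<forall>k. Z $ k \<in> B}"
  define A2 where "A2 = {Z \<in> ?A. \<forall>i j. Z $ 1 $ i * Z $ 2 $ j = Z $ 1 $ j * Z $ 2 $ i}"
  \<comment> \<open>A single index \<open>n\<close> codes the integers \<open>p\<close> and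
    \<open>q\<close>, so that countable subadditivity applies; codes with \<open>p = 0\<close> or
    \<open>q = 0\<close> get the empty set.\<close>
  define D where "D n = {z :: real ^ 'n. case prod_decode n of (i, j) \<Rightarrow> int_decode i \<noteq> 0 \<and> int_decode j \<noteq> 0 \<and>
      of_int (int_decode i) *\<^sub>R z \<in> B \<and> of_int (int_decode j) *\<^sub>R z \<in> B}" for n
  define g :: "nat \<Rightarrow> real ^ 'n \<Rightarrow> real ^ 'n ^ 2" where
    "g n z = (case prod_decode n of (i, j) \<Rightarrow> \<chi> k. if k = 1 then of_int (int_decode i) *\<^sub>R z else of_int (int_decode j) *\<^sub>R z)" for n z
  have A: "?A \<in> sets borel" by (rule sets_tuples_in[OF B(1)])
  have "{Z \<in> space borel. \<forall>i j. (Z :: real ^ 'n ^ 2) $ 1 $ i * Z $ 2 $ j = Z $ 1 $ j * Z $ 2 $ i} \<in> sets borel"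
    by measurable
  then have A2: "A2 \<in> sets borel"
    using sets.Int[OF A] by (simp add: A2_def Int_def)
  have D: "D n \<in> sets borel" for n
  proof -
    have "{z \<in> space borel. int_decode i \<noteq> 0 \<and> int_decode j \<noteq> 0 \<and>
      of_int (int_decode i) *\<^sub>R z \<in> B \<and> of_int (int_decode j) *\<^sub>R z \<in> B} \<in> sets borel" for i j
      by measurable
    then show ?thesis unfolding D_def by (cases "prod_decode n") simp
  qed
  have "emeasure (intensity \<mu>) (?A - A2) = emeasure lborel (?A - A2)"
  proof (rule intensity_full_rank[OF haar])
    fix Z assume "Z \<in> ?A - A2"
    then obtain i j where ij: "Z $ 1 $ i * Z $ 2 $ j \<noteq> Z $ 1 $ j * Z $ 2 $ i" by (auto simp: A2_def)
    define J :: "2 \<Rightarrow> 'n" where "J a = (if a = 1 then i else j)" for a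
    have "range J \<noteq> UNIV"
    proof
      assume "range J = UNIV"
      then have "UNIV \<subseteq> {i, j}" by (auto simp: J_def)
      then have "CARD('n) \<le> card {i, j}" by (intro card_mono) auto
      also have "\<dots> \<le> 2" by (simp add: card_insert_if)
      finally show False using dim by simp
    qed
    moreover have "det (\<chi> k a. Z $ k $ J a) \<noteq> 0" using ij by (simp add: det_2 J_def)
    ultimately show "\<exists>J :: 2 \<Rightarrow> 'n. range J \<noteq> UNIV \<and> det (\<chi> k a. Z $ k $ J a) \<noteq> 0" by blast
  qed (use A A2 in auto)
  also have "\<dots> \<le> emeasure lborel ?A" using A by (intro emeasure_mono) auto
  also have "\<dots> = (emeasure lborel B)\<^sup>2"
    using emeasure_lborel_tuples[of "\<lambda>_ :: 2. B"] B by simp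
  finally have ind: "emeasure (intensity \<mu>) (?A - A2) \<le> (emeasure lborel B)\<^sup>2" .
  have cover: "lattice_sum (indicator A2) \<Lambda> \<le> (\<Sum>n. point_count (D n) \<Lambda>)" if \<Lambda>: "\<Lambda> \<in> unimodular_lattices" for \<Lambda>
  proof -
    have "tuples \<Lambda> \<inter> A2 \<subseteq> (\<Union>n. g n ` (\<Lambda> \<inter> D n))"
    proof
      fix Z assume "Z \<in> tuples \<Lambda> \<inter> A2"
      then have Z: "Z $ 1 \<in> \<Lambda>" "Z $ 2 \<in> \<Lambda>" "Z $ 1 \<in> B" "Z $ 2 \<in> B"
        "\<And>i j. Z $ 1 $ i * Z $ 2 $ j = Z $ 1 $ j * Z $ 2 $ i"
        by (auto simp: tuples_def A2_def)
      then have "Z $ 1 \<noteq> 0" "Z $ 2 \<noteq> 0" using B(2) by auto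
      then obtain p q :: int and z where pq: "p \<noteq> 0" "q \<noteq> 0" "z \<in> \<Lambda>" "Z $ 1 = of_int p *\<^sub>R z" "Z $ 2 = of_int q *\<^sub>R z"
        using dependent_lattice_vectors[OF \<Lambda> Z(1) _ Z(2)] Z(5) by metis
      define n where "n = prod_encode (int_encode p, int_encode q)"
      have "z \<in> \<Lambda> \<inter> D n" using pq Z by (simp add: n_def D_def)
      moreover have "Z = g n z" using pq by (simp add: g_def n_def vec_eq_iff forall_2)
      ultimately show "Z \<in> (\<Union>n. g n ` (\<Lambda> \<inter> D n))" by blast
    qed
    then have "lattice_sum (indicator A2) \<Lambda> \<le> emeasure (count_space UNIV) (\<Union>n. g n ` (\<Lambda> \<inter> D n))"
      unfolding lattice_sum_indicator by (intro emeasure_mono) auto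
    also have "\<dots> \<le> (\<Sum>n. emeasure (count_space UNIV) (g n ` (\<Lambda> \<inter> D n)))"
      by (rule emeasure_subadditive_countably) auto
    also have "\<dots> \<le> (\<Sum>n. point_count (D n) \<Lambda>)"
      unfolding point_count_def by (intro suminf_le emeasure_count_space_image_le) auto
    finally show ?thesis .
  qed
  have "emeasure (intensity \<mu>) A2 \<le> (\<integral>\<^sup>+\<Lambda>. (\<Sum>n. point_count (D n) \<Lambda>) \<partial>\<mu>)"
    unfolding emeasure_intensity[OF haar A2]
    using cover by (intro nn_integral_mono) (simp add: haar_space[OF haar])
  also have "\<dots> = (\<Sum>n. \<integral>\<^sup>+\<Lambda>. point_count (D n) \<Lambda> \<partial>\<mu>)"
    by (intro nn_integral_suminf borel_measurable_point_count[OF haar] D)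
  also have "\<dots> = (\<Sum>n. emeasure lborel (D n))"
    using dim B(2) by (intro suminf_cong point_count_expectation[OF haar _ D]) (auto simp: D_def split: prod.splits)
  also have "\<dots> \<le> (\<Sum>n. ennreal (case prod_decode n of (i, j) \<Rightarrow> dependent_weight i * dependent_weight j) * emeasure lborel B)"
  proof (intro suminf_le allI)
    fix n
    obtain i j where ij: "prod_decode n = (i, j)" by (cases "prod_decode n")
    show "emeasure lborel (D n) \<le> ennreal (case prod_decode n of (i, j) \<Rightarrow> dependent_weight i * dependent_weight j) * emeasure lborel B"
    proof (cases "int_decode i \<noteq> 0 \<and> int_decode j \<noteq> 0")
      case True
      then show ?thesis using dependent_measure_bound[OF dim B(1), of i j] by (simp add: D_def ij)
    next
      case False
      then have "D n = {}" by (auto simp: D_def ij)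
      then show ?thesis by simp
    qed
  qed auto
  also have "\<dots> = ennreal dependent_constant * emeasure lborel B"
    by (simp only: ennreal_suminf_multc suminf_dependent_weights)
  finally have dep: "emeasure (intensity \<mu>) A2 \<le> ennreal dependent_constant * emeasure lborel B" .
  have "(\<integral>\<^sup>+\<Lambda>. (point_count B \<Lambda>)\<^sup>2 \<partial>\<mu>) = emeasure (intensity \<mu>) ?A"
    by (simp only: point_count_squared emeasure_intensity[OF haar A])
  also have "\<dots> = emeasure (intensity \<mu>) (?A - A2) + emeasure (intensity \<mu>) A2"
  proof -
    have "?A = (?A - A2) \<union> A2" by (auto simp: A2_def)
    then show ?thesis using A A2 by (subst plus_emeasure) auto
  qed
  also have "\<dots> \<le> (emeasure lborel B)\<^sup>2 + ennreal dependent_constant * emeasure lborel B"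
    by (rule add_mono[OF ind dep])
  finally show ?thesis .
qed

section \<open>Deviations\<close>

text \<open>Chebyshev's inequality; the square of the mean cancels \<open>a\<^sup>2\<close> in the
  second moment. A finite mean makes the count finite almost surely, so passing to reals loses
  nothing.\<close>

lemma point_count_deviation:
  fixes B :: "(real ^ 'n) set"
  assumes haar: "haar_probability \<mu>" and dim: "CARD('n) \<ge> 3" and B: "B \<in> sets borel" "0 \<notin> B"
    and a: "emeasure lborel B = ennreal a" "a \<ge> 0" and t: "t > 0"
  shows "measure \<mu> {\<Lambda> \<in> space \<mu>. t \<le> \<bar>enn2real (point_count B \<Lambda>) - a\<bar>} \<le> dependent_constant * a / t\<^sup>2"
proof -
  interpret prob_space \<mu> by (rule haar_prob[OF haar])
  define X where "X \<Lambda> = enn2real (point_count B \<Lambda>)" for \<Lambda>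
  note borel_measurable_point_count[OF haar B(1), measurable]
  have X0: "X \<Lambda> \<ge> 0" for \<Lambda> by (simp add: X_def)
  have X[measurable]: "X \<in> borel_measurable \<mu>" unfolding X_def by measurable
  have "(\<integral>\<^sup>+\<Lambda>. point_count B \<Lambda> \<partial>\<mu>) = ennreal a"
    using dim point_count_expectation[OF haar _ B] a by simp
  moreover have "AE \<Lambda> in \<mu>. point_count B \<Lambda> \<noteq> \<infinity>"
    by (rule nn_integral_PInf_AE) (simp_all add: calculation)
  then have AE: "AE \<Lambda> in \<mu>. ennreal (X \<Lambda>) = point_count B \<Lambda>"
    by eventually_elim (simp add: X_def less_top)
  ultimately have EX: "(\<integral>\<^sup>+\<Lambda>. ennreal (X \<Lambda>) \<partial>\<mu>) = ennreal a"
    using nn_integral_cong_AE[OF AE] by simp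
  have dc: "dependent_constant \<ge> 0" by (simp add: dependent_constant_def)
  have "AE \<Lambda> in \<mu>. ennreal ((X \<Lambda>)\<^sup>2) = (point_count B \<Lambda>)\<^sup>2"
    using AE by eventually_elim (simp add: ennreal_power[symmetric] X_def)
  then have "(\<integral>\<^sup>+\<Lambda>. ennreal ((X \<Lambda>)\<^sup>2) \<partial>\<mu>) = (\<integral>\<^sup>+\<Lambda>. (point_count B \<Lambda>)\<^sup>2 \<partial>\<mu>)"
    by (rule nn_integral_cong_AE)
  also have "\<dots> \<le> ennreal (a\<^sup>2 + dependent_constant * a)"
    using point_count_second_moment[OF haar dim B] a dc by (simp add: ennreal_power ennreal_mult)
  finally have EX2: "(\<integral>\<^sup>+\<Lambda>. ennreal ((X \<Lambda>)\<^sup>2) \<partial>\<mu>) \<le> ennreal (a\<^sup>2 + dependent_constant * a)" .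
  have iX: "integrable \<mu> X"
    by (rule integrableI_nonneg) (simp_all add: EX X0)
  have iX2: "integrable \<mu> (\<lambda>\<Lambda>. (X \<Lambda>)\<^sup>2)"
    using order_le_less_trans[OF EX2 ennreal_less_top] by (intro integrableI_nonneg) auto
  have eX: "expectation X = a"
    using EX a(2) by (subst integral_eq_nn_integral) (auto simp: X_def)
  have eX2: "expectation (\<lambda>\<Lambda>. (X \<Lambda>)\<^sup>2) \<le> a\<^sup>2 + dependent_constant * a"
    using EX2 a(2) dc by (subst integral_eq_nn_integral) (auto simp: enn2real_leI)
  have "variance X \<le> dependent_constant * a"
    unfolding variance_eq[OF iX iX2] using eX eX2 by simp
  then have "variance X / t\<^sup>2 \<le> dependent_constant * a / t\<^sup>2"
    by (rule divide_right_mono) simp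
  from order_trans[OF Chebyshev_inequality[OF X iX2 t] this] show ?thesis
    unfolding eX unfolding X_def .
qed

text \<open>Markov's inequality. It takes over for sets of small volume, where half of the tolerance
  is too small to absorb the origin.\<close>

lemma point_count_positive:
  fixes B :: "(real ^ 'n) set"
  assumes haar: "haar_probability \<mu>" and dim: "CARD('n) \<ge> 3" and B: "B \<in> sets borel" "0 \<notin> B"
    and a: "emeasure lborel B = ennreal a" "a \<ge> 0"
  shows "measure \<mu> {\<Lambda> \<in> space \<mu>. 1 \<le> point_count B \<Lambda>} \<le> a"
proof -
  interpret prob_space \<mu> by (rule haar_prob[OF haar])
  note borel_measurable_point_count[OF haar B(1), measurable]
  have "emeasure \<mu> {\<Lambda> \<in> space \<mu>. 1 \<le> point_count B \<Lambda>}
      = (\<integral>\<^sup>+\<Lambda>. indicator {\<Lambda> \<in> space \<mu>. 1 \<le> point_count B \<Lambda>} \<Lambda> \<partial>\<mu>)"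
    by (rule nn_integral_indicator[symmetric]) measurable
  also have "\<dots> \<le> (\<integral>\<^sup>+\<Lambda>. point_count B \<Lambda> \<partial>\<mu>)"
    by (intro nn_integral_mono) (auto split: split_indicator)
  also have "\<dots> = ennreal a"
    using dim point_count_expectation[OF haar _ B] a by simp
  finally show ?thesis using a(2) by (simp add: emeasure_eq_measure)
qed

text \<open>If the volume is zero or infinite, then \<open>measure\<close> is 0 and the strict
  inequality has 0 on the right, so it fails for every lattice. The origin belongs to every lattice;
  where the condition \<open>origin\<close> is violated, this single point already makes the count
  exceed the volume by too much.\<close>

theorem theorem1p4:
  fixes \<mu> :: "(real ^ 'n) set measure"
    and B :: "nat \<Rightarrow> (real ^ 'n) set"
    and f :: "nat \<Rightarrow> real"
  assumes dim: "CARD('n) \<ge> 3"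
    and haar: "haar_probability \<mu>"
    and meas: "\<And>k. B k \<in> sets lebesgue"
    and finite_volume: "\<forall>\<^sub>F k in sequentially. emeasure lebesgue (B k) < \<infinity>"
    and positive_volume: "\<forall>\<^sub>F k in sequentially. emeasure lebesgue (B k) > 0"
    and origin: "\<forall>\<^sub>F k in sequentially. 0 \<in> B k \<longrightarrow>
                   1 - measure lebesgue (B k) < sqrt (measure lebesgue (B k)) * f k"
    and f_pos: "\<And>k. f k > 0"
    and f_sum: "summable (\<lambda>k. 1 / (f k)\<^sup>2)"
  shows "AE \<Lambda> in \<mu>. \<exists>k0. \<forall>k\<ge>k0.
           \<bar>lattice_count \<Lambda> (B k) - ereal (measure lebesgue (B k))\<bar>
             < ereal (sqrt (measure lebesgue (B k)) * f k)"
proof -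
  interpret prob_space \<mu> by (rule haar_prob[OF haar])
  define a where "a k = measure lebesgue (B k)" for k
  define s where "s k = sqrt (a k) * f k" for k
  \<comment> \<open>A Lebesgue set differs from a Borel subset \<open>S\<close> by part of a Borel
    null set \<open>N\<close>; the moment formulas concern Borel sets only.\<close>
  have "\<forall>k. \<exists>S N. S \<in> sets borel \<and> N \<in> null_sets lborel \<and> S \<subseteq> B k \<and> B k \<subseteq> S \<union> N \<and>
      emeasure lborel S = emeasure lebesgue (B k)"
  proof
    fix k
    obtain S N N' where S: "B k = S \<union> N" "N \<subseteq> N'" "N' \<in> null_sets lborel" "S \<in> sets lborel"
      using meas[of k] by (rule sets_completionE)
    have "N \<in> null_sets lebesgue" using S(2,3) by (rule null_sets_completion_subset[OF _ null_sets_completionI])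
    then have "emeasure lebesgue (B k) = emeasure lebesgue S"
      unfolding S(1) using S(4) by (intro emeasure_Un_null_set) auto
    then show "\<exists>S N. S \<in> sets borel \<and> N \<in> null_sets lborel \<and> S \<subseteq> B k \<and> B k \<subseteq> S \<union> N \<and>
      emeasure lborel S = emeasure lebesgue (B k)"
      using S by (intro exI[of _ S] exI[of _ N']) auto
  qed
  then obtain S N where S: "\<And>k. S k \<in> sets borel" "\<And>k. S k \<subseteq> B k"
    "\<And>k. emeasure lborel (S k) = emeasure lebesgue (B k)"
    and N: "\<And>k. N k \<in> null_sets lborel" "\<And>k. B k \<subseteq> S k \<union> N k"
    by metis
  \<comment> \<open>The moment formulas require the origin to be absent; it is added back at the
    end.\<close>
  define P where "P k = S k - {0}" for k
  have P: "P k \<in> sets borel" "0 \<notin> P k" for k using S(1)[of k] by (auto simp: P_def)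
  have P_vol: "emeasure lborel (P k) = emeasure lebesgue (B k)" for k
    unfolding P_def S(3)[symmetric] using S(1)[of k] by (intro emeasure_Diff_null_set) auto
  define good where "good k \<longleftrightarrow> emeasure lebesgue (B k) < \<infinity> \<and> emeasure lebesgue (B k) > 0" for k
  have a: "emeasure lborel (P k) = ennreal (a k)" "a k > 0" if "good k" for k
  proof -
    show e: "emeasure lborel (P k) = ennreal (a k)"
      using that unfolding P_vol a_def good_def by (simp add: emeasure_eq_ennreal_measure less_top)
    show "a k > 0" using that e unfolding good_def P_vol by simp
  qed
  \<comment> \<open>The deviation is limited to \<open>s k / 2\<close>, and the other half absorbs
    the origin if \<open>s k \<ge> 2\<close>. If \<open>s k < 2\<close>, then \<open>P k\<close> has
    to be free of lattice points altogether.\<close>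
  define G where "G k = (if good k then
      {\<Lambda> \<in> space \<mu>. s k / 2 \<le> \<bar>enn2real (point_count (P k) \<Lambda>) - a k\<bar>} \<union>
      (if s k < 2 then {\<Lambda> \<in> space \<mu>. 1 \<le> point_count (P k) \<Lambda>} else {}) else {})" for k
  have [measurable]: "point_count (P k) \<in> borel_measurable \<mu>" for k
    by (rule borel_measurable_point_count[OF haar P(1)])
  have E: "{\<Lambda> \<in> space \<mu>. s k / 2 \<le> \<bar>enn2real (point_count (P k) \<Lambda>) - a k\<bar>} \<in> sets \<mu>"
    "{\<Lambda> \<in> space \<mu>. 1 \<le> point_count (P k) \<Lambda>} \<in> sets \<mu>" for k
    by measurable
  then have G: "G k \<in> sets \<mu>" for k by (simp add: G_def)
  have G_bound: "measure \<mu> (G k) \<le> (4 * dependent_constant + 4) * (1 / (f k)\<^sup>2)" for k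
  proof (cases "good k")
    case False
    then show ?thesis by (simp add: G_def dependent_constant_def)
  next
    case True
    note ak = a[OF True]
    have s: "s k > 0" using ak f_pos[of k] by (simp add: s_def)
    have s2: "(s k)\<^sup>2 = a k * (f k)\<^sup>2" using ak by (simp add: s_def power_mult_distrib)
    have "measure \<mu> {\<Lambda> \<in> space \<mu>. s k / 2 \<le> \<bar>enn2real (point_count (P k) \<Lambda>) - a k\<bar>}
        \<le> dependent_constant * a k / (s k / 2)\<^sup>2"
      using ak s by (intro point_count_deviation[OF haar dim P]) auto
    \<comment> \<open>\<open>(s k)\<^sup>2\<close> contains the factor \<open>a k\<close>, so the
      volume cancels and only the summable \<open>1 / (f k)\<^sup>2\<close> remains; the 4 comes
      from halving the tolerance.\<close>
    also have "\<dots> = 4 * dependent_constant * (1 / (f k)\<^sup>2)"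
      using ak by (simp add: power_divide s2)
    finally have 1: "measure \<mu> {\<Lambda> \<in> space \<mu>. s k / 2 \<le> \<bar>enn2real (point_count (P k) \<Lambda>) - a k\<bar>}
        \<le> 4 * dependent_constant * (1 / (f k)\<^sup>2)" .
    have 2: "measure \<mu> (if s k < 2 then {\<Lambda> \<in> space \<mu>. 1 \<le> point_count (P k) \<Lambda>} else {}) \<le> 4 * (1 / (f k)\<^sup>2)"
    proof (cases "s k < 2")
      case True
      \<comment> \<open>From \<open>s k < 2\<close> the volume is at most
        \<open>4 / (f k)\<^sup>2\<close>, so Markov's bound is summable too.\<close>
      then have "(s k)\<^sup>2 \<le> 2\<^sup>2" using s by (intro power_mono) auto
      then have "a k \<le> 4 * (1 / (f k)\<^sup>2)" using f_pos[of k] unfolding s2 by (simp add: pos_le_divide_eq)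
      then show ?thesis using True ak point_count_positive[OF haar dim P ak(1)] by simp
    qed simp
    have "measure \<mu> (G k) \<le> measure \<mu> {\<Lambda> \<in> space \<mu>. s k / 2 \<le> \<bar>enn2real (point_count (P k) \<Lambda>) - a k\<bar>}
        + measure \<mu> (if s k < 2 then {\<Lambda> \<in> space \<mu>. 1 \<le> point_count (P k) \<Lambda>} else {})"
      unfolding G_def using True by (simp only: if_True) (rule measure_Un_le; use E in simp)
    with 1 2 have "measure \<mu> (G k) \<le> 4 * dependent_constant * (1 / (f k)\<^sup>2) + 4 * (1 / (f k)\<^sup>2)"
      by linarith
    then show ?thesis by (simp only: distrib_right)
  qed
  have "AE \<Lambda> in \<mu>. \<forall>\<^sub>F k in sequentially. \<Lambda> \<in> space \<mu> - G k"
  proof (rule borel_cantelli_AE1)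
    show "summable (\<lambda>k. measure \<mu> (G k))"
      using G_bound by (intro summable_comparison_test'[OF summable_mult[OF f_sum], of 0 _ "4 * dependent_constant + 4"]) auto
  qed (auto simp: emeasure_eq_measure G)
  \<comment> \<open>By the mean value formula almost no lattice has a non-zero point in the null set
    that covers the difference between \<open>B k\<close> and its Borel part.\<close>
  moreover have "AE \<Lambda> in \<mu>. \<forall>k. point_count (N k - {0}) \<Lambda> = 0"
  proof (subst AE_all_countable, rule allI)
    fix k
    have Nk: "N k - {0} \<in> sets borel" "0 \<notin> N k - {0}" using N(1)[of k] by auto
    have "emeasure lborel (N k - {0}) \<le> emeasure lborel (N k)"
      by (rule emeasure_mono[OF Diff_subset null_setsD2[OF N(1)]])
    then have "emeasure lborel (N k - {0}) = 0"
      by (simp add: null_setsD1[OF N(1)])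
    then have "(\<integral>\<^sup>+\<Lambda>. point_count (N k - {0}) \<Lambda> \<partial>\<mu>) = 0"
      using dim point_count_expectation[OF haar _ Nk] by simp
    then show "AE \<Lambda> in \<mu>. point_count (N k - {0}) \<Lambda> = 0"
      by (simp add: nn_integral_0_iff_AE borel_measurable_point_count[OF haar Nk(1)])
  qed
  moreover have "AE \<Lambda> in \<mu>. \<forall>k. good k \<longrightarrow> point_count (P k) \<Lambda> \<noteq> \<infinity>"
  proof (subst AE_all_countable, rule allI)
    fix k
    show "AE \<Lambda> in \<mu>. good k \<longrightarrow> point_count (P k) \<Lambda> \<noteq> \<infinity>"
    proof (cases "good k")
      case True
      have "(\<integral>\<^sup>+\<Lambda>. point_count (P k) \<Lambda> \<partial>\<mu>) = ennreal (a k)"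
        using dim point_count_expectation[OF haar _ P] a[OF True] by simp
      then have "AE \<Lambda> in \<mu>. point_count (P k) \<Lambda> \<noteq> \<infinity>" by (intro nn_integral_PInf_AE) simp_all
      then show ?thesis by simp
    qed simp
  qed
  ultimately show ?thesis
    using AE_space
  proof eventually_elim
    case (elim \<Lambda>)
    have "\<Lambda> \<in> unimodular_lattices" using elim haar_space[OF haar] by simp
    then have zero: "0 \<in> \<Lambda>"
      by (auto simp: unimodular_lattices_def lattice_of_def integer_vectors_def intro!: image_eqI[of _ _ 0])
    have "\<forall>\<^sub>F k in sequentially. \<bar>lattice_count \<Lambda> (B k) - ereal (a k)\<bar> < ereal (s k)"
      using elim(1) finite_volume positive_volume origin
    proof eventually_elim
      case (elim k)
      then have gk: "good k" by (simp add: good_def)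
      note ak = a[OF gk]
      have s: "s k > 0" using ak f_pos[of k] by (simp add: s_def)
      have fin: "finite (\<Lambda> \<inter> P k)" and NN: "\<Lambda> \<inter> (N k - {0}) = {}"
        using \<open>\<forall>k. good k \<longrightarrow> point_count (P k) \<Lambda> \<noteq> \<infinity>\<close> \<open>\<forall>k. point_count (N k - {0}) \<Lambda> = 0\<close> gk
        by (auto simp: point_count_def emeasure_count_space split: if_splits)
      define c where "c = card (\<Lambda> \<inter> P k)"
      have pc: "point_count (P k) \<Lambda> = of_nat c"
        using fin by (simp add: point_count_def emeasure_count_space c_def)
      have dev: "\<bar>real c - a k\<bar> < s k / 2" and small: "s k < 2 \<Longrightarrow> c = 0"
        using elim(1) gk \<open>\<Lambda> \<in> space \<mu>\<close> by (auto simp: G_def pc not_le)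
      have eq: "\<Lambda> \<inter> B k = (\<Lambda> \<inter> P k) \<union> (if 0 \<in> B k then {0} else {})"
        using zero NN S(2)[of k] N(2)[of k] by (auto simp: P_def)
      have "lattice_count \<Lambda> (B k) = ereal (real (card (\<Lambda> \<inter> B k)))"
        using fin unfolding lattice_count_def eq by simp
      moreover have "card (\<Lambda> \<inter> B k) = (if 0 \<in> B k then c + 1 else c)"
        using fin P(2)[of k] unfolding eq c_def by simp
      moreover have "\<bar>real (if 0 \<in> B k then c + 1 else c) - a k\<bar> < s k"
      proof (cases "0 \<in> B k")
        case False
        then show ?thesis using dev s by simp
      next
        case True
        show ?thesis
        proof (cases "s k < 2")
          case False
          have "\<bar>(real c - a k) + 1\<bar> \<le> \<bar>real c - a k\<bar> + \<bar>1\<bar>" by (rule abs_triangle_ineq)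
          then have "\<bar>(real c + 1) - a k\<bar> < s k" using dev False by (simp add: algebra_simps)
          then show ?thesis using True by (simp add: add.commute)
        next
          case True
          \<comment> \<open>Here \<open>c = 0\<close> and the count is 1: \<open>origin\<close>
            bounds \<open>1 - a k\<close>, and the deviation bound gives
            \<open>a k < s k / 2\<close> for the other sign.\<close>
          then show ?thesis using dev small elim(4) \<open>0 \<in> B k\<close> by (simp add: a_def s_def)
        qed
      qed
      ultimately show ?case by simp
    qed
    then show ?case by (simp add: eventually_sequentially a_def s_def)
  qed
qed

end
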